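(* Let $K$ be an algebraically closed field, let $Q$ be a finite quiver, let $\mathcal{I}$ be an admissible ideal in the path algebra $KQ$, and let $A = KQ/\mathcal{I}$. Assume that $A$ is local, i.e. $Q$ has just one vertex. Then the following are equivalent: (i) $A$ is geometrically irreducible; (ii) $Q$ has at most one arrow; (iii) $A \cong K[X]/(X^m)$ for some $m \ge 1$.
   Context: An ideal $\mathcal{I}$ in $KQ$ is admissible if (a) it is generated by a finite set of relations, where a relation is a linear combination $\sum_{i=1}^t \lambda_i p_i$ with $\lambda_i \in K^*$ and pairwise different paths $p_i$ of length at least two, all with the same starting vertex and all with the same end vertex, and (b) there is some $m \ge 2$ such that all paths of length at least $m$ lie in $\mathcal{I}$. In particular $A$ is finite-dimensional. For $d \ge 0$ let $\operatorname{mod}(A,d)$ be the affine scheme of $d$-dimensional (left) $A$-modules, i.e. of $K$-algebra homomorphisms $A \to M_d(K)$. A finite-dimensional $K$-algebra $A$ is geometrically irreducible if for each $d \ge 0$ all connected components of $\operatorname{mod}(A,d)$ are irreducible. For $A = KQ/\mathcal{I}$ with $n$ vertices this is equivalent to: for every dimension vector $\mathbf{d} \in \mathbb{N}^n$ the affine scheme $\operatorname{rep}(A,\mathbf{d})$ is irreducible, where $\operatorname{rep}(A,\mathbf{d})$ consists of the tuples $(M(a))_a \in \prod_{a} \operatorname{Hom}_K(K^{d_{s(a)}},K^{d_{t(a)}})$ ($a$ running over the arrows of $Q$, with start $s(a)$ and end $t(a)$) that satisfy all relations in $\mathcal{I}$. *)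

theory Defs
  imports
    "HOL-Analysis.Abstract_Topological_Spaces"
    "HOL-Algebra.Algebra"
    "HOL-Algebra.Algebraic_Closure_Type"
    "HOL-Library.Poly_Mapping"
    "HOL-Computational_Algebra.Polynomial"
    "Graph_Theory.Arc_Walk"
begin

section \<open>Path algebras and admissible ideals\<close>

text \<open>
  A finite quiver is a \<^locale>\<open>fin_digraph\<close>: loops and parallel arrows are allowed, \<^const>\<open>tail\<close> is the
  start and \<^const>\<open>head\<close> the end of an arrow. A path is a pair of its start vertex and the
  list of its arrows in the order in which they are traversed; the start vertex is needed to
  distinguish the trivial paths.
\<close>

definition quiver_paths :: "('v, 'e) pre_digraph \<Rightarrow> ('v \<times> 'e list) set" where
  "quiver_paths Q = {(u, p). \<exists>v. pre_digraph.awalk Q u p v}"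

definition path_end :: "('v, 'e) pre_digraph \<Rightarrow> 'v \<times> 'e list \<Rightarrow> 'v" where
  "path_end Q p = last (pre_digraph.awalk_verts Q (fst p) (snd p))"

text \<open>
  Associative algebras over a field given by a type \<open>'k\<close> are records of type
  \<^typ>\<open>('k, 'a) module\<close>. (The library locale \<^locale>\<open>algebra\<close> is restricted to commutative algebras.)

  Arrows compose like maps, as is appropriate for left modules with arrows acting by
  \<open>M(a) : M(s(a)) \<rightarrow> M(t(a))\<close>: the product of the paths \<open>p\<close> and \<open>q\<close> is ``first \<open>q\<close>, then \<open>p\<close>''.
\<close>

definition path_algebra ::
    "('v, 'e) pre_digraph \<Rightarrow> ('k::field, ('v \<times> 'e list) \<Rightarrow>\<^sub>0 'k) module" where
  "path_algebra Q =
    \<lparr>carrier = {f. Poly_Mapping.keys f \<subseteq> quiver_paths Q},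
     monoid.mult = (\<lambda>f g. \<Sum>p\<in>Poly_Mapping.keys f. \<Sum>q\<in>Poly_Mapping.keys g.
        if path_end Q q = fst p
        then Poly_Mapping.single (fst q, snd q @ snd p) (Poly_Mapping.lookup f p * Poly_Mapping.lookup g q) else 0),
     one = (\<Sum>v\<in>verts Q. Poly_Mapping.single (v, []) 1),
     ring.zero = 0,
     add = (+),
     module.smult = (\<lambda>c f. Poly_Mapping.map (\<lambda>x. c * x) f)\<rparr>"

definition relation_in ::
    "('v, 'e) pre_digraph \<Rightarrow> (('v \<times> 'e list) \<Rightarrow>\<^sub>0 'k::field) \<Rightarrow> bool" where
  "relation_in Q r \<longleftrightarrow> r \<noteq> 0 \<and>
    (\<exists>u v. \<forall>p\<in>Poly_Mapping.keys r. fst p = u \<and> pre_digraph.awalk Q u (snd p) v \<and> 2 \<le> length (snd p))"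

definition admissible_ideal ::
    "('v, 'e) pre_digraph \<Rightarrow> (('v \<times> 'e list) \<Rightarrow>\<^sub>0 'k::field) set \<Rightarrow> bool" where
  "admissible_ideal Q I \<longleftrightarrow>
    ideal I (path_algebra Q) \<and>
    (\<exists>S. finite S \<and> (\<forall>r\<in>S. relation_in Q r) \<and> I = genideal (path_algebra Q) S) \<and>
    (\<exists>m\<ge>2. \<forall>p\<in>quiver_paths Q. m \<le> length (snd p) \<longrightarrow> Poly_Mapping.single p 1 \<in> I)"

section \<open>Quotients and isomorphisms of algebras\<close>

text \<open>
  Like \<^const>\<open>rcoset_mult\<close>, the scalar multiplication on cosets is a union over representatives; for an
  ideal that is closed under scalars all the cosets in this union agree.
\<close>

definition quotient_algebra ::
    "('k, 'a) module \<Rightarrow> 'a set \<Rightarrow> ('k, 'a set) module" where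
  "quotient_algebra A I = ring.extend (A Quot I)
     (module.fields (\<lambda>c C. \<Union>x\<in>C. I +>\<^bsub>A\<^esub> (c \<odot>\<^bsub>A\<^esub> x)))"

definition algebra_isomorphic ::
    "('k, 'a) module \<Rightarrow> ('k, 'b) module \<Rightarrow> bool" where
  "algebra_isomorphic A B \<longleftrightarrow>
    (\<exists>h\<in>ring_iso A B. \<forall>c. \<forall>x\<in>carrier A. h (c \<odot>\<^bsub>A\<^esub> x) = c \<odot>\<^bsub>B\<^esub> h x)"

definition poly_algebra :: "('k::field, 'k poly) module" where
  "poly_algebra = ring.extend ring_of_type_algebra (module.fields Polynomial.smult)"

definition truncated_poly_algebra :: "nat \<Rightarrow> ('k::field, 'k poly set) module" where
  "truncated_poly_algebra m =
    quotient_algebra poly_algebra (genideal poly_algebra {Polynomial.monom 1 m})"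

section \<open>The spectrum of a ring\<close>

definition prime_spectrum :: "('a, 'b) ring_scheme \<Rightarrow> 'a set set" where
  "prime_spectrum R = {P. primeideal P R}"

definition zariski_topology :: "('a, 'b) ring_scheme \<Rightarrow> 'a set topology" where
  "zariski_topology R =
    topology (\<lambda>U. \<exists>E\<subseteq>carrier R. U = prime_spectrum R - {P \<in> prime_spectrum R. E \<subseteq> P})"

lemma openin_zariski_topology:
  "openin (zariski_topology R) U \<longleftrightarrow>
    (\<exists>E\<subseteq>carrier R. U = prime_spectrum R - {P \<in> prime_spectrum R. E \<subseteq> P})"
proof -
  let ?D = "\<lambda>E. prime_spectrum R - {P \<in> prime_spectrum R. E \<subseteq> P}"
  have int: "\<exists>E\<subseteq>carrier R. ?D E1 \<inter> ?D E2 = ?D E"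
    if "E1 \<subseteq> carrier R" "E2 \<subseteq> carrier R" for E1 E2
  proof (cases "prime_spectrum R = {}")
    case False
    then obtain P0 where "primeideal P0 R" by (auto simp: prime_spectrum_def)
    then interpret P0: primeideal P0 R .
    let ?E = "{x \<otimes>\<^bsub>R\<^esub> y | x y. x \<in> E1 \<and> y \<in> E2}"
    have "?E \<subseteq> P \<longleftrightarrow> E1 \<subseteq> P \<or> E2 \<subseteq> P" if "primeideal P R" for P
    proof
      interpret P: primeideal P R by fact
      assume E: "?E \<subseteq> P"
      show "E1 \<subseteq> P \<or> E2 \<subseteq> P"
      proof (rule ccontr)
        assume "\<not> ?thesis"
        then obtain x y where xy: "x \<in> E1" "x \<notin> P" "y \<in> E2" "y \<notin> P" by blast
        then have "x \<otimes>\<^bsub>R\<^esub> y \<in> P" using E by blast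
        then show False using P.I_prime[of x y] xy \<open>E1 \<subseteq> carrier R\<close> \<open>E2 \<subseteq> carrier R\<close> by blast
      qed
    next
      interpret P: primeideal P R by fact
      assume *: "E1 \<subseteq> P \<or> E2 \<subseteq> P"
      show "?E \<subseteq> P"
      proof clarify
        fix x y
        assume "x \<in> E1" "y \<in> E2"
        then show "x \<otimes>\<^bsub>R\<^esub> y \<in> P"
          using * P.I_l_closed[of y x] P.I_r_closed[of x y] \<open>E1 \<subseteq> carrier R\<close> \<open>E2 \<subseteq> carrier R\<close>
          by (elim disjE) (meson subsetD)+
      qed
    qed
    then have "?D E1 \<inter> ?D E2 = ?D ?E" by (simp add: prime_spectrum_def set_eq_iff) blast
    moreover have "?E \<subseteq> carrier R" using that by (auto intro!: P0.m_closed)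
    ultimately show ?thesis by blast
  qed auto
  have "istopology (\<lambda>U. \<exists>E\<subseteq>carrier R. U = ?D E)"
    unfolding istopology_def
  proof (intro conjI allI impI)
    fix S T
    assume "\<exists>E\<subseteq>carrier R. S = ?D E" "\<exists>E\<subseteq>carrier R. T = ?D E"
    then show "\<exists>E\<subseteq>carrier R. S \<inter> T = ?D E" using int by blast
  next
    fix \<K>
    assume "\<forall>U\<in>\<K>. \<exists>E\<subseteq>carrier R. U = ?D E"
    then have "\<forall>U\<in>\<K>. \<exists>E. E \<subseteq> carrier R \<and> U = ?D E" by blast
    then obtain e where "\<forall>U\<in>\<K>. e U \<subseteq> carrier R \<and> U = ?D (e U)"
      by (rule bchoice[THEN exE])
    then have e: "\<And>U. U \<in> \<K> \<Longrightarrow> e U \<subseteq> carrier R"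
      and D: "\<And>U P. U \<in> \<K> \<Longrightarrow> P \<in> U \<longleftrightarrow> P \<in> prime_spectrum R \<and> \<not> e U \<subseteq> P"
      by blast+
    have "\<Union>\<K> = ?D (\<Union>(e ` \<K>))"
    proof (rule Set.set_eqI)
      fix P
      have "P \<in> \<Union>\<K> \<longleftrightarrow> (\<exists>U\<in>\<K>. P \<in> prime_spectrum R \<and> \<not> e U \<subseteq> P)" using D by simp
      then show "P \<in> \<Union>\<K> \<longleftrightarrow> P \<in> ?D (\<Union>(e ` \<K>))" by (auto simp: UN_subset_iff)
    qed
    moreover have "\<Union>(e ` \<K>) \<subseteq> carrier R" using e by blast
    ultimately show "\<exists>E\<subseteq>carrier R. \<Union>\<K> = ?D E" by blast
  qed
  then show ?thesis unfolding zariski_topology_def by (simp add: topology_inverse')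
qed

definition irreducible_space :: "'a topology \<Rightarrow> bool" where
  "irreducible_space T \<longleftrightarrow> topspace T \<noteq> {} \<and>
    (\<forall>C D. closedin T C \<and> closedin T D \<and> C \<union> D = topspace T \<longrightarrow>
      C = topspace T \<or> D = topspace T)"

section \<open>Module schemes\<close>

definition mpoly_ring :: "'x set \<Rightarrow> (('x \<Rightarrow>\<^sub>0 nat) \<Rightarrow>\<^sub>0 'k::field) ring" where
  "mpoly_ring V = ring_of_type_algebra
    \<lparr>carrier := {f. \<forall>m\<in>Poly_Mapping.keys f. Poly_Mapping.keys m \<subseteq> V}\<rparr>"

definition mpoly_const :: "'k::field \<Rightarrow> ('x \<Rightarrow>\<^sub>0 nat) \<Rightarrow>\<^sub>0 'k" where
  "mpoly_const c = Poly_Mapping.single 0 c"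

definition mpoly_var :: "'x \<Rightarrow> ('x \<Rightarrow>\<^sub>0 nat) \<Rightarrow>\<^sub>0 'k::field" where
  "mpoly_var x = Poly_Mapping.single (Poly_Mapping.single x 1) 1"

text \<open>
  The affine scheme \<open>mod(A,d)\<close> represents the functor that sends a commutative \<open>K\<close>-algebra \<open>R\<close>
  to the set of \<open>K\<close>-algebra homomorphisms \<open>A \<rightarrow> M\<^sub>d(R)\<close>. Its coordinate ring is
  generated by the entries \<open>x(a,i,j)\<close> of the image of each \<open>a \<in> A\<close> under the universal such
  homomorphism, subject to the equations which say that it is a homomorphism of \<open>K\<close>-algebras. Taking
  a variable for every element of \<open>A\<close> avoids the choice of generators or of a basis of \<open>A\<close>.
\<close>

definition mod_relations ::
    "('k::field, 'a) module \<Rightarrow> nat \<Rightarrow> ((('a \<times> nat \<times> nat) \<Rightarrow>\<^sub>0 nat) \<Rightarrow>\<^sub>0 'k) set" where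
  "mod_relations A d =
    {mpoly_var (a \<oplus>\<^bsub>A\<^esub> b, i, j) - (mpoly_var (a, i, j) + mpoly_var (b, i, j)) | a b i j.
        a \<in> carrier A \<and> b \<in> carrier A \<and> i < d \<and> j < d} \<union>
    {mpoly_var (c \<odot>\<^bsub>A\<^esub> a, i, j) - mpoly_const c * mpoly_var (a, i, j) | c a i j.
        a \<in> carrier A \<and> i < d \<and> j < d} \<union>
    {mpoly_var (a \<otimes>\<^bsub>A\<^esub> b, i, j) - (\<Sum>k<d. mpoly_var (a, i, k) * mpoly_var (b, k, j)) | a b i j.
        a \<in> carrier A \<and> b \<in> carrier A \<and> i < d \<and> j < d} \<union>
    {mpoly_var (\<one>\<^bsub>A\<^esub>, i, j) - (if i = j then 1 else 0) | i j. i < d \<and> j < d}"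

definition mod_coordinate_ring ::
    "('k::field, 'a) module \<Rightarrow> nat \<Rightarrow> ((('a \<times> nat \<times> nat) \<Rightarrow>\<^sub>0 nat) \<Rightarrow>\<^sub>0 'k) set ring" where
  "mod_coordinate_ring A d =
    (let R = mpoly_ring (carrier A \<times> {..<d} \<times> {..<d}) in R Quot (genideal R (mod_relations A d)))"

text \<open>
  Connectedness and irreducibility of a scheme are properties of its underlying topological space,
  which for \<open>mod(A,d)\<close> is the prime spectrum of the coordinate ring (all primes, not only the
  \<open>K\<close>-rational points).
\<close>

definition geometrically_irreducible :: "('k::field, 'a) module \<Rightarrow> bool" where
  "geometrically_irreducible A \<longleftrightarrow>
    (\<forall>d. let T = zariski_topology (mod_coordinate_ring A d) in
      \<forall>C\<in>connected_components_of T. irreducible_space (subtopology T C))"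

end

theory Submission
  imports Defs "Jordan_Normal_Form.Determinant" "HOL-Library.Function_Algebras"
begin

text \<open>
  The three properties are shown to imply each other in a circle.

  \<^bold>\<open>At most one arrow.\<close> There is at most one path of each length, and the ideal is determined by the least
  length \<open>m\<close> from which on all paths lie in it. Hence \<open>A\<close> is \<open>K[X]/(X\<^sup>m)\<close>.

  \<^bold>\<open>Truncated polynomial algebras.\<close> A \<open>d\<close>-dimensional module over \<open>K[X]/(X\<^sup>m)\<close> is a matrix \<open>M\<close> with \<open>M\<^sup>m = 0\<close>.
  A dimension count for the kernels of \<open>M\<close> on the images of its powers shows that all these matrices descend
  through flags of one and the same type (\<open>uniform_flag_labelling\<close>). So each of them is \<open>h N h\<^sup>-\<^sup>1\<close> with \<open>N\<close> in
  one fixed linear space. With the adjugate in place of the inverse, linear interpolation of \<open>h\<close> and \<open>N\<close>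
  joins any two of them by a polynomial curve of such matrices (\<open>nilpotent_matrices_joined\<close>). A curve is a
  \<open>K[t]\<close>-valued point of the module scheme, and two functions that are nonzero at one of its ends each are
  both nonzero at this point; so the spectrum of the coordinate ring is irreducible
  (\<open>irreducible_if_joined_by_curves\<close>). The spectrum contains more than the rational points, but by the
  Nullstellensatz a function that does not lie in a given prime ideal is nonzero at some rational point
  (\<open>rational_point_outside_zero_set\<close>). It is applied in the form of an extension theorem for homomorphisms
  to an algebraically closed field (\<open>extend_hom_step\<close>).

  \<^bold>\<open>Geometrically irreducible algebras.\<close> Choose a basis \<open>b\<^sub>0 = 1, b\<^sub>1, b\<^sub>2, \<dots>\<close> of \<open>A\<close> that refines the powers of
  the radical, and let \<open>A\<^sub>d\<close> be the quotient of \<open>A\<close> by the span of \<open>b\<^sub>d, b\<^bsub>d+1\<^esub>, \<dots>\<close>. The regular module \<open>A\<^sub>d\<close> is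
  cyclic, and the dual of the regular right module is cocyclic, that is, its own dual is cyclic. Both conditions are
  open, and both modules degenerate to the semisimple module of dimension \<open>d\<close>; so they lie in one connected
  component, and if that is irreducible then some module of dimension \<open>d\<close> is cyclic and cocyclic
  (\<open>cyclic_cocyclic_rep\<close>). Downward induction on \<open>d\<close> shows that this module is \<open>A\<^sub>d\<close>, whence every \<open>A\<^sub>d\<close> has
  a simple socle (\<open>simple_socle_of_quotients\<close>). If there are two arrows, then \<open>b\<^sub>1\<close> and \<open>b\<^sub>2\<close> can be chosen to
  be arrows, and both lie in the socle of \<open>A\<^sub>3\<close>, a contradiction.
\<close>

section \<open>Extending homomorphisms to an algebraically closed field\<close>

text \<open>
  A subring \<open>S\<close> of a commutative ring given by a type, together with a prime ideal \<open>P\<close> of \<open>S\<close>. The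
  pair stands for the domain \<open>S/P\<close>: the elements stay those of one type while \<open>S\<close> grows by adjunctions,
  and no cosets are needed.
\<close>

locale prime_in_subring =
  fixes S P :: "'b::comm_ring_1 set"
  assumes one_S: "1 \<in> S" and add_S: "\<And>x y. x \<in> S \<Longrightarrow> y \<in> S \<Longrightarrow> x + y \<in> S"
    and mult_S: "\<And>x y. x \<in> S \<Longrightarrow> y \<in> S \<Longrightarrow> x * y \<in> S"
    and minus_S: "\<And>x. x \<in> S \<Longrightarrow> - x \<in> S"
    and P_sub: "P \<subseteq> S" and zero_P: "0 \<in> P"
    and add_P: "\<And>x y. x \<in> P \<Longrightarrow> y \<in> P \<Longrightarrow> x + y \<in> P"
    and mult_P: "\<And>x y. x \<in> S \<Longrightarrow> y \<in> P \<Longrightarrow> x * y \<in> P"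
    and one_P: "1 \<notin> P"
    and prime_P: "\<And>x y. x \<in> S \<Longrightarrow> y \<in> S \<Longrightarrow> x * y \<in> P \<Longrightarrow> x \<in> P \<or> y \<in> P"
begin

lemma zero_S: "0 \<in> S" using P_sub zero_P by auto

lemma diff_S: "x \<in> S \<Longrightarrow> y \<in> S \<Longrightarrow> x - y \<in> S"
  using add_S[of x "-y"] minus_S[of y] by simp

lemma minus_P: "x \<in> P \<Longrightarrow> - x \<in> P"
  using mult_P[of "-1" x] minus_S[OF one_S] by simp

lemma diff_P: "x \<in> P \<Longrightarrow> y \<in> P \<Longrightarrow> x - y \<in> P"
  using add_P[of x "-y"] minus_P[of y] by simp

lemma sum_S: "(\<And>i. i \<in> I \<Longrightarrow> f i \<in> S) \<Longrightarrow> sum f I \<in> S"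
  by (induction I rule: infinite_finite_induct) (auto intro: add_S zero_S)

lemma sum_P: "(\<And>i. i \<in> I \<Longrightarrow> f i \<in> P) \<Longrightarrow> sum f I \<in> P"
  by (induction I rule: infinite_finite_induct) (auto intro: add_P zero_P)

lemma power_S: "x \<in> S \<Longrightarrow> x ^ n \<in> S"
  by (induction n) (auto intro: mult_S one_S)

lemma power_P: "x \<in> S \<Longrightarrow> x ^ n \<in> P \<Longrightarrow> x \<in> P"
  by (induction n) (use one_P prime_P power_S in auto)

end

text \<open>A homomorphism from \<open>S/P\<close> to a field, regarded as a function on \<open>S\<close>.\<close>

definition ring_hom_mod :: "'b::comm_ring_1 set \<Rightarrow> 'b set \<Rightarrow> ('b \<Rightarrow> 'k::field) \<Rightarrow> bool" where
  "ring_hom_mod S P \<phi> \<longleftrightarrow> \<phi> 1 = 1 \<and>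
     (\<forall>x\<in>S. \<forall>y\<in>S. \<phi> (x + y) = \<phi> x + \<phi> y \<and> \<phi> (x * y) = \<phi> x * \<phi> y) \<and> (\<forall>x\<in>P. \<phi> x = 0)"

definition polys_over :: "'b::comm_ring_1 set \<Rightarrow> 'b poly set" where
  "polys_over S = {p. \<forall>i. coeff p i \<in> S}"

definition adjoin :: "'b::comm_ring_1 set \<Rightarrow> 'b \<Rightarrow> 'b set" where
  "adjoin S x = (\<lambda>p. poly p x) ` polys_over S"

context prime_in_subring
begin

lemma polys_over_simps:
  "0 \<in> polys_over S"
  "p \<in> polys_over S \<Longrightarrow> q \<in> polys_over S \<Longrightarrow> p + q \<in> polys_over S"
  "p \<in> polys_over S \<Longrightarrow> q \<in> polys_over S \<Longrightarrow> p - q \<in> polys_over S"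
  "p \<in> polys_over S \<Longrightarrow> q \<in> polys_over S \<Longrightarrow> p * q \<in> polys_over S"
  "c \<in> S \<Longrightarrow> p \<in> polys_over S \<Longrightarrow> smult c p \<in> polys_over S"
  "c \<in> S \<Longrightarrow> [:c:] \<in> polys_over S"
  "c \<in> S \<Longrightarrow> Polynomial.monom c n \<in> polys_over S"
  by (auto simp: polys_over_def coeff_mult coeff_pCons zero_S add_S diff_S mult_S sum_S split: nat.splits)

text \<open>
  The leading coefficient of \<open>p\<close> need not be invertible, nor the coefficients lie in a domain; this is why
  a power of it is multiplied on \<open>g\<close> and why the degree of the quotient is recorded separately.
\<close>

lemma pseudo_division:
  assumes "g \<in> polys_over S" "p \<in> polys_over S"
  shows "\<exists>N s r. s \<in> polys_over S \<and> r \<in> polys_over S \<and>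
    smult (lead_coeff p ^ N) g = s * p + r \<and> (r = 0 \<or> degree r < degree p) \<and>
    degree s \<le> degree g - degree p"
  using assms(1)
proof (induction "degree g" arbitrary: g rule: less_induct)
  case less
  have c: "lead_coeff p \<in> S" "lead_coeff g \<in> S" using assms(2) less.prems by (auto simp: polys_over_def)
  show ?case
  proof (cases "degree g < degree p \<or> g = 0")
    case True
    then have "smult (lead_coeff p ^ 0) g = 0 * p + g" by simp
    then show ?thesis using less.prems polys_over_simps(1) True by (metis degree_0 zero_le)
  next
    case False
    define t where "t = Polynomial.monom (lead_coeff g) (degree g - degree p)"
    define g' where "g' = smult (lead_coeff p) g - t * p"
    have t: "t \<in> polys_over S" unfolding t_def using c by (intro polys_over_simps)
    have g': "g' \<in> polys_over S" unfolding g'_def using t c less.prems assms(2) by (intro polys_over_simps)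
    have dt: "degree t \<le> degree g - degree p" unfolding t_def by (rule degree_monom_le)
    have dtp: "degree (t * p) \<le> degree g"
      using degree_mult_le[of t p] dt False by linarith
    have c0: "coeff g' (degree g) = 0"
      using False by (simp add: g'_def t_def coeff_monom_mult mult.commute[of "lead_coeff g"])
    have "degree g' \<le> degree g"
      unfolding g'_def using dtp by (intro degree_diff_le) (auto intro: order_trans[OF degree_smult_le])
    moreover have "g' = 0" if "degree g' = degree g"
      using c0 unfolding that[symmetric] by simp
    ultimately have dg': "degree g' < degree g \<or> degree g = 0 \<and> g' = 0"
      by (metis degree_0 le_neq_implies_less)
    show ?thesis
    proof (cases "degree g = 0")
      case True
      with dg' have "g' = 0" by simp
      then have "smult (lead_coeff p ^ 1) g = t * p + 0" by (simp add: g'_def)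
      then show ?thesis using t polys_over_simps(1) dt by metis
    next
      case g0: False
      with dg' have "degree g' < degree g" by simp
      from less.hyps[OF this g'] obtain N s r where *: "s \<in> polys_over S" "r \<in> polys_over S"
        "smult (lead_coeff p ^ N) g' = s * p + r" "r = 0 \<or> degree r < degree p"
        "degree s \<le> degree g' - degree p" by blast
      let ?s = "s + smult (lead_coeff p ^ N) t"
      have "smult (lead_coeff p ^ Suc N) g = smult (lead_coeff p ^ N) (g' + t * p)"
        by (simp add: g'_def mult.commute)
      also have "\<dots> = ?s * p + r" by (simp add: smult_add_right *(3) algebra_simps)
      finally have "smult (lead_coeff p ^ Suc N) g = ?s * p + r" .
      moreover have "?s \<in> polys_over S" using * t c by (intro polys_over_simps power_S)
      moreover have "degree ?s \<le> degree g - degree p"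
        using *(5) dt \<open>degree g' < degree g\<close>
        by (intro degree_add_le) (auto intro: order_trans[OF degree_smult_le])
      ultimately show ?thesis using *(2,4) by blast
    qed
  qed
qed

end

lemma ring_hom_mod_props:
  assumes "prime_in_subring S P" "ring_hom_mod S P \<phi>"
  shows "\<phi> 1 = 1" "\<phi> 0 = 0"
    "\<And>x y. x \<in> S \<Longrightarrow> y \<in> S \<Longrightarrow> \<phi> (x + y) = \<phi> x + \<phi> y"
    "\<And>x y. x \<in> S \<Longrightarrow> y \<in> S \<Longrightarrow> \<phi> (x * y) = \<phi> x * \<phi> y"
    "\<And>x. x \<in> P \<Longrightarrow> \<phi> x = 0"
    "\<And>x. x \<in> S \<Longrightarrow> \<phi> (- x) = - \<phi> x"
    "\<And>x n. x \<in> S \<Longrightarrow> \<phi> (x ^ n) = \<phi> x ^ n"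
    "\<And>f I. (\<And>i. i \<in> I \<Longrightarrow> f i \<in> S) \<Longrightarrow> \<phi> (\<Sum>i\<in>I. f i) = (\<Sum>i\<in>I. \<phi> (f i))"
proof -
  interpret prime_in_subring S P by fact
  show 1: "\<phi> 1 = 1" and add: "\<And>x y. x \<in> S \<Longrightarrow> y \<in> S \<Longrightarrow> \<phi> (x + y) = \<phi> x + \<phi> y"
    and mult: "\<And>x y. x \<in> S \<Longrightarrow> y \<in> S \<Longrightarrow> \<phi> (x * y) = \<phi> x * \<phi> y"
    and "\<And>x. x \<in> P \<Longrightarrow> \<phi> x = 0"
    using assms(2) by (auto simp: ring_hom_mod_def)
  then show 0: "\<phi> 0 = 0" using zero_P by auto
  show "\<phi> (- x) = - \<phi> x" if "x \<in> S" for x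
    using add[of x "-x"] minus_S[OF that] that 0 by (simp add: eq_neg_iff_add_eq_0 add.commute)
  show "\<phi> (x ^ n) = \<phi> x ^ n" if "x \<in> S" for x n
    using that by (induction n) (auto simp: 1 mult power_S)
  show "\<phi> (\<Sum>i\<in>I. f i) = (\<Sum>i\<in>I. \<phi> (f i))" if "\<And>i. i \<in> I \<Longrightarrow> f i \<in> S" for f and I :: "'c set"
    using that by (induction I rule: infinite_finite_induct) (auto simp: 0 add sum_S)
qed

lemma map_poly_hom:
  assumes "prime_in_subring S P" "ring_hom_mod S P \<phi>"
    and "p \<in> polys_over S" "q \<in> polys_over S"
  shows "map_poly \<phi> (p + q) = map_poly \<phi> p + map_poly \<phi> q"
    and "map_poly \<phi> (p * q) = map_poly \<phi> p * map_poly \<phi> q"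
    and "c \<in> S \<Longrightarrow> map_poly \<phi> (smult c p) = smult (\<phi> c) (map_poly \<phi> p)"
proof -
  note h = ring_hom_mod_props[OF assms(1,2)]
  interpret prime_in_subring S P by fact
  have c: "coeff p i \<in> S" "coeff q i \<in> S" for i using assms(3,4) by (auto simp: polys_over_def)
  show "map_poly \<phi> (p + q) = map_poly \<phi> p + map_poly \<phi> q"
    by (rule poly_eqI) (simp add: coeff_map_poly h c)
  show "map_poly \<phi> (p * q) = map_poly \<phi> p * map_poly \<phi> q"
    by (rule poly_eqI) (simp add: coeff_map_poly h c coeff_mult mult_S)
  show "map_poly \<phi> (smult c p) = smult (\<phi> c) (map_poly \<phi> p)" if "c \<in> S"
    by (rule poly_eqI) (simp add: coeff_map_poly h c that)
qed

text \<open>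
  A homomorphism \<open>\<phi>\<close> on \<open>S\<close> and a value \<open>\<xi>\<close> for \<open>x\<close> determine a homomorphism on \<open>S[x]\<close> as soon as every
  polynomial relation of \<open>x\<close> modulo \<open>P\<close> becomes zero.
\<close>

lemma adjoin_hom:
  assumes "prime_in_subring S P" "ring_hom_mod S P \<phi>"
    and rel: "\<And>p. p \<in> polys_over S \<Longrightarrow> poly p x \<in> P \<Longrightarrow> poly (map_poly \<phi> p) \<xi> = 0"
  obtains \<psi> where "ring_hom_mod (adjoin S x) P \<psi>" "\<And>s. s \<in> S \<Longrightarrow> \<psi> s = \<phi> s"
    "\<And>p. p \<in> polys_over S \<Longrightarrow> \<psi> (poly p x) = poly (map_poly \<phi> p) \<xi>"
proof -
  note h = ring_hom_mod_props[OF assms(1,2)]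
  interpret prime_in_subring S P by fact
  note mh = map_poly_hom[OF assms(1,2)]
  define \<psi> where "\<psi> = (\<lambda>y. poly (map_poly \<phi> (SOME p. p \<in> polys_over S \<and> poly p x = y)) \<xi>)"
  have \<psi>: "\<psi> (poly p x) = poly (map_poly \<phi> p) \<xi>" if p: "p \<in> polys_over S" for p
  proof -
    define q where "q = (SOME q. q \<in> polys_over S \<and> poly q x = poly p x)"
    have q: "q \<in> polys_over S \<and> poly q x = poly p x"
      unfolding q_def by (rule someI[of _ p]) (use p in auto)
    then have "q - p \<in> polys_over S" "poly (q - p) x \<in> P"
      using p by (auto intro: polys_over_simps simp: zero_P)
    from rel[OF this] have "poly (map_poly \<phi> (q - p)) \<xi> = 0" .
    moreover have "map_poly \<phi> q = map_poly \<phi> ((q - p) + p)" by simp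
    moreover have "\<dots> = map_poly \<phi> (q - p) + map_poly \<phi> p" using q p by (intro mh polys_over_simps) auto
    ultimately show ?thesis by (simp add: \<psi>_def q_def)
  qed
  have const: "\<psi> s = \<phi> s" if "s \<in> S" for s
    using \<psi>[of "[:s:]"] that by (simp add: polys_over_simps map_poly_pCons h)
  show ?thesis
  proof (rule that[OF _ const \<psi>])
    show "ring_hom_mod (adjoin S x) P \<psi>"
      unfolding ring_hom_mod_def
    proof (intro conjI ballI)
      show "\<psi> 1 = 1" using const[OF one_S] h(1) by simp
      show "\<psi> y = 0" if "y \<in> P" for y using const[of y] P_sub h(5)[OF that] that by auto
      fix y z assume "y \<in> adjoin S x" "z \<in> adjoin S x"
      then obtain p q where pq: "p \<in> polys_over S" "q \<in> polys_over S" "y = poly p x" "z = poly q x"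
        by (auto simp: adjoin_def)
      show "\<psi> (y + z) = \<psi> y + \<psi> z"
        using \<psi>[of "p + q"] pq by (simp add: polys_over_simps \<psi> mh)
      show "\<psi> (y * z) = \<psi> y * \<psi> z"
        using \<psi>[of "p * q"] pq by (simp add: polys_over_simps \<psi> mh)
    qed
  qed
qed


lemma infinite_UNIV_alg_closed_field: "infinite (UNIV :: 'k::alg_closed_field set)"
proof
  assume fin: "finite (UNIV :: 'k set)"
  \<comment> \<open>Euclid's argument: this polynomial is \<open>1\<close> everywhere.\<close>
  define p :: "'k poly" where "p = (\<Prod>a\<in>UNIV. [:-a, 1:]) + 1"
  have "degree (\<Prod>a\<in>UNIV. [:-a, 1::'k:]) = card (UNIV :: 'k set)"
    by (subst degree_prod_eq_sum_degree) auto
  moreover have "card (UNIV :: 'k set) > 0" using fin by (simp add: card_gt_0_iff)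
  ultimately have "degree p > 0" unfolding p_def by (subst degree_add_eq_left) auto
  then obtain x where "poly p x = 0" using alg_closed_imp_poly_has_root by blast
  moreover have "poly p x = 1"
    using fin by (auto simp: p_def poly_prod prod_zero_iff)
  ultimately show False by simp
qed

text \<open>
  If \<open>x\<close> is transcendental over \<open>S/P\<close>, any value that avoids the
  zeros of one nonzero polynomial can be assigned to \<open>x\<close>. Otherwise take a polynomial \<open>p\<close> of least degree
  that vanishes at \<open>x\<close>; then \<open>x\<close> can be sent to any root of \<open>\<phi>(p)\<close> as long as \<open>\<phi>\<close> does not kill the leading
  coefficient of \<open>p\<close>, because pseudo-division by \<open>p\<close> controls all relations of \<open>x\<close>. Since \<open>b\<close> is algebraic,
  it has a nonzero multiple \<open>e\<close> in \<open>S\<close>, and \<open>\<phi>(e) \<noteq> 0\<close> keeps the image of \<open>b\<close> nonzero.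
\<close>

lemma extend_hom_step:
  fixes S P :: "'b::comm_ring_1 set"
  assumes S: "prime_in_subring S P" and T: "prime_in_subring (adjoin S x) P"
    and sub: "S \<subseteq> adjoin S x" "x \<in> adjoin S x"
    and b: "b \<in> adjoin S x" "b \<notin> P"
  shows "\<exists>a\<in>S. a \<notin> P \<and> (\<forall>\<phi> :: 'b \<Rightarrow> 'k::alg_closed_field. ring_hom_mod S P \<phi> \<longrightarrow> \<phi> a \<noteq> 0 \<longrightarrow>
     (\<exists>\<psi>. ring_hom_mod (adjoin S x) P \<psi> \<and> (\<forall>s\<in>S. \<psi> s = \<phi> s) \<and> \<psi> b \<noteq> 0))"
proof -
  interpret prime_in_subring S P by (rule S)
  interpret T: prime_in_subring "adjoin S x" P by (rule T)
  obtain q0 where q0: "q0 \<in> polys_over S" "b = poly q0 x" using b(1) by (auto simp: adjoin_def)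
  have inT: "poly p x \<in> adjoin S x" if "p \<in> polys_over S" for p using that by (auto simp: adjoin_def)
  have allP: "poly p x \<in> P" if "\<forall>i. coeff p i \<in> P" for p
    unfolding poly_altdef using that T.power_S[OF sub(2)]
    by (intro sum_P) (metis T.mult_P mult.commute)
  show ?thesis
  proof (cases "\<exists>p\<in>polys_over S. poly p x \<in> P \<and> (\<exists>i. coeff p i \<notin> P)")
    case False
    then obtain i where i: "coeff q0 i \<notin> P" using allP[of q0] b(2) q0(2) by blast
    show ?thesis
    proof (intro bexI[of _ "coeff q0 i"] conjI allI impI)
      show "coeff q0 i \<notin> P" by (rule i)
      show "coeff q0 i \<in> S" using q0 by (auto simp: polys_over_def)
      fix \<phi> :: "'b \<Rightarrow> 'k" assume \<phi>: "ring_hom_mod S P \<phi>" "\<phi> (coeff q0 i) \<noteq> 0"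
      note h = ring_hom_mod_props[OF S \<phi>(1)]
      have "map_poly \<phi> q0 \<noteq> 0" using \<phi>(2) by (metis coeff_0 coeff_map_poly h(2))
      then have "finite {\<xi>. poly (map_poly \<phi> q0) \<xi> = 0}" by (rule poly_roots_finite)
      then obtain \<xi> where \<xi>: "poly (map_poly \<phi> q0) \<xi> \<noteq> 0"
        using ex_new_if_finite[OF infinite_UNIV_alg_closed_field] by blast
      have "poly (map_poly \<phi> p) \<xi> = 0" if "p \<in> polys_over S" "poly p x \<in> P" for p
      proof -
        have "map_poly \<phi> p = 0"
          using False that h(5) by (intro poly_eqI) (auto simp: coeff_map_poly h(2))
        then show ?thesis by simp
      qed
      from adjoin_hom[OF S \<phi>(1) this] obtain \<psi> where "ring_hom_mod (adjoin S x) P \<psi>"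
        "\<And>s. s \<in> S \<Longrightarrow> \<psi> s = \<phi> s" "\<And>p. p \<in> polys_over S \<Longrightarrow> \<psi> (poly p x) = poly (map_poly \<phi> p) \<xi>" by blast
      then show "\<exists>\<psi>. ring_hom_mod (adjoin S x) P \<psi> \<and> (\<forall>s\<in>S. \<psi> s = \<phi> s) \<and> \<psi> b \<noteq> 0"
        using q0 \<xi> by auto
    qed
  next
    case True
    \<comment> \<open>The relations of \<open>x\<close> over \<open>S\<close> that are not zero modulo \<open>P\<close>.\<close>
    define N where "N = (\<lambda>p. p \<in> polys_over S \<and> poly p x \<in> P \<and> (\<exists>i. coeff p i \<notin> P))"
    obtain p where p: "N p" "\<And>g. N g \<Longrightarrow> degree p \<le> degree g"
      using True exists_least_iff[of "\<lambda>n. \<exists>p. N p \<and> degree p = n"] unfolding N_def[symmetric]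
      by (metis N_def not_le)
    have pS: "p \<in> polys_over S" and px: "poly p x \<in> P" using p by (auto simp: N_def)
    have small: "coeff g i \<in> P" if "g \<in> polys_over S" "poly g x \<in> P" "g = 0 \<or> degree g < degree p" for g i
      using p(2)[of g] that zero_P by (cases "g = 0") (auto simp: N_def)
    \<comment> \<open>Removing a leading term that lies in \<open>P\<close> does not change the class of a polynomial modulo \<open>P\<close>.\<close>
    have strip: "g - Polynomial.monom (lead_coeff g) (degree g) \<in> polys_over S"
      "poly g x - poly (g - Polynomial.monom (lead_coeff g) (degree g)) x \<in> P"
      "degree g > 0 \<Longrightarrow> degree (g - Polynomial.monom (lead_coeff g) (degree g)) < degree g"
      "coeff (g - Polynomial.monom (lead_coeff g) (degree g)) i \<in> P \<longleftrightarrow> coeff g i \<in> P"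
      if "g \<in> polys_over S" "lead_coeff g \<in> P" for g i
    proof -
      let ?g = "g - Polynomial.monom (lead_coeff g) (degree g)"
      show "?g \<in> polys_over S" using that P_sub by (intro polys_over_simps) auto
      have "x ^ degree g * lead_coeff g \<in> P"
        using that T.power_S[OF sub(2)] by (intro T.mult_P) auto
      then show "poly g x - poly ?g x \<in> P" by (simp add: poly_monom mult.commute)
      show "degree ?g < degree g" if "degree g > 0"
      proof -
        have "degree ?g \<le> degree g" by (intro degree_diff_le degree_monom_le) auto
        moreover have "coeff ?g (degree g) = 0" by simp
        ultimately show ?thesis using that by (metis degree_0 eq_zero_or_degree_less)
      qed
      show "coeff ?g i \<in> P \<longleftrightarrow> coeff g i \<in> P" using that zero_P by auto
    qed
    have lcp: "lead_coeff p \<notin> P"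
    proof
      assume l: "lead_coeff p \<in> P"
      let ?g = "p - Polynomial.monom (lead_coeff p) (degree p)"
      have "degree p > 0"
      proof (rule ccontr)
        assume "\<not> degree p > 0"
        then have "coeff p i \<in> P" for i using l zero_P by (cases i) (auto simp: coeff_eq_0)
        then show False using p(1) by (auto simp: N_def)
      qed
      moreover have "poly ?g x \<in> P"
        using diff_P[OF px strip(2)[OF pS l]] by simp
      then have "N ?g"
        unfolding N_def using strip(1,4)[OF pS l] p(1) by (auto simp: N_def)
      ultimately show False using p(2) strip(3)[OF pS l] by (meson not_le)
    qed
    have lcpS: "lead_coeff p \<in> S" using pS by (auto simp: polys_over_def)
    have deg_p: "degree p > 0"
    proof (rule ccontr)
      assume "\<not> degree p > 0"
      then have "p = [:lead_coeff p:]" using degree_0_id[of p] by simp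
      then have "poly p x = lead_coeff p" by (metis poly_pCons poly_0 mult_zero_right add_0_right)
      then show False using px lcp by simp
    qed
    \<comment> \<open>The polynomials whose value at \<open>x\<close> is, modulo \<open>P\<close>, a nonzero multiple of \<open>b\<close>. One of least degree
      turns out to be a constant, the element \<open>e\<close> of \<open>S\<close>.\<close>
    define M where "M = (\<lambda>q. q \<in> polys_over S \<and> poly q x \<notin> P \<and>
      (\<exists>u\<in>polys_over S. poly q x - poly u x * b \<in> P))"
    have M_red: "\<exists>q. M q \<and> degree q < degree p"
    proof -
      obtain n s r where nsr: "s \<in> polys_over S" "r \<in> polys_over S"
        "smult (lead_coeff p ^ n) q0 = s * p + r" "r = 0 \<or> degree r < degree p"
        using pseudo_division[OF q0(1) pS] by blast
      have "lead_coeff p ^ n * b = poly s x * poly p x + poly r x"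
        using arg_cong[OF nsr(3), of "\<lambda>q. poly q x"] q0 by simp
      moreover have sp: "poly s x * poly p x \<in> P" using inT nsr px by (intro T.mult_P) auto
      ultimately have r: "poly r x - poly [:lead_coeff p ^ n:] x * b \<in> P"
        using minus_P[OF sp] by (simp add: algebra_simps)
      have lb: "lead_coeff p ^ n * b \<notin> P"
        using T.prime_P[of "lead_coeff p ^ n" b] b power_P[OF lcpS] lcp power_S[OF lcpS] sub by auto
      have "poly r x \<notin> P"
      proof
        assume "poly r x \<in> P"
        from diff_P[OF this r] lb show False by simp
      qed
      moreover from this have "r \<noteq> 0" using zero_P by auto
      moreover have "[:lead_coeff p ^ n:] \<in> polys_over S" using lcpS by (intro polys_over_simps power_S)
      ultimately show ?thesis using nsr r unfolding M_def by blast
    qed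
    obtain q where q: "M q" "\<And>g. M g \<Longrightarrow> degree q \<le> degree g"
      using M_red exists_least_iff[of "\<lambda>n. \<exists>p. M p \<and> degree p = n"] by (metis not_le)
    have dq: "degree q < degree p" using q(2) M_red by fastforce
    have qS: "q \<in> polys_over S" and qx: "poly q x \<notin> P" using q(1) by (auto simp: M_def)
    obtain u where u: "u \<in> polys_over S" "poly q x - poly u x * b \<in> P" using q(1) by (auto simp: M_def)
    have lcq: "lead_coeff q \<notin> P"
    proof
      assume l: "lead_coeff q \<in> P"
      let ?g = "q - Polynomial.monom (lead_coeff q) (degree q)"
      note st = strip[OF qS l]
      have g: "poly ?g x \<notin> P" using st(2) qx add_P by (metis diff_add_cancel)
      have "degree q > 0"
      proof (rule ccontr)
        assume "\<not> degree q > 0"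
        then have "coeff q i \<in> P" for i using l zero_P by (cases i) (auto simp: coeff_eq_0)
        then show False using allP qx by auto
      qed
      moreover have "poly ?g x - poly u x * b \<in> P"
        using diff_P[OF u(2) st(2)] by (simp add: algebra_simps)
      then have "M ?g" unfolding M_def using st(1) g u(1) by blast
      ultimately show False using q(2) st(3) by (meson not_le)
    qed
    have lcqS: "lead_coeff q \<in> S" using qS by (auto simp: polys_over_def)
    have deg_q: "degree q = 0"
    proof (rule ccontr)
      assume "degree q \<noteq> 0"
      obtain n s t where nst: "s \<in> polys_over S" "t \<in> polys_over S"
        "smult (lead_coeff q ^ n) p = s * q + t" "t = 0 \<or> degree t < degree q"
        "degree s \<le> degree p - degree q"
        using pseudo_division[OF pS qS] by blast
      have eq: "lead_coeff q ^ n * poly p x = poly s x * poly q x + poly t x"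
        using arg_cong[OF nst(3), of "\<lambda>q. poly q x"] by simp
      have lp: "lead_coeff q ^ n * poly p x \<in> P" using px power_S[OF lcqS] by (intro mult_P) auto
      have "poly t x - poly (- (s * u)) x * b =
        lead_coeff q ^ n * poly p x - poly s x * (poly q x - poly u x * b)"
        using eq by (simp add: algebra_simps)
      also have "\<dots> \<in> P" by (rule diff_P[OF lp T.mult_P[OF inT[OF nst(1)] u(2)]])
      finally have tb: "poly t x - poly (- (s * u)) x * b \<in> P" .
      have su: "- (s * u) \<in> polys_over S"
        using polys_over_simps(3)[OF polys_over_simps(1), of "s * u"] polys_over_simps(4) nst(1) u(1) by simp
      have tP: "poly t x \<in> P"
      proof (rule ccontr)
        assume "poly t x \<notin> P"
        then have "M t" unfolding M_def using nst(2) tb su by blast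
        moreover have "t \<noteq> 0" using \<open>poly t x \<notin> P\<close> zero_P by auto
        ultimately show False using q(2)[of t] nst(4) by auto
      qed
      have tc: "coeff t i \<in> P" for i using small[OF nst(2) tP] nst(4) dq by auto
      have "poly s x * poly q x = lead_coeff q ^ n * poly p x - poly t x" using eq by simp
      then have "poly s x * poly q x \<in> P" using diff_P[OF lp tP] by simp
      then have "poly s x \<in> P" using T.prime_P[OF inT[OF nst(1)] inT[OF qS]] qx by blast
      moreover have "degree s < degree p" using nst(5) \<open>degree q \<noteq> 0\<close> dq by linarith
      ultimately have sc: "coeff s i \<in> P" for i using small[OF nst(1)] by blast
      have "coeff (smult (lead_coeff q ^ n) p) (degree p) \<in> P"
        unfolding nst(3) coeff_add coeff_mult
        by (intro add_P sum_P tc) (metis sc mult_P mult.commute qS polys_over_def mem_Collect_eq)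
      then have "lead_coeff q ^ n * lead_coeff p \<in> P" by simp
      then show False
        using prime_P[OF power_S[OF lcqS] lcpS] lcp power_P[OF lcqS] lcq by blast
    qed
    define e where "e = lead_coeff q"
    have "q = [:e:]" using deg_q degree_0_id[of q] by (simp add: e_def)
    then have qe: "poly q x = e" by simp
    show ?thesis
    proof (intro bexI[of _ "lead_coeff p * e"] conjI allI impI)
      show "lead_coeff p * e \<in> S" unfolding e_def by (intro mult_S lcpS lcqS)
      show "lead_coeff p * e \<notin> P" using prime_P[OF lcpS lcqS] lcp lcq by (auto simp: e_def)
      fix \<phi> :: "'b \<Rightarrow> 'k" assume \<phi>: "ring_hom_mod S P \<phi>" "\<phi> (lead_coeff p * e) \<noteq> 0"
      note h = ring_hom_mod_props[OF S \<phi>(1)]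
      note mh = map_poly_hom[OF S \<phi>(1)]
      have \<phi>p: "\<phi> (lead_coeff p) \<noteq> 0" and \<phi>e: "\<phi> e \<noteq> 0" using \<phi>(2) h(4)[OF lcpS lcqS] by (auto simp: e_def)
      have "coeff (map_poly \<phi> p) (degree p) \<noteq> 0" using \<phi>p by (simp add: coeff_map_poly h)
      then have "degree (map_poly \<phi> p) > 0" using deg_p le_degree by fastforce
      then obtain \<xi> where \<xi>: "poly (map_poly \<phi> p) \<xi> = 0"
        using alg_closed_imp_poly_has_root by blast
      have "poly (map_poly \<phi> g) \<xi> = 0" if g: "g \<in> polys_over S" "poly g x \<in> P" for g
      proof -
        obtain n s r where nsr: "s \<in> polys_over S" "r \<in> polys_over S"
          "smult (lead_coeff p ^ n) g = s * p + r" "r = 0 \<or> degree r < degree p"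
          using pseudo_division[OF g(1) pS] by blast
        have "poly r x = lead_coeff p ^ n * poly g x - poly s x * poly p x"
          using arg_cong[OF nsr(3), of "\<lambda>q. poly q x"] by simp
        also have "\<dots> \<in> P"
          by (rule diff_P[OF mult_P[OF power_S[OF lcpS] g(2)] T.mult_P[OF inT[OF nsr(1)] px]])
        finally have "map_poly \<phi> r = 0"
          using small[OF nsr(2)] nsr(4) h(5) by (intro poly_eqI) (auto simp: coeff_map_poly h(2))
        moreover have "smult (\<phi> (lead_coeff p ^ n)) (map_poly \<phi> g) = map_poly \<phi> s * map_poly \<phi> p + map_poly \<phi> r"
          using arg_cong[OF nsr(3), of "map_poly \<phi>"] mh(3)[OF g(1) g(1) power_S[OF lcpS]]
            mh(1)[OF polys_over_simps(4)[OF nsr(1) pS] nsr(2)] mh(2)[OF nsr(1) pS] by metis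
        ultimately have "\<phi> (lead_coeff p) ^ n * poly (map_poly \<phi> g) \<xi> = 0"
          using \<xi> h(7)[OF lcpS] by (metis add_0_right mult_zero_right poly_mult poly_smult)
        then show ?thesis using \<phi>p by simp
      qed
      from adjoin_hom[OF S \<phi>(1) this] obtain \<psi> where \<psi>: "ring_hom_mod (adjoin S x) P \<psi>"
        "\<And>s. s \<in> S \<Longrightarrow> \<psi> s = \<phi> s" by blast
      note k = ring_hom_mod_props[OF T \<psi>(1)]
      have "e = (e - poly u x * b) + poly u x * b" by simp
      then have "\<psi> e = \<psi> (e - poly u x * b) + \<psi> (poly u x * b)"
        using k(3)[of "e - poly u x * b" "poly u x * b"] inT[OF u(1)] u(2) qe b(1) T.P_sub
        by (metis T.mult_S subsetD)
      also have "\<dots> = \<psi> (poly u x) * \<psi> b" using k(5) u(2) qe k(4) inT[OF u(1)] b(1) by auto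
      finally have "\<psi> b \<noteq> 0" using \<psi>(2)[of e] \<phi>e lcqS by (auto simp: e_def)
      then show "\<exists>\<psi>. ring_hom_mod (adjoin S x) P \<psi> \<and> (\<forall>s\<in>S. \<psi> s = \<phi> s) \<and> \<psi> b \<noteq> 0"
        using \<psi> by blast
    qed
  qed
qed

lemma prime_in_subring_adjoin:
  assumes C: "prime_in_subring C P" and S: "prime_in_subring S P" and "S \<subseteq> C" "x \<in> C"
  shows "prime_in_subring (adjoin S x) P" "S \<subseteq> adjoin S x" "x \<in> adjoin S x" "adjoin S x \<subseteq> C"
proof -
  interpret C: prime_in_subring C P by (rule C)
  interpret prime_in_subring S P by (rule S)
  show sub: "S \<subseteq> adjoin S x"
  proof
    fix s assume "s \<in> S"
    then have "poly [:s:] x \<in> adjoin S x" unfolding adjoin_def by (intro imageI polys_over_simps)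
    then show "s \<in> adjoin S x" by simp
  qed
  have "poly [:0,1:] x \<in> adjoin S x" unfolding adjoin_def
    by (intro imageI) (auto simp: polys_over_def coeff_pCons zero_S one_S split: nat.splits)
  then show "x \<in> adjoin S x" by simp
  show subC: "adjoin S x \<subseteq> C"
    using assms(3,4) by (auto simp: adjoin_def polys_over_def poly_altdef intro!: C.sum_S C.mult_S C.power_S)
  show "prime_in_subring (adjoin S x) P"
  proof
    show "1 \<in> adjoin S x" using sub one_S by auto
    show "y + z \<in> adjoin S x" "y * z \<in> adjoin S x" if yz: "y \<in> adjoin S x" "z \<in> adjoin S x" for y z
    proof -
      obtain p q where "p \<in> polys_over S" "q \<in> polys_over S" "y = poly p x" "z = poly q x"
        using yz by (auto simp: adjoin_def)
      then show "y + z \<in> adjoin S x" "y * z \<in> adjoin S x"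
        by (auto simp: adjoin_def polys_over_simps simp flip: poly_add poly_mult)
    qed
    show "- y \<in> adjoin S x" if "y \<in> adjoin S x" for y
    proof -
      from that obtain p where "p \<in> polys_over S" "y = poly p x" unfolding adjoin_def by blast
      then have "- y = poly (0 - p) x" "0 - p \<in> polys_over S" by (auto intro: polys_over_simps simp del: diff_0)
      then show ?thesis unfolding adjoin_def by blast
    qed
    show "P \<subseteq> adjoin S x" using P_sub sub by auto
    show "0 \<in> P" "1 \<notin> P" by (auto simp: zero_P one_P)
    show "y + z \<in> P" if "y \<in> P" "z \<in> P" for y z using that by (rule add_P)
    show "y * z \<in> P" if "y \<in> adjoin S x" "z \<in> P" for y z using that subC C.mult_P by auto
    show "y \<in> P \<or> z \<in> P" if "y \<in> adjoin S x" "z \<in> adjoin S x" "y * z \<in> P" for y z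
      using that subC C.prime_P by blast
  qed
qed

text \<open>
  The Nullstellensatz in the form of Chevalley: adjoining the elements of \<open>xs\<close> one after the other, the
  condition that \<open>b\<close> is not killed is pulled back to the condition that one nonzero element \<open>a\<close> of \<open>S/P\<close> is
  not killed.
\<close>

lemma extend_hom_adjoin_list:
  fixes S P :: "'b::comm_ring_1 set"
  assumes "prime_in_subring C P" "prime_in_subring S P" "S \<subseteq> C" "set xs \<subseteq> C"
    and gen: "\<And>T. prime_in_subring T P \<Longrightarrow> S \<subseteq> T \<Longrightarrow> set xs \<subseteq> T \<Longrightarrow> T \<subseteq> C \<Longrightarrow> b \<in> T"
    and b: "b \<notin> P"
  shows "\<exists>a\<in>S. a \<notin> P \<and> (\<forall>\<phi> :: 'b \<Rightarrow> 'k::alg_closed_field. ring_hom_mod S P \<phi> \<longrightarrow> \<phi> a \<noteq> 0 \<longrightarrow>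
     (\<exists>\<psi> T. prime_in_subring T P \<and> S \<subseteq> T \<and> set xs \<subseteq> T \<and> T \<subseteq> C \<and>
        ring_hom_mod T P \<psi> \<and> (\<forall>s\<in>S. \<psi> s = \<phi> s) \<and> \<psi> b \<noteq> 0))"
  using assms(2-5)
proof (induction xs arbitrary: S)
  case Nil
  have "b \<in> S" using Nil.prems by auto
  show ?case
  proof (intro bexI[OF _ \<open>b \<in> S\<close>] conjI b allI impI)
    fix \<phi> :: "'b \<Rightarrow> 'k" assume "ring_hom_mod S P \<phi>" "\<phi> b \<noteq> 0"
    then show "\<exists>\<psi> T. prime_in_subring T P \<and> S \<subseteq> T \<and> set [] \<subseteq> T \<and> T \<subseteq> C \<and>
        ring_hom_mod T P \<psi> \<and> (\<forall>s\<in>S. \<psi> s = \<phi> s) \<and> \<psi> b \<noteq> 0"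
      using Nil.prems(1,2) by (intro exI[of _ \<phi>] exI[of _ S] conjI) auto
  qed
next
  case (Cons x xs)
  have x: "x \<in> C" using Cons.prems by auto
  note ad = prime_in_subring_adjoin[OF assms(1) Cons.prems(1,2) x]
  have "\<exists>a\<in>adjoin S x. a \<notin> P \<and> (\<forall>\<phi> :: 'b \<Rightarrow> 'k. ring_hom_mod (adjoin S x) P \<phi> \<longrightarrow> \<phi> a \<noteq> 0 \<longrightarrow>
     (\<exists>\<psi> T. prime_in_subring T P \<and> adjoin S x \<subseteq> T \<and> set xs \<subseteq> T \<and> T \<subseteq> C \<and>
        ring_hom_mod T P \<psi> \<and> (\<forall>s\<in>adjoin S x. \<psi> s = \<phi> s) \<and> \<psi> b \<noteq> 0))"
  proof (rule Cons.IH[OF ad(1,4)])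
    show "set xs \<subseteq> C" using Cons.prems by auto
    show "b \<in> T" if "prime_in_subring T P" "adjoin S x \<subseteq> T" "set xs \<subseteq> T" "T \<subseteq> C" for T
      using Cons.prems(4)[of T] that ad(2,3) by auto
  qed
  then obtain a' where a': "a' \<in> adjoin S x" "a' \<notin> P"
    "\<And>\<phi> :: 'b \<Rightarrow> 'k. ring_hom_mod (adjoin S x) P \<phi> \<Longrightarrow> \<phi> a' \<noteq> 0 \<Longrightarrow>
     (\<exists>\<psi> T. prime_in_subring T P \<and> adjoin S x \<subseteq> T \<and> set xs \<subseteq> T \<and> T \<subseteq> C \<and>
        ring_hom_mod T P \<psi> \<and> (\<forall>s\<in>adjoin S x. \<psi> s = \<phi> s) \<and> \<psi> b \<noteq> 0)" by blast
  obtain a where a: "a \<in> S" "a \<notin> P" "\<And>\<phi> :: 'b \<Rightarrow> 'k. ring_hom_mod S P \<phi> \<Longrightarrow> \<phi> a \<noteq> 0 \<Longrightarrow>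
     (\<exists>\<psi>. ring_hom_mod (adjoin S x) P \<psi> \<and> (\<forall>s\<in>S. \<psi> s = \<phi> s) \<and> \<psi> a' \<noteq> 0)"
    using extend_hom_step[OF Cons.prems(1) ad(1,2,3) a'(1,2), where ?'k = 'k] by blast
  show ?case
  proof (intro bexI[OF _ a(1)] conjI a(2) allI impI)
    fix \<phi> :: "'b \<Rightarrow> 'k" assume "ring_hom_mod S P \<phi>" "\<phi> a \<noteq> 0"
    from a(3)[OF this] obtain \<psi>' where \<psi>': "ring_hom_mod (adjoin S x) P \<psi>'" "\<forall>s\<in>S. \<psi>' s = \<phi> s" "\<psi>' a' \<noteq> 0"
      by blast
    from a'(3)[OF this(1,3)] obtain \<psi> T where T: "prime_in_subring T P" "adjoin S x \<subseteq> T" "set xs \<subseteq> T" "T \<subseteq> C"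
      "ring_hom_mod T P \<psi>" "\<forall>s\<in>adjoin S x. \<psi> s = \<psi>' s" "\<psi> b \<noteq> 0" by blast
    have 1: "S \<subseteq> T" and 2: "set (x # xs) \<subseteq> T" using T(2,3) ad(2,3) by auto
    have 3: "\<forall>s\<in>S. \<psi> s = \<phi> s" using T(6) \<psi>'(2) ad(2) by (metis subsetD)
    show "\<exists>\<psi> T. prime_in_subring T P \<and> S \<subseteq> T \<and> set (x # xs) \<subseteq> T \<and> T \<subseteq> C \<and>
        ring_hom_mod T P \<psi> \<and> (\<forall>s\<in>S. \<psi> s = \<phi> s) \<and> \<psi> b \<noteq> 0"
      by (rule exI[of _ \<psi>], rule exI[of _ T], intro conjI 1 2 3 T(1,4,5,7))
  qed
qed

section \<open>Nilpotent matrices of bounded nilpotency index\<close>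

context vector_space
begin

lemma finite_dim_basis:
  assumes V: "subspace V" "V \<subseteq> span F" "finite F" and B0: "B0 \<subseteq> V" "independent B0"
  obtains B where "B0 \<subseteq> B" "finite B" "B \<subseteq> V" "independent B" "span B = V" "card B = dim V"
proof -
  obtain B where B: "B0 \<subseteq> B" "B \<subseteq> V" "independent B" "V \<subseteq> span B"
    using maximal_independent_subset_extend[OF B0] by blast
  have "finite B" using independent_span_bound[OF V(3) B(3)] B(2) V(2) by blast
  moreover have "span B = V" using B(2,4) V(1) by (simp add: span_subspace)
  moreover have "card B = dim V" using basis_card_eq_dim[OF B(2,4,3)] .
  ultimately show ?thesis using that B by blast
qed

lemma span_Int_trivial:
  assumes "independent (A \<union> B)" "A \<inter> B = {}" "x \<in> span A" "x \<in> span B"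
  shows "x = 0"
proof -
  have "representation A x = representation B x"
    using representation_extend[OF assms(1,3)] representation_extend[OF assms(1,4)] by auto
  then have "representation A x b = 0" for b
    using representation_ne_zero[of A x b] representation_ne_zero[of B x b] assms(2) by auto
  moreover have "independent A" using assms(1) independent_mono by blast
  ultimately show ?thesis using sum_nonzero_representation_eq[of A x] assms(3) by auto
qed

lemma rank_nullity:
  assumes T: "Vector_Spaces.linear scale scale T" and V: "subspace V" "V \<subseteq> span F" "finite F"
  shows "dim (T ` V) + dim {v\<in>V. T v = 0} = dim V"
proof -
  interpret T: Vector_Spaces.linear scale scale T by (rule T)
  let ?K = "{v\<in>V. T v = 0}"
  have K: "subspace ?K"
    using V(1) by (auto simp: subspace_def T.add T.scale)
  have KF: "?K \<subseteq> span F" using V(2) by auto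
  obtain A where A0: "{} \<subseteq> A" and A: "finite A" "A \<subseteq> ?K" "independent A" "span A = ?K" "card A = dim ?K"
    by (rule finite_dim_basis[OF K KF V(3) empty_subsetI independent_empty])
  have AV: "A \<subseteq> V" using A(2) by auto
  obtain B where B: "A \<subseteq> B" "finite B" "B \<subseteq> V" "independent B" "span B = V" "card B = dim V"
    by (rule finite_dim_basis[OF V AV A(3)])
  let ?E = "B - A"
  have AE: "A \<union> ?E = B" using B(1) by auto
  have inj: "inj_on T (span ?E)"
  proof (rule T.inj_on_iff_eq_0[THEN iffD2, OF subspace_span], safe)
    fix x assume x: "x \<in> span ?E" "T x = 0"
    moreover have "x \<in> V" using x(1) B(5) span_mono[of ?E B] by auto
    ultimately have "x \<in> span A" using A(4) by auto
    then show "x = 0" using span_Int_trivial[of A ?E x] x(1) B(4) AE by auto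
  qed
  have "independent ?E" using B(4) independent_mono by blast
  then have ind: "independent (T ` ?E)" by (rule T.independent_inj_on_image[OF _ inj])
  have "T ` V = span (T ` B)" unfolding T.span_image B(5) ..
  also have "\<dots> = span (T ` ?E)"
  proof (rule span_eq[THEN iffD2], intro conjI)
    show "T ` ?E \<subseteq> span (T ` B)" using span_superset by blast
    have "T b \<in> span (T ` ?E)" if "b \<in> B" for b
    proof (cases "b \<in> A")
      case True
      then have "T b = 0" using A(2) by auto
      then show ?thesis by (simp add: span_zero)
    qed (use that in \<open>auto intro: span_base\<close>)
    then show "T ` B \<subseteq> span (T ` ?E)" by blast
  qed
  finally have "dim (T ` V) = card (T ` ?E)" using dim_span_eq_card_independent[OF ind] by simp
  also have "\<dots> = card ?E" using inj span_superset[of ?E] by (metis card_image inj_on_subset)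
  also have "\<dots> = dim V - dim ?K" using A B by (simp add: card_Diff_subset)
  finally show ?thesis using A(5) B(6) card_mono[OF B(2,1)] by simp
qed

lemma intermediate_subspace:
  assumes U: "subspace U" "U \<subseteq> V" and V: "subspace V" "V \<subseteq> span F" "finite F"
    and k: "dim U \<le> k" "k \<le> dim V"
  obtains W where "subspace W" "U \<subseteq> W" "W \<subseteq> V" "dim W = k"
proof -
  have UF: "U \<subseteq> span F" using U(2) V(2) by auto
  obtain A where A0: "{} \<subseteq> A" and A: "finite A" "A \<subseteq> U" "independent A" "span A = U" "card A = dim U"
    by (rule finite_dim_basis[OF U(1) UF V(3) empty_subsetI independent_empty])
  have AV: "A \<subseteq> V" using A(2) U(2) by auto
  obtain B where B: "A \<subseteq> B" "finite B" "B \<subseteq> V" "independent B" "span B = V" "card B = dim V"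
    by (rule finite_dim_basis[OF V AV A(3)])
  obtain C where C: "A \<subseteq> C" "C \<subseteq> B" "card C = k"
    using exists_subset_between[of A k B] A B k by auto
  show ?thesis
  proof
    show "U \<subseteq> span C" using A(4) span_mono[OF C(1)] by auto
    show "span C \<subseteq> V" using B(5) span_mono[OF C(2)] by auto
    show "dim (span C) = k" using C B(4) independent_mono dim_span_eq_card_independent by metis
  qed auto
qed

lemma funpow_linear: "Vector_Spaces.linear scale scale T \<Longrightarrow> Vector_Spaces.linear scale scale (T ^^ n)"
proof (induction n)
  case 0
  then show ?case by (simp add: linear_id id_def[symmetric])
next
  case (Suc n)
  then show ?case using Vector_Spaces.linear_compose[of scale scale "T ^^ n" scale T] by (simp only: funpow.simps)
qed

text \<open>
  The kernels of \<open>T\<close> on the subspaces \<open>T\<^sup>i V\<close> decrease with \<open>i\<close>, and their dimensions add up to \<open>dim V\<close>.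
  Comparing the first and the last of these summands with their average gives both bounds.
\<close>

lemma nilpotent_dim_bounds:
  assumes T: "Vector_Spaces.linear scale scale T" and V: "subspace V" "V \<subseteq> span F" "finite F"
    and inv: "T ` V \<subseteq> V" and nil: "\<And>v. v \<in> V \<Longrightarrow> (T ^^ Suc m) v = 0"
  shows "dim (T ` V) \<le> dim V - dim V div Suc m" "dim V - dim V div Suc m \<le> dim {v\<in>V. (T ^^ m) v = 0}"
proof -
  interpret T: Vector_Spaces.linear scale scale T by (rule T)
  define U where "U i = (T ^^ i) ` V" for i
  define n where "n i = dim {v\<in>U i. T v = 0}" for i
  have U_Suc: "U (Suc i) = T ` U i" for i by (auto simp: U_def image_comp)
  have U_sub: "U (Suc i) \<subseteq> U i" for i
    using inv unfolding U_def funpow_Suc_right image_comp[symmetric] by blast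
  have U: "subspace (U i)" "U i \<subseteq> span F" for i
  proof -
    interpret Ti: Vector_Spaces.linear scale scale "T ^^ i" by (rule funpow_linear[OF T])
    show "subspace (U i)" unfolding U_def by (rule Ti.subspace_image[OF V(1)])
    have "U i \<subseteq> V"
    proof (induction i)
      case 0
      then show ?case by (simp add: U_def)
    next
      case (Suc i)
      then show ?case using U_sub[of i] by (rule order_trans[rotated])
    qed
    then show "U i \<subseteq> span F" using V(2) by auto
  qed
  have rn: "dim (U (Suc i)) + n i = dim (U i)" for i
    unfolding U_Suc n_def by (rule rank_nullity[OF T U V(3)])
  have n_dec: "n (Suc i) \<le> n i" for i
  proof -
    have "subspace {v\<in>U i. T v = 0}"
      using U(1)[of i] by (auto simp: subspace_def T.add T.scale)
    moreover have "{v\<in>U i. T v = 0} \<subseteq> span F" using U(2)[of i] by auto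
    ultimately obtain B where "{} \<subseteq> B" and B: "finite B" "B \<subseteq> {v\<in>U i. T v = 0}" "independent B"
      "span B = {v\<in>U i. T v = 0}" "card B = dim {v\<in>U i. T v = 0}"
      by (rule finite_dim_basis[OF _ _ V(3) empty_subsetI independent_empty])
    have "{v\<in>U (Suc i). T v = 0} \<subseteq> span B" unfolding B(4) using U_sub[of i] by auto
    from dim_le_card[OF this B(1)] show ?thesis unfolding n_def B(5) .
  qed
  have n_mono: "i \<le> j \<Longrightarrow> n j \<le> n i" for i j using lift_Suc_antimono_le[of n i j] n_dec by blast
  have "U (Suc m) \<subseteq> {0}" using nil by (auto simp: U_def)
  then have dim_last: "dim (U (Suc m)) = 0" using dim_le_card[of "U (Suc m)" "{}"] by simp
  have sum: "(\<Sum>i<k. n i) + dim (U k) = dim V" for k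
  proof (induction k)
    case 0
    then show ?case by (simp add: U_def)
  next
    case (Suc k)
    then show ?case using rn[of k] by simp
  qed
  have total: "(\<Sum>i<Suc m. n i) = dim V" using sum[of "Suc m"] dim_last by simp
  have "(\<Sum>i<Suc m. n i) \<le> (\<Sum>i<Suc m. n 0)" by (intro sum_mono n_mono) auto
  then have "dim V \<le> Suc m * n 0" using total by simp
  then have n0: "dim V div Suc m \<le> n 0"
    by (metis div_le_mono nonzero_mult_div_cancel_left nat.distinct(1))
  have "(\<Sum>i<Suc m. n m) \<le> (\<Sum>i<Suc m. n i)" by (intro sum_mono n_mono) auto
  then have "Suc m * n m \<le> dim V" using total by simp
  then have nm: "n m \<le> dim V div Suc m"
    by (metis div_le_mono nonzero_mult_div_cancel_left nat.distinct(1))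
  show "dim (T ` V) \<le> dim V - dim V div Suc m"
    using rn[of 0] n0 by (simp add: U_def)
  have "dim ((T ^^ m) ` V) + dim {v\<in>V. (T ^^ m) v = 0} = dim V"
    by (rule rank_nullity[OF funpow_linear[OF T] V])
  moreover have "dim (U m) = n m" using rn[of m] dim_last by simp
  ultimately show "dim V - dim V div Suc m \<le> dim {v\<in>V. (T ^^ m) v = 0}"
    using nm by (simp add: U_def)
qed

text \<open>
  A labelling \<open>l\<close> of the basis indices by \<open>0, \<dots>, m-1\<close> prescribes the dimensions of a flag of length \<open>m\<close>
  through which \<open>T\<close> has to descend. The point is that one labelling serves all \<open>T\<close> with \<open>T\<^sup>m = 0\<close>: by
  the preceding bounds a member of dimension \<open>dim V - \<lfloor>dim V / m\<rfloor>\<close> fits between \<open>T V\<close> and the kernel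
  of \<open>T\<^sup>m\<^sup>-\<^sup>1\<close>, and the remaining members are found inside it.
\<close>

lemma uniform_flag_labelling:
  "\<exists>l. (\<forall>i<d. l i < Suc m) \<and> (\<forall>T V F. Vector_Spaces.linear scale scale T \<longrightarrow> subspace V \<longrightarrow> V \<subseteq> span F \<longrightarrow> finite F \<longrightarrow>
      dim V = d \<longrightarrow> T ` V \<subseteq> V \<longrightarrow> (\<forall>v\<in>V. (T ^^ Suc m) v = 0) \<longrightarrow>
      (\<exists>u. inj_on u {..<d} \<and> independent (u ` {..<d}) \<and> span (u ` {..<d}) = V \<and>
        (\<forall>j<d. T (u j) \<in> span (u ` {i. i < d \<and> l i < l j}))))"
proof (induction m arbitrary: d)
  case 0
  show ?case
  proof (intro exI[of _ "\<lambda>_. 0 :: nat"] conjI allI impI)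
    fix T :: "'b \<Rightarrow> 'b" and V F
    assume *: "subspace V" "V \<subseteq> span F" "finite F" "dim V = d" "\<forall>v\<in>V. (T ^^ Suc 0) v = 0"
    obtain B where "{} \<subseteq> B" and B: "finite B" "B \<subseteq> V" "independent B" "span B = V" "card B = dim V"
      by (rule finite_dim_basis[OF *(1-3) empty_subsetI independent_empty])
    obtain u where "bij_betw u {0..<d} B" using ex_bij_betw_nat_finite[OF B(1)] B(5) *(4) by auto
    then have u: "inj_on u {..<d}" "u ` {..<d} = B" by (auto simp: bij_betw_def atLeast0LessThan)
    have "T (u j) = 0" if "j < d" for j using *(5) u(2) B(2) that by auto
    then show "\<exists>u. inj_on u {..<d} \<and> independent (u ` {..<d}) \<and> span (u ` {..<d}) = V \<and>
        (\<forall>j<d. T (u j) \<in> span (u ` {i. i < d \<and> (0::nat) < 0}))"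
      using u B by (intro exI[of _ u]) (auto simp: span_zero)
  qed auto
next
  case (Suc m)
  define d' where "d' = d - d div Suc (Suc m)"
  have d': "d' \<le> d" by (simp add: d'_def)
  obtain l where l: "\<forall>i<d'. l i < Suc m" and flag: "\<And>T V F. Vector_Spaces.linear scale scale T \<Longrightarrow> subspace V \<Longrightarrow>
      V \<subseteq> span F \<Longrightarrow> finite F \<Longrightarrow> dim V = d' \<Longrightarrow> T ` V \<subseteq> V \<Longrightarrow> (\<forall>v\<in>V. (T ^^ Suc m) v = 0) \<Longrightarrow>
      (\<exists>u. inj_on u {..<d'} \<and> independent (u ` {..<d'}) \<and> span (u ` {..<d'}) = V \<and>
        (\<forall>j<d'. T (u j) \<in> span (u ` {i. i < d' \<and> l i < l j})))"
    using Suc.IH[of d'] by blast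
  define l' where "l' i = (if i < d' then l i else Suc m)" for i
  show ?case
  proof (intro exI[of _ l'] conjI allI impI)
    show "l' i < Suc (Suc m)" if "i < d" for i using l that by (auto simp: l'_def less_Suc_eq)
    fix T V F
    assume *: "Vector_Spaces.linear scale scale T" "subspace V" "V \<subseteq> span F" "finite F" "dim V = d"
      "T ` V \<subseteq> V" "\<forall>v\<in>V. (T ^^ Suc (Suc m)) v = 0"
    interpret T: Vector_Spaces.linear scale scale T by (rule *(1))
    interpret Tm: Vector_Spaces.linear scale scale "T ^^ Suc m" by (rule funpow_linear[OF *(1)])
    let ?N = "{v\<in>V. (T ^^ Suc m) v = 0}"
    have b: "dim (T ` V) \<le> d'" "d' \<le> dim ?N"
      using nilpotent_dim_bounds[OF *(1-4,6), of "Suc m"] *(5,7) unfolding d'_def by auto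
    have N: "subspace ?N" using *(2) unfolding subspace_def by (auto simp: Tm.add Tm.scale simp del: funpow.simps)
    have TVN: "T ` V \<subseteq> ?N"
      using *(6,7) unfolding funpow_Suc_right[of "Suc m"] by (auto simp del: funpow.simps)
    have NF: "?N \<subseteq> span F" using *(3) by auto
    obtain W where W: "subspace W" "T ` V \<subseteq> W" "W \<subseteq> ?N" "dim W = d'"
      by (rule intermediate_subspace[OF T.subspace_image[OF *(2)] TVN N NF *(4) b])
    have WF: "W \<subseteq> span F" and WV: "W \<subseteq> V" using W(3) *(3) by auto
    have "T ` W \<subseteq> W" "\<forall>v\<in>W. (T ^^ Suc m) v = 0" using W(2,3) by auto
    from flag[OF *(1) W(1) WF *(4) W(4) this] obtain u where u: "inj_on u {..<d'}"
      "independent (u ` {..<d'})" "span (u ` {..<d'}) = W"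
      "\<And>j. j < d' \<Longrightarrow> T (u j) \<in> span (u ` {i. i < d' \<and> l i < l j})" by blast
    have uV: "u ` {..<d'} \<subseteq> V" using u(3) WV span_superset[of "u ` {..<d'}"] by auto
    obtain B where B: "u ` {..<d'} \<subseteq> B" "finite B"
      "B \<subseteq> V" "independent B" "span B = V" "card B = dim V"
      by (rule finite_dim_basis[OF *(2-4) uV u(2)])
    have "card (B - u ` {..<d'}) = card {d'..<d}"
      using B u(1) *(5) by (simp add: card_Diff_subset card_image)
    then obtain w where w: "bij_betw w {d'..<d} (B - u ` {..<d'})"
      using finite_same_card_bij[of "{d'..<d}" "B - u ` {..<d'}"] B(2) by auto
    define v where "v i = (if i < d' then u i else w i)" for i
    have v1: "v ` A = u ` A" if "A \<subseteq> {..<d'}" for A using that by (auto simp: v_def image_def)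
    have "{..<d} = {..<d'} \<union> {d'..<d}" using d' by auto
    moreover have "v ` {d'..<d} = B - u ` {..<d'}" using w by (auto simp: v_def bij_betw_def)
    ultimately have vB: "v ` {..<d} = B" using v1[of "{..<d'}"] B(1) by (auto simp: image_Un)
    have "card (v ` {..<d}) = card {..<d}" using vB B(6) *(5) by simp
    then have "inj_on v {..<d}" by (intro eq_card_imp_inj_on) auto
    moreover have "T (v j) \<in> span (v ` {i. i < d \<and> l' i < l' j})" if j: "j < d" for j
    proof (cases "j < d'")
      case True
      have "u ` {i. i < d' \<and> l i < l j} = v ` {i. i < d' \<and> l i < l j}" by (rule v1[symmetric]) auto
      also have "\<dots> \<subseteq> v ` {i. i < d \<and> l' i < l' j}" using d' True by (auto simp: l'_def)
      finally have "T (u j) \<in> span (v ` {i. i < d \<and> l' i < l' j})"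
        by (rule subsetD[OF span_mono u(4)[OF True]])
      moreover have "v j = u j" using True by (simp add: v_def)
      ultimately show ?thesis by (simp only:)
    next
      case False
      have "v j \<in> V" using vB B(3) j by auto
      then have *: "T (v j) \<in> span (u ` {..<d'})" using W(2) u(3) by auto
      have "u ` {..<d'} = v ` {..<d'}" by (rule v1[symmetric]) auto
      also have "\<dots> \<subseteq> v ` {i. i < d \<and> l' i < l' j}" using d' False l by (intro image_mono) (auto simp: l'_def)
      finally show ?thesis by (rule subsetD[OF span_mono *])
    qed
    ultimately show "\<exists>u. inj_on u {..<d} \<and> independent (u ` {..<d}) \<and> span (u ` {..<d}) = V \<and>
        (\<forall>j<d. T (u j) \<in> span (u ` {i. i < d \<and> l' i < l' j}))"
      using vB B(4,5) by blast
  qed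
qed

end

interpretation fun_vs: vector_space "\<lambda>(c::'k::field) (f :: nat \<Rightarrow> 'k) i. c * f i"
  by unfold_locales (auto simp: plus_fun_def algebra_simps)

lemma sum_fun_apply: "(\<Sum>x\<in>A. f x) i = (\<Sum>x\<in>A. f x (i::nat) :: 'k::comm_monoid_add)"
  by (induction A rule: infinite_finite_induct) (auto simp: plus_fun_def zero_fun_def)

lemma fun_vs_span_image:
  assumes "x \<in> fun_vs.span (u ` A)" "inj_on u A" "finite A"
  obtains c where "\<And>i. x i = (\<Sum>a\<in>A. c a * u a i)"
proof -
  obtain g where g: "x = (\<Sum>v\<in>u ` A. (\<lambda>i. g v * v i))"
    using assms by (auto simp: fun_vs.span_finite)
  show ?thesis
    by (rule that[of "\<lambda>a. g (u a)"]) (simp add: g sum_fun_apply sum.reindex[OF assms(2)])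
qed

text \<open>
  The flag lemma for matrices, with the flag adapted to a basis. The condition on \<open>N\<close> describes a linear
  space of matrices that is the same for all \<open>M\<close>; this is what makes it possible to interpolate between
  two nilpotent matrices.
\<close>

lemma nilpotent_matrix_normal_form:
  obtains l :: "nat \<Rightarrow> nat" where "\<And>i. i < d \<Longrightarrow> l i < Suc m"
    "\<And>M. M \<in> carrier_mat d d \<Longrightarrow> M ^\<^sub>m Suc m = 0\<^sub>m d d \<Longrightarrow>
      \<exists>h N. h \<in> carrier_mat d d \<and> N \<in> carrier_mat d d \<and> det h \<noteq> (0 :: 'k::field) \<and> M * h = h * N \<and>
        (\<forall>i<d. \<forall>j<d. N $$ (i, j) \<noteq> 0 \<longrightarrow> l i < l j)"
proof -
  let ?sc = "\<lambda>(c::'k) (f :: nat \<Rightarrow> 'k) i. c * f i"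
  obtain l :: "nat \<Rightarrow> nat" where l: "\<forall>i<d. l i < Suc m"
    and flag: "\<And>T V F. Vector_Spaces.linear ?sc ?sc T \<Longrightarrow> fun_vs.subspace V \<Longrightarrow> V \<subseteq> fun_vs.span F \<Longrightarrow> finite F \<Longrightarrow>
      fun_vs.dim V = d \<Longrightarrow> T ` V \<subseteq> V \<Longrightarrow> (\<forall>v\<in>V. (T ^^ Suc m) v = 0) \<Longrightarrow>
      (\<exists>u. inj_on u {..<d} \<and> fun_vs.independent (u ` {..<d}) \<and> fun_vs.span (u ` {..<d}) = V \<and>
        (\<forall>j<d. T (u j) \<in> fun_vs.span (u ` {i. i < d \<and> l i < l j})))"
    using fun_vs.uniform_flag_labelling[of d m] by blast
  define e :: "nat \<Rightarrow> nat \<Rightarrow> 'k" where "e j i = (if i = j then 1 else 0)" for i j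
  define V where "V = {f :: nat \<Rightarrow> 'k. \<forall>i\<ge>d. f i = 0}"
  have V: "fun_vs.subspace V" by (auto simp: V_def fun_vs.subspace_def plus_fun_def zero_fun_def)
  have inj_e: "inj_on e A" for A by (rule inj_onI) (metis e_def zero_neq_one)
  have "f = (\<Sum>j<d. ?sc (f j) (e j))" if "f \<in> V" for f
    using that by (auto simp: fun_eq_iff sum_fun_apply e_def V_def if_distrib[of "\<lambda>x. _ * x"] cong: if_cong)
  moreover have "(\<Sum>j<d. ?sc (f j) (e j)) \<in> fun_vs.span (e ` {..<d})" for f
    by (rule fun_vs.span_sum, rule fun_vs.span_scale, rule fun_vs.span_base) auto
  ultimately have VF: "V \<subseteq> fun_vs.span (e ` {..<d})"
  proof -
    assume 1: "\<And>f. f \<in> V \<Longrightarrow> f = (\<Sum>j<d. ?sc (f j) (e j))"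
      and 2: "\<And>f :: nat \<Rightarrow> 'k. (\<Sum>j<d. ?sc (f j) (e j)) \<in> fun_vs.span (e ` {..<d})"
    show ?thesis
    proof
      fix f assume "f \<in> V"
      show "f \<in> fun_vs.span (e ` {..<d})" by (subst 1[OF \<open>f \<in> V\<close>]) (rule 2)
    qed
  qed
  have ind: "fun_vs.independent (e ` {..<d})"
  proof (rule fun_vs.independent_if_scalars_zero)
    fix f x assume s: "(\<Sum>x\<in>e ` {..<d}. ?sc (f x) x) = 0" and "x \<in> e ` {..<d}"
    then obtain j where j: "x = e j" "j < d" by auto
    have "0 = (\<Sum>x\<in>e ` {..<d}. ?sc (f x) x) j" using s by (simp add: zero_fun_def)
    also have "\<dots> = (\<Sum>i<d. f (e i) * e i j)" by (simp add: sum_fun_apply sum.reindex[OF inj_e])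
    also have "\<dots> = f (e j)" using j(2) by (simp add: e_def if_distrib[of "\<lambda>x. _ * x"] cong: if_cong)
    finally show "f x = 0" using j by simp
  qed auto
  have eV: "e ` {..<d} \<subseteq> V" by (auto simp: V_def e_def)
  have dimV: "fun_vs.dim V = d"
    using fun_vs.basis_card_eq_dim[OF eV VF ind] card_image[OF inj_e] by simp
  have "\<exists>h N. h \<in> carrier_mat d d \<and> N \<in> carrier_mat d d \<and> det h \<noteq> (0 :: 'k::field) \<and> M * h = h * N \<and>
        (\<forall>i<d. \<forall>j<d. N $$ (i, j) \<noteq> 0 \<longrightarrow> l i < l j)"
    if M: "M \<in> carrier_mat d d" "M ^\<^sub>m Suc m = 0\<^sub>m d d" for M
  proof -
    define T :: "(nat \<Rightarrow> 'k) \<Rightarrow> nat \<Rightarrow> 'k" where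
      "T f i = (if i < d then \<Sum>j<d. M $$ (i, j) * f j else 0)" for f i
    have T: "Vector_Spaces.linear ?sc ?sc T"
      by unfold_locales
        (auto simp: T_def plus_fun_def fun_eq_iff sum.distrib distrib_left sum_distrib_left mult.left_commute)
    have TV: "T f \<in> V" for f by (simp add: V_def T_def)
    have "(T ^^ k) f i = (\<Sum>j<d. (M ^\<^sub>m k) $$ (i, j) * f j)" if "f \<in> V" "i < d" for k f i
      using that
    proof (induction k arbitrary: f)
      case 0
      then show ?case using M(1) by (auto simp: if_distrib[of "\<lambda>x. x * _"] cong: if_cong)
    next
      case (Suc k)
      have Mk: "M ^\<^sub>m k \<in> carrier_mat d d" using M(1) by (rule pow_carrier_mat)
      have "(T ^^ Suc k) f i = (T ^^ k) (T f) i" by (simp add: funpow_swap1)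
      also have "\<dots> = (\<Sum>j<d. (M ^\<^sub>m k) $$ (i, j) * (\<Sum>n<d. M $$ (j, n) * f n))"
        unfolding Suc.IH[OF TV Suc.prems(2)] by (intro sum.cong) (auto simp: T_def)
      also have "\<dots> = (\<Sum>n<d. (\<Sum>j<d. (M ^\<^sub>m k) $$ (i, j) * M $$ (j, n)) * f n)"
        unfolding sum_distrib_left sum_distrib_right by (subst sum.swap) (simp add: mult.assoc)
      also have "\<dots> = (\<Sum>n<d. (M ^\<^sub>m Suc k) $$ (i, n) * f n)"
        using M(1) Mk Suc.prems(2) by (auto simp: scalar_prod_def atLeast0LessThan intro!: sum.cong)
      finally show ?case .
    qed
    note power_T = this
    have nil: "\<forall>v\<in>V. (T ^^ Suc m) v = 0"
    proof (intro ballI ext)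
      fix v i assume v: "v \<in> V"
      show "(T ^^ Suc m) v i = 0 i"
      proof (cases "i < d")
        case True
        have "(T ^^ Suc m) v i = (\<Sum>j<d. (M ^\<^sub>m Suc m) $$ (i, j) * v j)" by (rule power_T[OF v True])
        also have "\<dots> = 0" unfolding M(2) using True by simp
        finally show ?thesis by (simp only: zero_fun_def)
      qed (simp add: T_def zero_fun_def)
    qed
    obtain u where u: "inj_on u {..<d}" "fun_vs.span (u ` {..<d}) = V"
      "\<And>j. j < d \<Longrightarrow> T (u j) \<in> fun_vs.span (u ` {i. i < d \<and> l i < l j})"
    proof -
      have "T ` V \<subseteq> V" using TV by auto
      from flag[OF T V VF finite_imageI[OF finite_lessThan] dimV this nil] show ?thesis using that by blast
    qed
    define h where "h = mat d d (\<lambda>(i, j). u j i)"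
    have "\<exists>c. \<forall>i. e j i = (\<Sum>k<d. c k * u k i)" if "j < d" for j
    proof -
      have "e j \<in> fun_vs.span (u ` {..<d})" using eV u(2) that by auto
      from fun_vs_span_image[OF this u(1)] show ?thesis by blast
    qed
    then obtain g where g: "\<And>j i. j < d \<Longrightarrow> e j i = (\<Sum>k<d. g j k * u k i)" by metis
    have "h * mat d d (\<lambda>(k, j). g j k) = 1\<^sub>m d"
      by (rule eq_matI) (auto simp: h_def scalar_prod_def atLeast0LessThan mult.commute g[symmetric] e_def)
    then have "det h * det (mat d d (\<lambda>(k, j). g j k)) = 1"
      using det_mult[of h d "mat d d (\<lambda>(k, j). g j k)"] by (simp add: h_def)
    then have deth: "det h \<noteq> 0" by auto
    have "\<exists>c. (\<forall>i. T (u j) i = (\<Sum>k<d. c k * u k i)) \<and> (\<forall>k<d. c k \<noteq> 0 \<longrightarrow> l k < l j)" if j: "j < d" for j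
    proof -
      let ?A = "{i. i < d \<and> l i < l j}"
      have "inj_on u ?A" using u(1) by (rule inj_on_subset) auto
      from fun_vs_span_image[OF u(3)[OF j] this] obtain c where
        c: "\<And>i. T (u j) i = (\<Sum>k\<in>?A. c k * u k i)" by auto
      have "(\<Sum>k\<in>?A. c k * u k i) = (\<Sum>k<d. (if l k < l j then c k else 0) * u k i)" for i
        by (rule sum.mono_neutral_cong_left) auto
      then show ?thesis using c by (intro exI[of _ "\<lambda>k. if l k < l j then c k else 0"]) auto
    qed
    then obtain c where c: "\<And>j i. j < d \<Longrightarrow> T (u j) i = (\<Sum>k<d. c j k * u k i)"
      "\<And>j k. j < d \<Longrightarrow> k < d \<Longrightarrow> c j k \<noteq> 0 \<Longrightarrow> l k < l j" by metis
    have "M * h = h * mat d d (\<lambda>(k, j). c j k)"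
    proof (rule eq_matI)
      fix i j assume "i < dim_row (h * mat d d (\<lambda>(k, j). c j k))" "j < dim_col (h * mat d d (\<lambda>(k, j). c j k))"
      then have ij: "i < d" "j < d" by (auto simp: h_def)
      have "(M * h) $$ (i, j) = T (u j) i"
        using ij M(1) by (simp add: T_def h_def scalar_prod_def atLeast0LessThan)
      also have "\<dots> = (h * mat d d (\<lambda>(k, j). c j k)) $$ (i, j)"
        using ij c(1) by (simp add: h_def scalar_prod_def atLeast0LessThan mult.commute)
      finally show "(M * h) $$ (i, j) = (h * mat d d (\<lambda>(k, j). c j k)) $$ (i, j)" .
    qed (use M(1) in \<open>auto simp: h_def\<close>)
    then show ?thesis
      using deth c(2) by (intro exI[of _ h] exI[of _ "mat d d (\<lambda>(k, j). c j k)"]) (auto simp: h_def)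
  qed
  then show ?thesis using that l by blast
qed

section \<open>Evaluating polynomials\<close>

definition monomial_value :: "('x \<Rightarrow> 'r::comm_ring_1) \<Rightarrow> ('x \<Rightarrow>\<^sub>0 nat) \<Rightarrow> 'r" where
  "monomial_value \<rho> m = (\<Prod>x\<in>Poly_Mapping.keys m. \<rho> x ^ Poly_Mapping.lookup m x)"

definition mpoly_eval ::
    "('k::field \<Rightarrow> 'r::comm_ring_1) \<Rightarrow> ('x \<Rightarrow> 'r) \<Rightarrow> (('x \<Rightarrow>\<^sub>0 nat) \<Rightarrow>\<^sub>0 'k) \<Rightarrow> 'r" where
  "mpoly_eval \<iota> \<rho> f = (\<Sum>m\<in>Poly_Mapping.keys f. \<iota> (Poly_Mapping.lookup f m) * monomial_value \<rho> m)"

lemma poly_mapping_sum_single: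
  "f = (\<Sum>m\<in>Poly_Mapping.keys f. Poly_Mapping.single m (Poly_Mapping.lookup f m))"
  by (rule poly_mapping_eqI)
    (auto simp: lookup_sum lookup_single when_def in_keys_iff sum.delta)

lemma monomial_value_superset:
  assumes "finite B" "Poly_Mapping.keys m \<subseteq> B"
  shows "monomial_value \<rho> m = (\<Prod>x\<in>B. \<rho> x ^ Poly_Mapping.lookup m x)"
  unfolding monomial_value_def
  by (rule prod.mono_neutral_left) (use assms in \<open>auto simp: in_keys_iff\<close>)

lemma monomial_value_add: "monomial_value \<rho> (m + n) = monomial_value \<rho> m * monomial_value \<rho> n"
proof -
  let ?B = "Poly_Mapping.keys m \<union> Poly_Mapping.keys n"
  have "Poly_Mapping.keys (m + n) \<subseteq> ?B" by (rule keys_add)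
  then show ?thesis
    by (simp add: monomial_value_superset[of ?B] lookup_add power_add prod.distrib)
qed

locale scalar_hom = comm_ring_hom hom for hom :: "'k::field \<Rightarrow> 'r::comm_ring_1"
begin

lemma mpoly_eval_superset:
  assumes "finite B" "Poly_Mapping.keys f \<subseteq> B"
  shows "mpoly_eval hom \<rho> f = (\<Sum>m\<in>B. hom (Poly_Mapping.lookup f m) * monomial_value \<rho> m)"
  unfolding mpoly_eval_def
  by (rule sum.mono_neutral_left) (use assms in \<open>auto simp: in_keys_iff\<close>)

lemma mpoly_eval_add: "mpoly_eval hom \<rho> (f + g) = mpoly_eval hom \<rho> f + mpoly_eval hom \<rho> g"
proof -
  let ?B = "Poly_Mapping.keys f \<union> Poly_Mapping.keys g"
  have "Poly_Mapping.keys (f + g) \<subseteq> ?B" by (rule keys_add)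
  then show ?thesis
    by (simp add: mpoly_eval_superset[of ?B] lookup_add hom_add distrib_right sum.distrib)
qed

lemma mpoly_eval_0: "mpoly_eval hom \<rho> 0 = 0"
  by (simp add: mpoly_eval_def)

lemma mpoly_eval_sum: "mpoly_eval hom \<rho> (\<Sum>i\<in>I. f i) = (\<Sum>i\<in>I. mpoly_eval hom \<rho> (f i))"
  by (induction I rule: infinite_finite_induct) (auto simp: mpoly_eval_0 mpoly_eval_add)

lemma mpoly_eval_single: "mpoly_eval hom \<rho> (Poly_Mapping.single m c) = hom c * monomial_value \<rho> m"
  by (simp add: mpoly_eval_def)

lemma mpoly_eval_const: "mpoly_eval hom \<rho> (mpoly_const c) = hom c"
  by (simp add: mpoly_const_def mpoly_eval_single monomial_value_def)

lemma mpoly_eval_var: "mpoly_eval hom \<rho> (mpoly_var x) = \<rho> x"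
  by (simp add: mpoly_var_def mpoly_eval_single monomial_value_def)

lemma mpoly_eval_mult: "mpoly_eval hom \<rho> (f * g) = mpoly_eval hom \<rho> f * mpoly_eval hom \<rho> g"
proof -
  let ?f = "\<lambda>m. Poly_Mapping.single m (Poly_Mapping.lookup f m)"
  let ?g = "\<lambda>m. Poly_Mapping.single m (Poly_Mapping.lookup g m)"
  have "f * g = (\<Sum>m\<in>Poly_Mapping.keys f. ?f m) * (\<Sum>n\<in>Poly_Mapping.keys g. ?g n)"
    using poly_mapping_sum_single[of f] poly_mapping_sum_single[of g] by simp
  also have "\<dots> = (\<Sum>m\<in>Poly_Mapping.keys f. \<Sum>n\<in>Poly_Mapping.keys g. ?f m * ?g n)"
    by (rule sum_product)
  finally have "mpoly_eval hom \<rho> (f * g) =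
      (\<Sum>m\<in>Poly_Mapping.keys f. \<Sum>n\<in>Poly_Mapping.keys g. mpoly_eval hom \<rho> (?f m * ?g n))"
    by (simp only: mpoly_eval_sum)
  also have "\<dots> = (\<Sum>m\<in>Poly_Mapping.keys f. \<Sum>n\<in>Poly_Mapping.keys g.
      (hom (Poly_Mapping.lookup f m) * monomial_value \<rho> m) * (hom (Poly_Mapping.lookup g n) * monomial_value \<rho> n))"
    by (simp add: mult_single mpoly_eval_single hom_mult monomial_value_add mult_ac)
  also have "\<dots> = mpoly_eval hom \<rho> f * mpoly_eval hom \<rho> g"
    by (simp add: mpoly_eval_def sum_product)
  finally show ?thesis .
qed

lemma comm_ring_hom_mpoly_eval: "comm_ring_hom (mpoly_eval hom \<rho>)"
proof
  show "mpoly_eval hom \<rho> 1 = 1"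
    using mpoly_eval_const[of \<rho> 1] by (simp add: mpoly_const_def)
qed (simp_all add: mpoly_eval_0 mpoly_eval_add mpoly_eval_mult)

lemma hom_mpoly_eval:
  assumes "comm_ring_hom h"
  shows "h (mpoly_eval hom \<rho> f) = mpoly_eval (h \<circ> hom) (h \<circ> \<rho>) f"
proof -
  interpret h: comm_ring_hom h by fact
  show ?thesis by (simp add: mpoly_eval_def monomial_value_def h.hom_sum h.hom_mult h.hom_prod h.hom_power)
qed

end

section \<open>Points of the module scheme\<close>

text \<open>
  The \<open>'r\<close>-valued points of the scheme \<open>mod(A,d)\<close>, where \<open>\<iota>\<close> makes \<open>'r\<close> a \<open>K\<close>-algebra. A matrix is a
  function of two indices, evaluated at indices below \<open>d\<close>.
\<close>

definition matrix_rep ::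
    "('k::field \<Rightarrow> 'r::comm_ring_1) \<Rightarrow> ('k, 'a) module \<Rightarrow> nat \<Rightarrow> ('a \<Rightarrow> nat \<Rightarrow> nat \<Rightarrow> 'r) \<Rightarrow> bool" where
  "matrix_rep \<iota> A d \<rho> \<longleftrightarrow>
    (\<forall>a\<in>carrier A. \<forall>b\<in>carrier A. \<forall>i<d. \<forall>j<d. \<rho> (a \<oplus>\<^bsub>A\<^esub> b) i j = \<rho> a i j + \<rho> b i j) \<and>
    (\<forall>c. \<forall>a\<in>carrier A. \<forall>i<d. \<forall>j<d. \<rho> (c \<odot>\<^bsub>A\<^esub> a) i j = \<iota> c * \<rho> a i j) \<and>
    (\<forall>a\<in>carrier A. \<forall>b\<in>carrier A. \<forall>i<d. \<forall>j<d. \<rho> (a \<otimes>\<^bsub>A\<^esub> b) i j = (\<Sum>k<d. \<rho> a i k * \<rho> b k j)) \<and>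
    (\<forall>i<d. \<forall>j<d. \<rho> \<one>\<^bsub>A\<^esub> i j = (if i = j then 1 else 0))"

abbreviation rep_eval where
  "rep_eval \<iota> \<rho> \<equiv> mpoly_eval \<iota> (\<lambda>(a, i, j). \<rho> a i j)"

lemma (in scalar_hom) rep_eval_relations:
  assumes "matrix_rep hom A d \<rho>" "r \<in> mod_relations A d"
  shows "rep_eval hom \<rho> r = 0"
proof -
  interpret e: comm_ring_hom "rep_eval hom \<rho>" by (rule comm_ring_hom_mpoly_eval)
  show ?thesis
    using assms unfolding mod_relations_def matrix_rep_def
    by (auto simp: e.hom_minus e.hom_add e.hom_mult e.hom_sum mpoly_eval_var mpoly_eval_const)
qed

text \<open>
  A finite-dimensional algebra together with a basis, given by the coordinate functions \<open>\<kappa>\<close> of that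
  basis.
\<close>

locale coord_algebra = ring A for A :: "('k::field, 'a) module" (structure) +
  fixes D :: nat and \<kappa> :: "'a \<Rightarrow> nat \<Rightarrow> 'k"
  assumes smult_closed: "a \<in> carrier A \<Longrightarrow> c \<odot> a \<in> carrier A"
    and smult_l: "a \<in> carrier A \<Longrightarrow> b \<in> carrier A \<Longrightarrow> (c \<odot> a) \<otimes> b = c \<odot> (a \<otimes> b)"
    and smult_r: "a \<in> carrier A \<Longrightarrow> b \<in> carrier A \<Longrightarrow> a \<otimes> (c \<odot> b) = c \<odot> (a \<otimes> b)"
    and coord_add: "a \<in> carrier A \<Longrightarrow> b \<in> carrier A \<Longrightarrow> i < D \<Longrightarrow> \<kappa> (a \<oplus> b) i = \<kappa> a i + \<kappa> b i"
    and coord_smult: "a \<in> carrier A \<Longrightarrow> i < D \<Longrightarrow> \<kappa> (c \<odot> a) i = c * \<kappa> a i"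
    and coord_inj: "a \<in> carrier A \<Longrightarrow> b \<in> carrier A \<Longrightarrow> (\<And>i. i < D \<Longrightarrow> \<kappa> a i = \<kappa> b i) \<Longrightarrow> a = b"
    and coord_surj: "\<exists>a\<in>carrier A. \<forall>i<D. \<kappa> a i = v i"
begin

definition basis :: "nat \<Rightarrow> 'a" where
  "basis k = (SOME a. a \<in> carrier A \<and> (\<forall>i<D. \<kappa> a i = (if i = k then 1 else 0)))"

lemma basis_closed [simp]: "basis k \<in> carrier A"
  and coord_basis: "i < D \<Longrightarrow> \<kappa> (basis k) i = (if i = k then 1 else 0)"
proof -
  have "\<exists>a. a \<in> carrier A \<and> (\<forall>i<D. \<kappa> a i = (if i = k then 1 else 0))"
    using coord_surj[of "\<lambda>i. if i = k then 1 else 0"] by auto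
  from someI_ex[OF this] show "basis k \<in> carrier A"
    "i < D \<Longrightarrow> \<kappa> (basis k) i = (if i = k then 1 else 0)" unfolding basis_def by auto
qed

lemma coord_zero:
  assumes "i < D"
  shows "\<kappa> \<zero> i = 0"
proof -
  have "\<kappa> \<zero> i = \<kappa> \<zero> i + \<kappa> \<zero> i"
    using coord_add[OF zero_closed zero_closed assms] by (simp only: l_zero[OF zero_closed])
  then show ?thesis by (metis add_cancel_right_right)
qed

text \<open>Subtracting multiples of basis elements removes the coordinates one by one.\<close>

lemma basis_induct [consumes 1, case_names zero add smult basis]:
  assumes "a \<in> carrier A" and "Q \<zero>"
    and "\<And>a b. a \<in> carrier A \<Longrightarrow> b \<in> carrier A \<Longrightarrow> Q a \<Longrightarrow> Q b \<Longrightarrow> Q (a \<oplus> b)"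
    and "\<And>c a. a \<in> carrier A \<Longrightarrow> Q a \<Longrightarrow> Q (c \<odot> a)"
    and "\<And>k. k < D \<Longrightarrow> Q (basis k)"
  shows "Q a"
proof -
  have "Q a" if "n \<le> D" "a \<in> carrier A" "\<And>i. n \<le> i \<Longrightarrow> i < D \<Longrightarrow> \<kappa> a i = 0" for n a
    using that
  proof (induction n arbitrary: a)
    case 0
    then have "a = \<zero>" by (intro coord_inj) (auto simp: coord_zero)
    then show ?case using assms(2) by simp
  next
    case (Suc n)
    define a' where "a' = a \<oplus> (- \<kappa> a n) \<odot> basis n"
    have a': "a' \<in> carrier A" using Suc.prems by (simp add: a'_def smult_closed)
    have k: "\<kappa> a' i = (if i = n then 0 else \<kappa> a i)" if "i < D" for i
      using that Suc.prems by (simp add: a'_def coord_add coord_smult coord_basis smult_closed)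
    have "Q a'" using Suc.prems k by (intro Suc.IH a') auto
    moreover have "a = a' \<oplus> \<kappa> a n \<odot> basis n"
      using Suc.prems a' k by (intro coord_inj) (auto simp: coord_add coord_smult coord_basis smult_closed)
    moreover have "Q (\<kappa> a n \<odot> basis n)" using Suc.prems assms(4,5) by simp
    ultimately show ?case using assms(3)[OF a' smult_closed] basis_closed by metis
  qed
  from this[of D a] show ?thesis using assms(1) by simp
qed

lemma linear_expand:
  fixes L :: "'a \<Rightarrow> 'r::comm_ring_1"
  assumes "a \<in> carrier A" and \<iota>: "scalar_hom \<iota>"
    and add: "\<And>a b. a \<in> carrier A \<Longrightarrow> b \<in> carrier A \<Longrightarrow> L (a \<oplus> b) = L a + L b"
    and smult: "\<And>c a. a \<in> carrier A \<Longrightarrow> L (c \<odot> a) = \<iota> c * L a"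
  shows "L a = (\<Sum>k<D. \<iota> (\<kappa> a k) * L (basis k))"
proof -
  interpret scalar_hom \<iota> by (rule \<iota>)
  show ?thesis using assms(1)
  proof (induction rule: basis_induct)
    case zero
    then show ?case using add[of \<zero> \<zero>] by (simp add: coord_zero)
  next
    case (add a b)
    then show ?case using assms(3) by (simp add: coord_add hom_add distrib_right sum.distrib)
  next
    case (smult c a)
    then show ?case using assms(4) by (simp add: coord_smult hom_mult sum_distrib_left mult.assoc)
  next
    case (basis k)
    have "(\<Sum>l<D. \<iota> (\<kappa> (basis k) l) * L (basis l)) = (\<Sum>l<D. if l = k then L (basis l) else 0)"
      by (intro sum.cong) (auto simp: coord_basis)
    then show ?case using basis by simp
  qed
qed

abbreviation vars :: "nat \<Rightarrow> ('a \<times> nat \<times> nat) set" where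
  "vars d \<equiv> carrier A \<times> {..<d} \<times> {..<d}"

end

lemma mpoly_ring_carrier:
  "carrier (mpoly_ring V) = {f. \<forall>m\<in>Poly_Mapping.keys f. Poly_Mapping.keys m \<subseteq> V}"
  by (simp add: mpoly_ring_def)

lemma mpoly_ring_simps [simp]:
  "f \<oplus>\<^bsub>mpoly_ring V\<^esub> g = f + g" "f \<otimes>\<^bsub>mpoly_ring V\<^esub> g = f * g"
  "\<one>\<^bsub>mpoly_ring V\<^esub> = 1" "\<zero>\<^bsub>mpoly_ring V\<^esub> = 0"
  "1 \<in> carrier (mpoly_ring V)" "0 \<in> carrier (mpoly_ring V)"
  by (simp_all add: mpoly_ring_def ring_of_type_algebra_def)

lemma mpoly_ring_closed:
  "f \<in> carrier (mpoly_ring V) \<Longrightarrow> g \<in> carrier (mpoly_ring V) \<Longrightarrow> f + g \<in> carrier (mpoly_ring V)"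
  "f \<in> carrier (mpoly_ring V) \<Longrightarrow> g \<in> carrier (mpoly_ring V) \<Longrightarrow> f * g \<in> carrier (mpoly_ring V)"
  "f \<in> carrier (mpoly_ring V) \<Longrightarrow> - f \<in> carrier (mpoly_ring V)"
  "f \<in> carrier (mpoly_ring V) \<Longrightarrow> g \<in> carrier (mpoly_ring V) \<Longrightarrow> f - g \<in> carrier (mpoly_ring V)"
  "mpoly_const c \<in> carrier (mpoly_ring V)"
  "x \<in> V \<Longrightarrow> mpoly_var x \<in> carrier (mpoly_ring V)"
proof -
  show add: "f + g \<in> carrier (mpoly_ring V)" if "f \<in> carrier (mpoly_ring V)" "g \<in> carrier (mpoly_ring V)" for f g
    using that keys_add[of f g] unfolding mpoly_ring_carrier by fastforce
  show "f * g \<in> carrier (mpoly_ring V)" if fg: "f \<in> carrier (mpoly_ring V)" "g \<in> carrier (mpoly_ring V)"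
  proof -
    have "Poly_Mapping.keys m \<subseteq> V" if m: "m \<in> Poly_Mapping.keys (f * g)" for m
    proof -
      obtain a b where "m = a + b" "a \<in> Poly_Mapping.keys f" "b \<in> Poly_Mapping.keys g"
        using subsetD[OF keys_mult m] by blast
      then show ?thesis using fg keys_add[of a b] unfolding mpoly_ring_carrier by fastforce
    qed
    then show ?thesis by (simp add: mpoly_ring_carrier)
  qed
  show minus: "- f \<in> carrier (mpoly_ring V)" if "f \<in> carrier (mpoly_ring V)" for f
    using that by (simp add: in_keys_iff mpoly_ring_carrier)
  show "f - g \<in> carrier (mpoly_ring V)" if "f \<in> carrier (mpoly_ring V)" "g \<in> carrier (mpoly_ring V)"
    using add[OF that(1) minus[OF that(2)]] by simp
  show "mpoly_const c \<in> carrier (mpoly_ring V)" by (simp add: mpoly_const_def mpoly_ring_carrier)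
  show "mpoly_var x \<in> carrier (mpoly_ring V)" if "x \<in> V" using that by (simp add: mpoly_var_def mpoly_ring_carrier)
qed

lemma mpoly_const_hom: "comm_ring_hom (mpoly_const :: 'k::field \<Rightarrow> ('x \<Rightarrow>\<^sub>0 nat) \<Rightarrow>\<^sub>0 'k)"
  by unfold_locales (auto simp: mpoly_const_def single_add mult_single)

lemma cring_mpoly_ring: "cring (mpoly_ring V :: (('x \<Rightarrow>\<^sub>0 nat) \<Rightarrow>\<^sub>0 'k::field) ring)"
  (is "cring ?M")
proof (rule cringI)
  show "abelian_group ?M"
  proof (rule abelian_groupI)
    fix f assume "f \<in> carrier ?M"
    then show "\<exists>g\<in>carrier ?M. g \<oplus>\<^bsub>?M\<^esub> f = \<zero>\<^bsub>?M\<^esub>"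
      using mpoly_ring_closed(3) by (intro bexI[of _ "- f"]) auto
  qed (use mpoly_ring_closed(1) in \<open>auto simp: add_ac\<close>)
  show "Group.comm_monoid ?M"
    by (rule comm_monoidI) (use mpoly_ring_closed(2) in \<open>auto simp: mult_ac\<close>)
qed (simp add: distrib_right)

text \<open>
  Every term is a product of a constant and variables. So the constants and the variables generate the
  polynomial ring, and a homomorphism to a field is evaluation at the images of the variables.
\<close>

lemma mpoly_ring_generated:
  assumes T: "prime_in_subring T P" and c: "\<And>c. mpoly_const c \<in> T" and v: "\<And>x. x \<in> V \<Longrightarrow> mpoly_var x \<in> T"
    and f: "f \<in> carrier (mpoly_ring V)"
  shows "f \<in> T"
    and "ring_hom_mod T P \<psi> \<Longrightarrow> (\<And>c. \<psi> (mpoly_const c) = c) \<Longrightarrow> \<psi> f = mpoly_eval (\<lambda>c. c) (\<lambda>x. \<psi> (mpoly_var x)) f"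
proof -
  interpret prime_in_subring T P by (rule T)
  have single_power: "Poly_Mapping.single (Poly_Mapping.single x n) (1::'b) = mpoly_var x ^ n"
    for x :: 'a and n
  proof (induction n)
    case (Suc n)
    have 1: "Poly_Mapping.single x (Suc n) = Poly_Mapping.single x 1 + Poly_Mapping.single x n"
      by (simp flip: single_add)
    have "Poly_Mapping.single (Poly_Mapping.single x 1 + Poly_Mapping.single x n) (1 * 1) =
        Poly_Mapping.single (Poly_Mapping.single x 1) 1 * Poly_Mapping.single (Poly_Mapping.single x n) (1::'b)"
      by (rule mult_single[symmetric])
    also have "\<dots> = mpoly_var x * mpoly_var x ^ n"
      unfolding Suc.IH unfolding mpoly_var_def ..
    finally show ?case unfolding 1 by (simp only: mult_1 power_Suc)
  next
    case 0
    show ?case by (simp only: single_zero single_one power_0)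
  qed
  have prod: "Poly_Mapping.single (\<Sum>x\<in>B. g x) (1::'b) = (\<Prod>x\<in>B. Poly_Mapping.single (g x) 1)"
    for g :: "'a \<Rightarrow> 'a \<Rightarrow>\<^sub>0 nat" and B
  proof (induction B rule: infinite_finite_induct)
    case (insert x B)
    have "Poly_Mapping.single (g x + (\<Sum>x\<in>B. g x)) (1 * 1) =
        Poly_Mapping.single (g x) 1 * Poly_Mapping.single (\<Sum>x\<in>B. g x) (1::'b)"
      by (rule mult_single[symmetric])
    then show ?case
      unfolding sum.insert[OF insert.hyps(1,2)] prod.insert[OF insert.hyps(1,2)] insert.IH mult_1 .
  next
    case (infinite B)
    show ?case unfolding sum.infinite[OF infinite] prod.infinite[OF infinite] by (rule single_one)
  next
    case empty
    show ?case unfolding sum.empty prod.empty by (rule single_one)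
  qed
  have mono: "Poly_Mapping.single m c = mpoly_const c * (\<Prod>x\<in>Poly_Mapping.keys m. mpoly_var x ^ Poly_Mapping.lookup m x)"
    for m :: "'a \<Rightarrow>\<^sub>0 nat" and c :: 'b
  proof -
    have "Poly_Mapping.single m c = mpoly_const c * Poly_Mapping.single m 1"
      unfolding mpoly_const_def mult_single by simp
    also have "Poly_Mapping.single m (1::'b) = Poly_Mapping.single (\<Sum>x\<in>Poly_Mapping.keys m. Poly_Mapping.single x (Poly_Mapping.lookup m x)) 1"
      by (rule arg_cong[OF poly_mapping_sum_single])
    also have "\<dots> = (\<Prod>x\<in>Poly_Mapping.keys m. mpoly_var x ^ Poly_Mapping.lookup m x)"
      unfolding prod single_power ..
    finally show ?thesis .
  qed
  have pT: "(\<Prod>x\<in>B. mpoly_var x ^ n x) \<in> T" if "B \<subseteq> V" for B and n :: "'a \<Rightarrow> nat"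
    using that by (induction B rule: infinite_finite_induct) (auto intro: one_S mult_S power_S v)
  have fV: "Poly_Mapping.keys m \<subseteq> V" if "m \<in> Poly_Mapping.keys f" for m using f that by (auto simp: mpoly_ring_carrier)
  have sT: "Poly_Mapping.single m (Poly_Mapping.lookup f m) \<in> T" if "m \<in> Poly_Mapping.keys f" for m
    unfolding mono[of m] by (intro mult_S c pT fV that)
  then show "f \<in> T" by (subst poly_mapping_sum_single[of f]) (rule sum_S)
  assume \<psi>: "ring_hom_mod T P \<psi>" "\<And>c. \<psi> (mpoly_const c) = c"
  note h = ring_hom_mod_props[OF T \<psi>(1)]
  have pr: "\<psi> (\<Prod>x\<in>B. mpoly_var x ^ n x) = (\<Prod>x\<in>B. \<psi> (mpoly_var x) ^ n x)" if "B \<subseteq> V" for B and n :: "'a \<Rightarrow> nat"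
    using that
  proof (induction B rule: infinite_finite_induct)
    case (insert x B)
    then show ?case using h(4)[of "mpoly_var x ^ n x" "\<Prod>x\<in>B. mpoly_var x ^ n x"] h(7)[OF v] pT power_S[OF v] by simp
  qed (simp_all add: h(1))
  have "\<psi> f = (\<Sum>m\<in>Poly_Mapping.keys f. \<psi> (Poly_Mapping.single m (Poly_Mapping.lookup f m)))"
    by (subst poly_mapping_sum_single[of f]) (rule h(8)[OF sT])
  also have "\<dots> = mpoly_eval (\<lambda>c. c) (\<lambda>x. \<psi> (mpoly_var x)) f"
    unfolding mpoly_eval_def monomial_value_def
  proof (rule sum.cong[OF refl])
    fix m assume m: "m \<in> Poly_Mapping.keys f"
    show "\<psi> (Poly_Mapping.single m (Poly_Mapping.lookup f m)) =
       Poly_Mapping.lookup f m * (\<Prod>x\<in>Poly_Mapping.keys m. \<psi> (mpoly_var x) ^ Poly_Mapping.lookup m x)"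
      unfolding mono[of m] h(4)[OF c pT[OF fV[OF m]]] pr[OF fV[OF m]] \<psi>(2) ..
  qed
  finally show "\<psi> f = mpoly_eval (\<lambda>c. c) (\<lambda>x. \<psi> (mpoly_var x)) f" .
qed

lemma mpoly_ring_sum:
  "(\<And>i. i \<in> I \<Longrightarrow> f i \<in> carrier (mpoly_ring V)) \<Longrightarrow> (\<Sum>i\<in>I. f i) \<in> carrier (mpoly_ring V)"
proof (induction I rule: infinite_finite_induct)
  case (insert x F)
  then have "f x + (\<Sum>i\<in>F. f i) \<in> carrier (mpoly_ring V)" by (intro mpoly_ring_closed(1)) auto
  then show ?case using insert.hyps by simp
qed simp_all

lemma mod_relationsI:
  assumes "a \<in> carrier A" "i < d" "j < d"
  shows "b \<in> carrier A \<Longrightarrow>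
      mpoly_var (a \<oplus>\<^bsub>A\<^esub> b, i, j) - (mpoly_var (a, i, j) + mpoly_var (b, i, j)) \<in> mod_relations A d"
    and "mpoly_var (c \<odot>\<^bsub>A\<^esub> a, i, j) - mpoly_const c * mpoly_var (a, i, j) \<in> mod_relations A d"
    and "b \<in> carrier A \<Longrightarrow>
      mpoly_var (a \<otimes>\<^bsub>A\<^esub> b, i, j) - (\<Sum>k<d. mpoly_var (a, i, k) * mpoly_var (b, k, j)) \<in> mod_relations A d"
    and "mpoly_var (\<one>\<^bsub>A\<^esub>, i, j) - (if i = j then 1 else 0) \<in> mod_relations A d"
  unfolding mod_relations_def Un_iff mem_Collect_eq using assms by metis+

lemma scalar_hom_id: "scalar_hom (\<lambda>c :: 'k::field. c)"
  by unfold_locales auto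

context coord_algebra
begin

abbreviation rel_ideal :: "nat \<Rightarrow> (('a \<times> nat \<times> nat \<Rightarrow>\<^sub>0 nat) \<Rightarrow>\<^sub>0 'k) set" where
  "rel_ideal d \<equiv> genideal (mpoly_ring (vars d)) (mod_relations A d)"

abbreviation coord_class where
  "coord_class d f \<equiv> rel_ideal d +>\<^bsub>mpoly_ring (vars d)\<^esub> f"

lemma mod_coordinate_ring_eq:
  "mod_coordinate_ring A d = mpoly_ring (vars d) Quot rel_ideal d"
  by (simp add: mod_coordinate_ring_def Let_def)

lemma mod_relations_closed: "mod_relations A d \<subseteq> carrier (mpoly_ring (vars d))"
proof -
  have v: "mpoly_var (a, i, j) \<in> carrier (mpoly_ring (vars d))" if "a \<in> carrier A" "i < d" "j < d" for a i j
    using that by (intro mpoly_ring_closed) auto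
  have c: "(if P then 1 else 0) \<in> carrier (mpoly_ring (vars d))" for P by simp
  show ?thesis
    unfolding mod_relations_def
    by (safe; intro mpoly_ring_closed mpoly_ring_sum v c) (simp_all add: smult_closed)
qed

lemma rel_ideal: "ideal (rel_ideal d) (mpoly_ring (vars d))"
  using ring.genideal_ideal[OF cring.axioms(1)[OF cring_mpoly_ring] mod_relations_closed] .

lemma mod_relations_rel_ideal: "mod_relations A d \<subseteq> rel_ideal d"
  using ring.genideal_self[OF cring.axioms(1)[OF cring_mpoly_ring] mod_relations_closed] .

lemma cring_coordinate_ring: "cring (mod_coordinate_ring A d)"
  unfolding mod_coordinate_ring_eq by (rule ideal.quotient_is_cring[OF rel_ideal cring_mpoly_ring])

lemma coord_class_hom:
  "coord_class d \<in> Ring.ring_hom (mpoly_ring (vars d)) (mod_coordinate_ring A d)"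
  unfolding mod_coordinate_ring_eq by (rule ideal.rcos_ring_hom[OF rel_ideal])

definition point_prime where
  "point_prime \<iota> d \<rho> = {C \<in> carrier (mod_coordinate_ring A d). \<exists>f\<in>C. rep_eval \<iota> \<rho> f = 0}"

text \<open>
  The kernel of the homomorphism from the coordinate ring to \<open>'r\<close> that belongs to an \<open>'r\<close>-valued point. It
  is a point of the spectrum because \<open>'r\<close> is a domain.
\<close>

lemma point_prime:
  fixes \<iota> :: "'k \<Rightarrow> 'r::idom"
  assumes \<iota>: "scalar_hom \<iota>" and \<rho>: "matrix_rep \<iota> A d \<rho>"
  shows "primeideal (point_prime \<iota> d \<rho>) (mod_coordinate_ring A d)"
    and "f \<in> carrier (mpoly_ring (vars d)) \<Longrightarrow> coord_class d f \<in> point_prime \<iota> d \<rho> \<longleftrightarrow> rep_eval \<iota> \<rho> f = 0"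
proof -
  let ?M = "mpoly_ring (vars d) :: (('a \<times> nat \<times> nat \<Rightarrow>\<^sub>0 nat) \<Rightarrow>\<^sub>0 'k) ring"
  let ?R = "mod_coordinate_ring A d" and ?e = "rep_eval \<iota> \<rho>" and ?T = "ring_of_type_algebra :: 'r ring"
  interpret scalar_hom \<iota> by (rule \<iota>)
  interpret e: comm_ring_hom ?e by (rule comm_ring_hom_mpoly_eval)
  interpret M: cring ?M by (rule cring_mpoly_ring)
  interpret J: ideal "rel_ideal d" ?M by (rule rel_ideal)
  interpret T: cring ?T by (rule cring_from_type_algebra)
  interpret R: cring ?R by (rule cring_coordinate_ring)
  note T_simps = ring_of_type_algebra_def
  have domT: "domain ?T"
    by (rule domainI) (use T.cring_axioms in \<open>auto simp: T_simps\<close>)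
  have eh: "?e \<in> Ring.ring_hom ?M ?T"
    by (rule ring_hom_memI) (auto simp: T_simps e.hom_add e.hom_mult)
  interpret eh: ring_hom_ring ?M ?T ?e
    by (rule ring_hom_ringI2[OF M.ring_axioms T.ring_axioms eh])
  have "mod_relations A d \<subseteq> a_kernel ?M ?T ?e"
    using rep_eval_relations[OF \<rho>] mod_relations_closed unfolding a_kernel_def' by (auto simp: T_simps)
  from M.genideal_minimal[OF eh.kernel_is_ideal this]
  have J0: "?e f = 0" if "f \<in> rel_ideal d" for f
    using that unfolding a_kernel_def' by (auto simp: T_simps)
  have e_class: "?e g = ?e f" if "g \<in> coord_class d f" for f g
    using that J0 unfolding a_r_coset_def' by (auto simp: e.hom_add)
  have self: "f \<in> coord_class d f" if "f \<in> carrier ?M" for f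
    using J.a_rcos_self[OF that] .
  have cls: "coord_class d f \<in> carrier ?R" if "f \<in> carrier ?M" for f
    using ring_hom_closed[OF coord_class_hom that] .
  show mem: "coord_class d f \<in> point_prime \<iota> d \<rho> \<longleftrightarrow> ?e f = 0" if "f \<in> carrier ?M" for f
  proof
    assume "coord_class d f \<in> point_prime \<iota> d \<rho>"
    then obtain g where "g \<in> coord_class d f" "?e g = 0" unfolding point_prime_def by blast
    then show "?e f = 0" using e_class by metis
  next
    assume "?e f = 0"
    then show "coord_class d f \<in> point_prime \<iota> d \<rho>"
      unfolding point_prime_def using cls[OF that] self[OF that] by blast
  qed
  define h where "h C = ?e (SOME f. f \<in> C)" for C
  have h: "h (coord_class d f) = ?e f" if "f \<in> carrier ?M" for f
    unfolding h_def by (rule e_class) (rule someI[of "\<lambda>g. g \<in> coord_class d f"], rule self[OF that])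
  have carr: "\<exists>f\<in>carrier ?M. C = coord_class d f" if "C \<in> carrier ?R" for C
    using that unfolding mod_coordinate_ring_eq FactRing_def A_RCOSETS_def' by auto
  have "h \<in> Ring.ring_hom ?R ?T"
  proof (rule ring_hom_memI)
    fix C D assume "C \<in> carrier ?R" "D \<in> carrier ?R"
    then obtain f g where f: "f \<in> carrier ?M" "C = coord_class d f" and g: "g \<in> carrier ?M" "D = coord_class d g"
      using carr by meson
    have "C \<otimes>\<^bsub>?R\<^esub> D = coord_class d (f * g)" "C \<oplus>\<^bsub>?R\<^esub> D = coord_class d (f + g)"
      using ring_hom_mult[OF coord_class_hom f(1) g(1)] ring_hom_add[OF coord_class_hom f(1) g(1)] f(2) g(2) by auto
    then show "h (C \<otimes>\<^bsub>?R\<^esub> D) = h C \<otimes>\<^bsub>?T\<^esub> h D" "h (C \<oplus>\<^bsub>?R\<^esub> D) = h C \<oplus>\<^bsub>?T\<^esub> h D"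
      using h[OF mpoly_ring_closed(2)[OF f(1) g(1)]] h[OF mpoly_ring_closed(1)[OF f(1) g(1)]]
        h[OF f(1)] h[OF g(1)] f(2) g(2) by (auto simp: T_simps e.hom_add e.hom_mult)
  next
    have "\<one>\<^bsub>?R\<^esub> = coord_class d 1" using ring_hom_one[OF coord_class_hom] by simp
    then show "h \<one>\<^bsub>?R\<^esub> = \<one>\<^bsub>?T\<^esub>" using h[of 1] by (simp add: T_simps)
  qed (simp add: T_simps)
  then have "ring_hom_ring ?R ?T h" by (rule ring_hom_ringI2[OF R.ring_axioms T.ring_axioms])
  from ring_hom_ring.primeideal_vimage[OF this R.is_cring domain.zeroprimeideal[OF domT]]
  have "primeideal {C \<in> carrier ?R. h C \<in> {\<zero>\<^bsub>?T\<^esub>}} ?R" .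
  moreover have "{C \<in> carrier ?R. h C \<in> {\<zero>\<^bsub>?T\<^esub>}} = point_prime \<iota> d \<rho>"
  proof -
    have "h C = 0 \<longleftrightarrow> C \<in> point_prime \<iota> d \<rho>" if "C \<in> carrier ?R" for C
      using carr[OF that] h mem by metis
    then show ?thesis by (auto simp: T_simps point_prime_def)
  qed
  ultimately show "primeideal (point_prime \<iota> d \<rho>) ?R" by simp
qed

end

text \<open>
  The residue domain of a point of the spectrum is a finitely generated algebra, since a basis of \<open>A\<close>
  yields finitely many generators; so the Nullstellensatz applies to it.
\<close>

lemma rational_point_outside_zero_set:
  fixes A :: "('k::alg_closed_field, 'a) module" (structure)
  assumes "coord_algebra A D \<kappa>"
    and \<PP>: "primeideal \<PP> (mod_coordinate_ring A d)"
    and f: "f \<in> carrier (mpoly_ring (carrier A \<times> {..<d} \<times> {..<d}))"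
      "genideal (mpoly_ring (carrier A \<times> {..<d} \<times> {..<d})) (mod_relations A d)
        +>\<^bsub>mpoly_ring (carrier A \<times> {..<d} \<times> {..<d})\<^esub> f \<notin> \<PP>"
  shows "\<exists>\<rho>. matrix_rep (\<lambda>c. c) A d \<rho> \<and> rep_eval (\<lambda>c. c) \<rho> f \<noteq> 0"
proof -
  interpret coord_algebra A D \<kappa> by fact
  let ?M = "mpoly_ring (vars d) :: (('a \<times> nat \<times> nat \<Rightarrow>\<^sub>0 nat) \<Rightarrow>\<^sub>0 'k) ring"
  let ?R = "mod_coordinate_ring A d"
  interpret M: cring ?M by (rule cring_mpoly_ring)
  interpret R: cring ?R by (rule cring_coordinate_ring)
  interpret J: ideal "rel_ideal d" ?M by (rule rel_ideal)
  interpret mc: comm_ring_hom "mpoly_const :: 'k \<Rightarrow> ('a \<times> nat \<times> nat \<Rightarrow>\<^sub>0 nat) \<Rightarrow>\<^sub>0 'k" by (rule mpoly_const_hom)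
  define C where "C = carrier ?M"
  define P where "P = {g \<in> C. coord_class d g \<in> \<PP>}"
  have "ring_hom_ring ?M ?R (coord_class d)"
    by (rule ring_hom_ringI2[OF M.ring_axioms R.ring_axioms coord_class_hom])
  then interpret P: primeideal P ?M
    unfolding P_def C_def by (rule ring_hom_ring.primeideal_vimage[OF _ M.is_cring \<PP>])
  have CP: "prime_in_subring C P"
  proof
    show "x + y \<in> C" "x * y \<in> C" if "x \<in> C" "y \<in> C" for x y
      using that mpoly_ring_closed(1,2)[of x _ y] unfolding C_def by blast+
    show "- x \<in> C" if "x \<in> C" for x using that mpoly_ring_closed(3) unfolding C_def by blast
    show "P \<subseteq> C" by (auto simp: P_def)
    show "0 \<in> P" using P.zero_closed by simp
    show "x + y \<in> P" if "x \<in> P" "y \<in> P" for x y using P.a_closed[OF that] by simp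
    show "x * y \<in> P" if "x \<in> C" "y \<in> P" for x y using P.I_l_closed[OF that(2)] that(1) by (simp add: C_def)
    show "1 \<notin> P" using P.one_imp_carrier P.I_notcarr by auto
    show "x \<in> P \<or> y \<in> P" if "x \<in> C" "y \<in> C" "x * y \<in> P" for x y
      using P.I_prime[of x y] that by (simp add: C_def)
  qed (simp add: C_def)
  interpret CP: prime_in_subring C P by (rule CP)
  have constC: "mpoly_const c \<in> C" for c unfolding C_def by (rule mpoly_ring_closed)
  have varC: "x \<in> vars d \<Longrightarrow> mpoly_var x \<in> C" for x unfolding C_def by (rule mpoly_ring_closed)
  have const_P: "mpoly_const c \<in> P \<Longrightarrow> c = 0" for c
  proof (rule ccontr)
    assume "mpoly_const c \<in> P" "c \<noteq> 0"
    then have "mpoly_const (inverse c) * mpoly_const c \<in> P" using CP.mult_P constC by blast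
    then show False using CP.one_P \<open>c \<noteq> 0\<close> by (simp flip: mc.hom_mult)
  qed
  define S where "S = {s \<in> C. \<exists>c. s - mpoly_const c \<in> P}"
  have constS: "mpoly_const c \<in> S" for c
    using constC CP.zero_P by (auto simp: S_def intro!: exI[of _ c])
  have S_add: "x + y - mpoly_const (a + b) \<in> P" if "x - mpoly_const a \<in> P" "y - mpoly_const b \<in> P" for x y a b
    using CP.add_P[OF that] by (simp add: mc.hom_add algebra_simps)
  have S_mult: "x * y - mpoly_const (a * b) \<in> P"
    if "x \<in> C" "x - mpoly_const a \<in> P" "y - mpoly_const b \<in> P" for x y a b
  proof -
    have "x * (y - mpoly_const b) + mpoly_const b * (x - mpoly_const a) \<in> P"
      using that constC by (intro CP.add_P CP.mult_P)
    then show ?thesis by (simp add: mc.hom_mult algebra_simps)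
  qed
  have SP: "prime_in_subring S P"
  proof
    show "1 \<in> S" using constS[of 1] by simp
    show "x + y \<in> S" "x * y \<in> S" if "x \<in> S" "y \<in> S" for x y
      using that S_add S_mult CP.add_S CP.mult_S unfolding S_def by blast+
    show "- x \<in> S" if x: "x \<in> S" for x
    proof -
      obtain c where "x \<in> C" "x - mpoly_const c \<in> P" using x by (auto simp: S_def)
      then have "- x \<in> C" "- x - mpoly_const (- c) \<in> P"
        using CP.minus_S CP.minus_P[of "x - mpoly_const c"] by (auto simp: mc.hom_uminus)
      then show ?thesis by (auto simp: S_def)
    qed
    show "P \<subseteq> S" using CP.P_sub by (auto simp: S_def intro!: exI[of _ 0])
    show "x * y \<in> P" if "x \<in> S" "y \<in> P" for x y using that CP.mult_P by (auto simp: S_def)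
    show "x \<in> P \<or> y \<in> P" if "x \<in> S" "y \<in> S" "x * y \<in> P" for x y
      using that CP.prime_P by (auto simp: S_def)
  qed (auto intro: CP.zero_P CP.add_P simp: CP.one_P)
  define \<phi> where "\<phi> s = (THE c. s - mpoly_const c \<in> P)" for s :: "('a \<times> nat \<times> nat \<Rightarrow>\<^sub>0 nat) \<Rightarrow>\<^sub>0 'k"
  have \<phi>: "\<phi> s = c" if "s - mpoly_const c \<in> P" for s c
    unfolding \<phi>_def
  proof (rule the_equality)
    show "s - mpoly_const c \<in> P" by (rule that)
    fix c' assume "s - mpoly_const c' \<in> P"
    from CP.diff_P[OF that this] have "mpoly_const (c' - c) \<in> P" by (simp add: mc.hom_minus)
    then show "c' = c" using const_P by fastforce
  qed
  have \<phi>_hom: "ring_hom_mod S P \<phi>"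
    unfolding ring_hom_mod_def
  proof (intro conjI ballI)
    show "\<phi> 1 = 1" by (rule \<phi>) (simp add: CP.zero_P)
    show "\<phi> x = 0" if "x \<in> P" for x by (rule \<phi>) (simp add: that)
    fix x y assume "x \<in> S" "y \<in> S"
    then obtain a b where ab: "x \<in> C" "x - mpoly_const a \<in> P" "y - mpoly_const b \<in> P" by (auto simp: S_def)
    show "\<phi> (x + y) = \<phi> x + \<phi> y" using \<phi>[OF S_add[OF ab(2,3)]] \<phi>[OF ab(2)] \<phi>[OF ab(3)] by simp
    show "\<phi> (x * y) = \<phi> x * \<phi> y" using \<phi>[OF S_mult[OF ab]] \<phi>[OF ab(2)] \<phi>[OF ab(3)] by simp
  qed
  have relP: "mod_relations A d \<subseteq> P"
  proof
    fix r assume r: "r \<in> mod_relations A d"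
    then have "r \<in> C" "r \<in> rel_ideal d"
      using mod_relations_closed mod_relations_rel_ideal unfolding C_def by blast+
    then have "coord_class d r = \<zero>\<^bsub>?R\<^esub>"
      unfolding mod_coordinate_ring_eq FactRing_def using J.a_rcos_const by simp
    then show "r \<in> P" using \<open>r \<in> C\<close> \<PP> unfolding P_def
      by (simp add: additive_subgroup.zero_closed ideal.axioms(1) primeideal.axioms(1))
  qed
  define xs where "xs = [mpoly_var (basis k, i, j) :: ('a \<times> nat \<times> nat \<Rightarrow>\<^sub>0 nat) \<Rightarrow>\<^sub>0 'k. k \<leftarrow> [0..<D], i \<leftarrow> [0..<d], j \<leftarrow> [0..<d]]"
  have xs: "mpoly_var (basis k, i, j) \<in> set xs" if "k < D" "i < d" "j < d" for k i j
    using that unfolding xs_def by simp (metis atLeast0LessThan imageI lessThan_iff)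
  have xsC: "set xs \<subseteq> C" unfolding xs_def by (auto intro!: varC)
  have gen: "C \<subseteq> T" if T: "prime_in_subring T P" "S \<subseteq> T" "set xs \<subseteq> T" for T
  proof -
    interpret T: prime_in_subring T P by (rule T)
    have cong: "x \<in> T" if "x - y \<in> P" "y \<in> T" for x y
      using T.add_S[of "x - y" y] that T.P_sub by auto
    have "\<forall>i<d. \<forall>j<d. mpoly_var (a, i, j) \<in> T" if "a \<in> carrier A" for a
      using that
    proof (induction rule: basis_induct)
      case zero
      show ?case
      proof (intro allI impI)
        fix i j assume ij: "i < d" "j < d"
        have "- mpoly_var (\<zero>, i, j) \<in> P"
          using subsetD[OF relP mod_relationsI(1)[OF zero_closed ij zero_closed]] by simp
        from T.minus_S[OF subsetD[OF T.P_sub this]] show "mpoly_var (\<zero>, i, j) \<in> T" by simp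
      qed
    next
      case (add a b)
      show ?case
      proof (intro allI impI)
        fix i j assume ij: "i < d" "j < d"
        show "mpoly_var (a \<oplus> b, i, j) \<in> T"
        proof (rule cong[OF subsetD[OF relP mod_relationsI(1)[OF add(1) ij add(2)]]])
          show "mpoly_var (a, i, j) + mpoly_var (b, i, j) \<in> T"
            using add(3,4) ij by (intro T.add_S) blast+
        qed
      qed
    next
      case (smult c a)
      show ?case
      proof (intro allI impI)
        fix i j assume ij: "i < d" "j < d"
        have "mpoly_const c * mpoly_var (a, i, j) \<in> T"
          using T.mult_S[OF subsetD[OF T(2) constS]] smult(2) ij by blast
        then show "mpoly_var (c \<odot> a, i, j) \<in> T"
          by (rule cong[OF subsetD[OF relP mod_relationsI(2)[OF smult(1) ij]]])
      qed
    next
      case (basis k)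
      then show ?case using T(3) xs by blast
    qed
    then have v: "mpoly_var x \<in> T" if "x \<in> vars d" for x using that by auto
    show ?thesis
    proof
      fix g assume "g \<in> C"
      then show "g \<in> T" using mpoly_ring_generated(1)[OF T(1) _ v] constS T(2) unfolding C_def by blast
    qed
  qed
  have fC: "f \<in> C" "f \<notin> P" using f unfolding P_def C_def by blast+
  have SC: "S \<subseteq> C" by (auto simp: S_def)
  obtain a where a: "a \<in> S" "a \<notin> P" and ext: "\<forall>\<phi> :: _ \<Rightarrow> 'k. ring_hom_mod S P \<phi> \<longrightarrow> \<phi> a \<noteq> 0 \<longrightarrow>
       (\<exists>\<psi> T. prime_in_subring T P \<and> S \<subseteq> T \<and> set xs \<subseteq> T \<and> T \<subseteq> C \<and>
        ring_hom_mod T P \<psi> \<and> (\<forall>s\<in>S. \<psi> s = \<phi> s) \<and> \<psi> f \<noteq> 0)"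
  proof -
    have fT: "f \<in> T" if "prime_in_subring T P" "S \<subseteq> T" "set xs \<subseteq> T" "T \<subseteq> C" for T
      using gen[OF that(1-3)] fC(1) by (rule subsetD)
    have "\<exists>a\<in>S. a \<notin> P \<and> (\<forall>\<phi> :: _ \<Rightarrow> 'k. ring_hom_mod S P \<phi> \<longrightarrow> \<phi> a \<noteq> 0 \<longrightarrow>
       (\<exists>\<psi> T. prime_in_subring T P \<and> S \<subseteq> T \<and> set xs \<subseteq> T \<and> T \<subseteq> C \<and>
        ring_hom_mod T P \<psi> \<and> (\<forall>s\<in>S. \<psi> s = \<phi> s) \<and> \<psi> f \<noteq> 0))"
      by (rule extend_hom_adjoin_list[OF CP SP SC xsC _ fC(2)]) (rule fT)
    then show ?thesis by (elim bexE conjE) (rule that)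
  qed
  obtain c where c: "a - mpoly_const c \<in> P" using a(1) by (auto simp: S_def)
  have "\<phi> a \<noteq> 0" using \<phi>[OF c] c a(2) by auto
  from ext[rule_format, OF \<phi>_hom this] obtain \<psi> T where T: "prime_in_subring T P" "S \<subseteq> T" "set xs \<subseteq> T" "T \<subseteq> C"
    and \<psi>: "ring_hom_mod T P \<psi>" "\<forall>s\<in>S. \<psi> s = \<phi> s" "\<psi> f \<noteq> 0" by (elim exE conjE)
  have "T = C" using gen[OF T(1-3)] T(4) by blast
  have \<psi>c: "\<psi> (mpoly_const c) = c" for c
    using \<psi>(2) constS[of c] \<phi>[of "mpoly_const c" c] CP.zero_P by simp
  note h = ring_hom_mod_props[OF T(1) \<psi>(1), unfolded \<open>T = C\<close>]
  define \<rho> where "\<rho> a i j = \<psi> (mpoly_var (a, i, j))" for a i j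
  have "matrix_rep (\<lambda>c. c) A d \<rho>"
  proof -
    have rel: "\<psi> x = \<psi> y" if "x - y \<in> mod_relations A d" "y \<in> C" for x y
    proof -
      have "x - y \<in> P" using that relP by auto
      then have "\<psi> ((x - y) + y) = 0 + \<psi> y" using h(3,5) CP.P_sub that(2) by (metis subsetD)
      then show ?thesis by simp
    qed
    have v: "mpoly_var (a, i, j) \<in> C" if "a \<in> carrier A" "i < d" "j < d" for a i j
      using that by (intro varC) auto
    show ?thesis
      unfolding matrix_rep_def \<rho>_def
    proof (intro conjI ballI allI impI)
      fix i j assume ij: "i < d" "j < d"
      fix a assume a: "a \<in> carrier A"
      show "\<psi> (mpoly_var (c \<odot> a, i, j)) = c * \<psi> (mpoly_var (a, i, j))" for c
      proof -
        have "\<psi> (mpoly_var (c \<odot> a, i, j)) = \<psi> (mpoly_const c * mpoly_var (a, i, j))"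
          by (rule rel[OF mod_relationsI(2)[OF a ij]]) (rule CP.mult_S[OF constC v[OF a ij]])
        then show ?thesis using h(4)[OF constC v[OF a ij]] \<psi>c by simp
      qed
      fix b assume b: "b \<in> carrier A"
      show "\<psi> (mpoly_var (a \<oplus> b, i, j)) = \<psi> (mpoly_var (a, i, j)) + \<psi> (mpoly_var (b, i, j))"
      proof -
        have "\<psi> (mpoly_var (a \<oplus> b, i, j)) = \<psi> (mpoly_var (a, i, j) + mpoly_var (b, i, j))"
          by (rule rel[OF mod_relationsI(1)[OF a ij b]]) (rule CP.add_S[OF v[OF a ij] v[OF b ij]])
        then show ?thesis using h(3)[OF v[OF a ij] v[OF b ij]] by simp
      qed
      show "\<psi> (mpoly_var (a \<otimes> b, i, j)) = (\<Sum>k<d. \<psi> (mpoly_var (a, i, k)) * \<psi> (mpoly_var (b, k, j)))"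
      proof -
        have m: "mpoly_var (a, i, k) * mpoly_var (b, k, j) \<in> C" if "k \<in> {..<d}" for k
          using that a b ij by (auto intro!: CP.mult_S v)
        have "\<psi> (mpoly_var (a \<otimes> b, i, j)) = \<psi> (\<Sum>k<d. mpoly_var (a, i, k) * mpoly_var (b, k, j))"
          by (rule rel[OF mod_relationsI(3)[OF a ij b]]) (rule CP.sum_S[OF m])
        also have "\<dots> = (\<Sum>k<d. \<psi> (mpoly_var (a, i, k) * mpoly_var (b, k, j)))" by (rule h(8)) (rule m)
        also have "\<dots> = (\<Sum>k<d. \<psi> (mpoly_var (a, i, k)) * \<psi> (mpoly_var (b, k, j)))"
          by (intro sum.cong refl h(4) v) (use a b ij in auto)
        finally show ?thesis .
      qed
    next
      fix i j assume ij: "i < d" "j < d"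
      have C1: "(if i = j then 1 else 0) \<in> C" using CP.one_S CP.zero_S by simp
      have "\<psi> (mpoly_var (\<one>, i, j)) = \<psi> (if i = j then 1 else 0)"
        by (rule rel[OF mod_relationsI(4)[OF one_closed ij] C1])
      then show "\<psi> (mpoly_var (\<one>, i, j)) = (if i = j then 1 else 0)" using h(1,2) by simp
    qed
  qed
  moreover have "\<psi> f = rep_eval (\<lambda>c. c) \<rho> f"
  proof -
    have "(\<lambda>x. \<psi> (mpoly_var x)) = (\<lambda>(a, i, j). \<rho> a i j)" by (auto simp: \<rho>_def)
    then show ?thesis
      using mpoly_ring_generated(2)[OF CP constC varC f(1) \<psi>(1)[unfolded \<open>T = C\<close>] \<psi>c] by simp
  qed
  ultimately show ?thesis using \<psi>(3) by metis
qed

section \<open>The spectrum\<close>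

lemma topspace_zariski: "cring R \<Longrightarrow> topspace (zariski_topology R) = prime_spectrum R"
proof -
  assume "cring R"
  have "openin (zariski_topology R) (prime_spectrum R)"
    unfolding openin_zariski_topology
  proof (intro exI[of _ "carrier R"] conjI)
    have "\<not> carrier R \<subseteq> P" if "primeideal P R" for P
      using primeideal.I_notcarr[OF that] ideal.Icarr[OF primeideal.axioms(1)[OF that]] by blast
    then show "prime_spectrum R = prime_spectrum R - {P \<in> prime_spectrum R. carrier R \<subseteq> P}"
      by (auto simp: prime_spectrum_def)
  qed simp
  moreover have "topspace (zariski_topology R) \<subseteq> prime_spectrum R"
    using openin_topspace[of "zariski_topology R"] unfolding openin_zariski_topology by blast
  ultimately show ?thesis using openin_subset by blast
qed

lemma closedin_zariski:
  assumes "cring R"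
  shows "closedin (zariski_topology R) C \<longleftrightarrow> (\<exists>E\<subseteq>carrier R. C = {P \<in> prime_spectrum R. E \<subseteq> P})"
proof -
  have "closedin (zariski_topology R) C \<longleftrightarrow> C \<subseteq> prime_spectrum R \<and>
      (\<exists>E\<subseteq>carrier R. prime_spectrum R - C = prime_spectrum R - {P \<in> prime_spectrum R. E \<subseteq> P})"
    unfolding closedin_def topspace_zariski[OF assms] openin_zariski_topology ..
  also have "\<dots> \<longleftrightarrow> (\<exists>E\<subseteq>carrier R. C = {P \<in> prime_spectrum R. E \<subseteq> P})" by blast
  finally show ?thesis .
qed

text \<open>
  The complements of the zero sets of single elements form a basis of the topology; so it is enough that
  any two nonempty ones meet.
\<close>

lemma irreducible_spectrumI:
  assumes R: "cring R" and ne: "primeideal P0 R"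
    and *: "\<And>P1 P2 f g. primeideal P1 R \<Longrightarrow> primeideal P2 R \<Longrightarrow> f \<in> carrier R \<Longrightarrow> g \<in> carrier R \<Longrightarrow>
      f \<notin> P1 \<Longrightarrow> g \<notin> P2 \<Longrightarrow> \<exists>P. primeideal P R \<and> f \<notin> P \<and> g \<notin> P"
  shows "irreducible_space (zariski_topology R)"
  unfolding irreducible_space_def topspace_zariski[OF R]
proof (intro conjI allI impI)
  show "prime_spectrum R \<noteq> {}" using ne by (auto simp: prime_spectrum_def)
  fix C D assume CD: "closedin (zariski_topology R) C \<and> closedin (zariski_topology R) D \<and> C \<union> D = prime_spectrum R"
  then obtain E F where E: "E \<subseteq> carrier R" "C = {P \<in> prime_spectrum R. E \<subseteq> P}"
    and F: "F \<subseteq> carrier R" "D = {P \<in> prime_spectrum R. F \<subseteq> P}"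
    unfolding closedin_zariski[OF R] by blast
  show "C = prime_spectrum R \<or> D = prime_spectrum R"
  proof (rule ccontr)
    assume "\<not> ?thesis"
    then obtain P1 P2 where "primeideal P1 R" "\<not> E \<subseteq> P1" "primeideal P2 R" "\<not> F \<subseteq> P2"
      unfolding E(2) F(2) prime_spectrum_def by blast
    then obtain f g where "f \<in> E" "f \<notin> P1" "g \<in> F" "g \<notin> P2" by blast
    then obtain P where "primeideal P R" "f \<notin> P" "g \<notin> P"
      using *[OF \<open>primeideal P1 R\<close> \<open>primeideal P2 R\<close>, of f g] E(1) F(1) by blast
    moreover from this have "P \<in> C \<union> D" using CD by (auto simp: prime_spectrum_def)
    ultimately show False using \<open>f \<in> E\<close> \<open>g \<in> F\<close> E(2) F(2) by blast
  qed
qed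

lemma irreducible_imp_components_irreducible:
  assumes "irreducible_space T" "C \<in> connected_components_of T"
  shows "irreducible_space (subtopology T C)"
proof -
  have "connected_space T"
    unfolding connected_space_closedin_eq
  proof (intro notI, elim exE conjE)
    fix E1 E2 assume E: "closedin T E1" "closedin T E2" "E1 \<union> E2 = topspace T" "E1 \<inter> E2 = {}" "E1 \<noteq> {}" "E2 \<noteq> {}"
    then have "E1 = topspace T \<or> E2 = topspace T" using assms(1) by (auto simp: irreducible_space_def)
    then show False using E closedin_subset by blast
  qed
  then have "C = topspace T" using assms(2) connected_components_of_connected_space[of T] by (auto split: if_splits)
  then show ?thesis using assms(1) by simp
qed

text \<open>A point of the spectrum lies in the closure of every prime below it.\<close>

lemma connected_component_specialization:
  assumes R: "cring R" and P: "primeideal P0 R" "primeideal P R" "P0 \<subseteq> P"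
  shows "connected_component_of (zariski_topology R) P0 P"
proof -
  let ?T = "zariski_topology R"
  have X: "P0 \<in> topspace ?T" "P \<in> topspace ?T" using P by (auto simp: topspace_zariski[OF R] prime_spectrum_def)
  have "connectedin ?T {P0}" using X(1) by simp
  then have "connectedin ?T (?T closure_of {P0})" by (rule connectedin_closure_of)
  moreover have "P0 \<in> ?T closure_of {P0}" using closure_of_subset[of "{P0}" ?T] X(1) by auto
  moreover have "P \<in> ?T closure_of {P0}"
    unfolding in_closure_of openin_zariski_topology using X P by (auto simp: topspace_zariski[OF R])
  ultimately show ?thesis unfolding connected_component_of_def by blast
qed

lemma irreducible_component_basic_open_meet:
  assumes R: "cring R"
    and irr: "\<And>C. C \<in> connected_components_of (zariski_topology R) \<Longrightarrow> irreducible_space (subtopology (zariski_topology R) C)"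
    and P: "primeideal P1 R" "primeideal P2 R" "connected_component_of (zariski_topology R) P1 P2"
    and fg: "f \<in> carrier R" "g \<in> carrier R" "f \<notin> P1" "g \<notin> P2"
  shows "\<exists>P. primeideal P R \<and> f \<notin> P \<and> g \<notin> P"
proof (rule ccontr)
  assume no: "\<not> ?thesis"
  let ?T = "zariski_topology R"
  define C where "C = connected_component_of_set ?T P1"
  have X: "P1 \<in> topspace ?T" using P by (auto simp: topspace_zariski[OF R] prime_spectrum_def)
  then have "C \<in> connected_components_of ?T"
    unfolding C_def connected_component_in_connected_components_of .
  from irr[OF this] have I: "irreducible_space (subtopology ?T C)" .
  have CX: "C \<subseteq> topspace ?T" unfolding C_def by (rule connected_component_of_subset_topspace)
  have Ctop: "topspace (subtopology ?T C) = C" using CX by auto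
  have P12: "P1 \<in> C" "P2 \<in> C" using P(3) X by (auto simp: C_def connected_component_of_refl)
  define V where "V h = {P \<in> prime_spectrum R. {h} \<subseteq> P}" for h
  have cl: "closedin (subtopology ?T C) (V h \<inter> C)" if "h \<in> carrier R" for h
    unfolding closedin_subtopology using that by (auto simp: V_def closedin_zariski[OF R] intro!: exI[of _ "V h"] exI[of _ "{h}"])
  have "C \<subseteq> V f \<union> V g"
    using CX no by (auto simp: V_def topspace_zariski[OF R] prime_spectrum_def)
  then have "(V f \<inter> C) \<union> (V g \<inter> C) = topspace (subtopology ?T C)" unfolding Ctop by blast
  then have "V f \<inter> C = C \<or> V g \<inter> C = C"
    using I cl[OF fg(1)] cl[OF fg(2)] unfolding irreducible_space_def Ctop by blast
  then show False using P12 fg(3,4) by (auto simp: V_def)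
qed

section \<open>Curves of representations\<close>

lemma scalar_hom_const: "scalar_hom (\<lambda>c :: 'k::field. [:c:])"
  by unfold_locales (auto simp: one_pCons)

lemma comm_ring_hom_poly_at: "comm_ring_hom (\<lambda>p :: 'k::field poly. poly p t)"
  by unfold_locales auto

lemma mpoly_eval_cong:
  assumes "f \<in> carrier (mpoly_ring V)" "\<And>x. x \<in> V \<Longrightarrow> \<rho> x = \<rho>' x"
  shows "mpoly_eval \<iota> \<rho> f = mpoly_eval \<iota> \<rho>' f"
  unfolding mpoly_eval_def monomial_value_def
proof (intro sum.cong refl arg_cong2[of _ _ _ _ "(*)"] prod.cong arg_cong2[of _ _ _ _ "(^)"])
  fix m x assume "m \<in> Poly_Mapping.keys f" "x \<in> Poly_Mapping.keys m"
  then show "\<rho> x = \<rho>' x" using assms(1) by (intro assms(2)) (auto simp: mpoly_ring_carrier)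
qed

lemma rep_eval_curve:
  fixes A :: "('k::field, 'a) module"
  assumes f: "f \<in> carrier (mpoly_ring (carrier A \<times> {..<d} \<times> {..<d}))"
    and eq: "\<And>a i j. a \<in> carrier A \<Longrightarrow> i < d \<Longrightarrow> j < d \<Longrightarrow> poly (\<rho> a i j) t = \<rho>t a i j"
  shows "poly (rep_eval (\<lambda>c. [:c:]) \<rho> f) t = rep_eval (\<lambda>c :: 'k. c) \<rho>t f"
proof -
  have "poly (rep_eval (\<lambda>c. [:c:]) \<rho> f) t =
      mpoly_eval ((\<lambda>p. poly p t) \<circ> (\<lambda>c. [:c:])) ((\<lambda>p. poly p t) \<circ> (\<lambda>(a, i, j). \<rho> a i j)) f"
    by (rule scalar_hom.hom_mpoly_eval[OF scalar_hom_const comm_ring_hom_poly_at])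
  also have "(\<lambda>p. poly p t) \<circ> (\<lambda>c. [:c:]) = (\<lambda>c. c)" by auto
  also have "mpoly_eval (\<lambda>c. c) ((\<lambda>p. poly p t) \<circ> (\<lambda>(a, i, j). \<rho> a i j)) f = rep_eval (\<lambda>c. c) \<rho>t f"
    by (rule mpoly_eval_cong[OF f]) (auto simp: eq)
  finally show ?thesis .
qed

context coord_algebra
begin

text \<open>
  A curve of representations is a \<open>K[t]\<close>-valued point. Its prime lies below the primes of all the members
  of the curve.
\<close>

lemma curve_connected:
  assumes \<rho>: "matrix_rep (\<lambda>c. [:c:]) A d \<rho>" and \<rho>t: "matrix_rep (\<lambda>c. c) A d \<rho>t"
    and eq: "\<And>a i j. a \<in> carrier A \<Longrightarrow> i < d \<Longrightarrow> j < d \<Longrightarrow> poly (\<rho> a i j) t = \<rho>t a i j"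
  shows "connected_component_of (zariski_topology (mod_coordinate_ring A d))
    (point_prime (\<lambda>c. [:c:]) d \<rho>) (point_prime (\<lambda>c. c) d \<rho>t)"
proof (rule connected_component_specialization[OF cring_coordinate_ring])
  note pp = point_prime[OF scalar_hom_const \<rho>] point_prime[OF scalar_hom_id \<rho>t]
  show "primeideal (point_prime (\<lambda>c. [:c:]) d \<rho>) (mod_coordinate_ring A d)"
    "primeideal (point_prime (\<lambda>c. c) d \<rho>t) (mod_coordinate_ring A d)" by (rule pp)+
  show "point_prime (\<lambda>c. [:c:]) d \<rho> \<subseteq> point_prime (\<lambda>c. c) d \<rho>t"
  proof
    fix C assume C: "C \<in> point_prime (\<lambda>c. [:c:]) d \<rho>"
    then have "C \<in> carrier (mod_coordinate_ring A d)" by (simp add: point_prime_def)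
    then obtain f where f: "f \<in> carrier (mpoly_ring (vars d))" "C = coord_class d f"
      unfolding mod_coordinate_ring_eq FactRing_def A_RCOSETS_def' by auto
    have "rep_eval (\<lambda>c. [:c:]) \<rho> f = 0" using C pp(2)[OF f(1)] f(2) by simp
    moreover have "poly (rep_eval (\<lambda>c. [:c:]) \<rho> f) t = rep_eval (\<lambda>c. c) \<rho>t f"
      by (rule rep_eval_curve[OF f(1)]) (rule eq)
    ultimately have "rep_eval (\<lambda>c. c) \<rho>t f = 0" by simp
    then show "C \<in> point_prime (\<lambda>c. c) d \<rho>t" using pp(4)[OF f(1)] f(2) by simp
  qed
qed

end

text \<open>
  If two functions are nonzero at one point each, both are nonzero on a curve through these points, and
  the curve is itself a point of the spectrum. By the Nullstellensatz rational points are enough.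
\<close>

lemma irreducible_if_joined_by_curves:
  fixes A :: "('k::alg_closed_field, 'a) module"
  assumes A: "coord_algebra A D \<kappa>" and ne: "matrix_rep (\<lambda>c. c) A d \<rho>0"
    and join: "\<And>\<rho>1 \<rho>2. matrix_rep (\<lambda>c. c) A d \<rho>1 \<Longrightarrow> matrix_rep (\<lambda>c. c) A d \<rho>2 \<Longrightarrow>
      \<exists>\<rho>. matrix_rep (\<lambda>c. [:c:]) A d \<rho> \<and> (\<forall>a\<in>carrier A. \<forall>i<d. \<forall>j<d.
        poly (\<rho> a i j) 0 = \<rho>1 a i j \<and> poly (\<rho> a i j) 1 = \<rho>2 a i j)"
  shows "irreducible_space (zariski_topology (mod_coordinate_ring A d))"
proof -
  interpret coord_algebra A D \<kappa> by (rule A)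
  let ?R = "mod_coordinate_ring A d"
  show ?thesis
  proof (rule irreducible_spectrumI[OF cring_coordinate_ring point_prime(1)[OF scalar_hom_id ne]])
    fix P1 P2 F G
    assume P: "primeideal P1 ?R" "primeideal P2 ?R" and FG: "F \<in> carrier ?R" "G \<in> carrier ?R" "F \<notin> P1" "G \<notin> P2"
    obtain f g where f: "f \<in> carrier (mpoly_ring (vars d))" "F = coord_class d f"
      and g: "g \<in> carrier (mpoly_ring (vars d))" "G = coord_class d g"
      using FG(1,2) unfolding mod_coordinate_ring_eq FactRing_def A_RCOSETS_def' by auto
    obtain \<rho>1 where \<rho>1: "matrix_rep (\<lambda>c. c) A d \<rho>1" "rep_eval (\<lambda>c. c) \<rho>1 f \<noteq> 0"
      using rational_point_outside_zero_set[OF A P(1) f(1)] FG(3) f(2) by blast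
    obtain \<rho>2 where \<rho>2: "matrix_rep (\<lambda>c. c) A d \<rho>2" "rep_eval (\<lambda>c. c) \<rho>2 g \<noteq> 0"
      using rational_point_outside_zero_set[OF A P(2) g(1)] FG(4) g(2) by blast
    obtain \<rho> where \<rho>: "matrix_rep (\<lambda>c. [:c:]) A d \<rho>" and e: "\<forall>a\<in>carrier A. \<forall>i<d. \<forall>j<d.
        poly (\<rho> a i j) 0 = \<rho>1 a i j \<and> poly (\<rho> a i j) 1 = \<rho>2 a i j"
      using join[OF \<rho>1(1) \<rho>2(1)] by blast
    have "poly (rep_eval (\<lambda>c. [:c:]) \<rho> f) 0 = rep_eval (\<lambda>c. c) \<rho>1 f"
      by (rule rep_eval_curve[OF f(1)]) (use e in blast)
    then have nf: "rep_eval (\<lambda>c. [:c:]) \<rho> f \<noteq> 0" using \<rho>1(2) by auto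
    have "poly (rep_eval (\<lambda>c. [:c:]) \<rho> g) 1 = rep_eval (\<lambda>c. c) \<rho>2 g"
      by (rule rep_eval_curve[OF g(1)]) (use e in blast)
    then have ng: "rep_eval (\<lambda>c. [:c:]) \<rho> g \<noteq> 0" using \<rho>2(2) by auto
    show "\<exists>P. primeideal P ?R \<and> F \<notin> P \<and> G \<notin> P"
      using point_prime[OF scalar_hom_const \<rho>] nf ng f g by blast
  qed
qed

section \<open>Truncated polynomial algebras are geometrically irreducible\<close>

lemma smult_smult_mat: "a \<cdot>\<^sub>m (b \<cdot>\<^sub>m M) = (a * b :: 'r::comm_ring_1) \<cdot>\<^sub>m M"
  and one_smult_mat: "1 \<cdot>\<^sub>m M = (M :: 'r::comm_ring_1 mat)"
  by (auto intro!: eq_matI simp: mult.assoc)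

text \<open>
  For \<open>e = 1\<close> this is the power of a conjugate of \<open>N\<close>. The general form covers the adjugate of a matrix in
  place of its inverse.
\<close>

lemma conjugate_power:
  fixes H :: "'r::comm_ring_1 mat"
  assumes c: "H \<in> carrier_mat d d" "N \<in> carrier_mat d d" "B \<in> carrier_mat d d" and BH: "B * H = e \<cdot>\<^sub>m 1\<^sub>m d"
  shows "(H * N * B) ^\<^sub>m Suc k = e ^ k \<cdot>\<^sub>m (H * N ^\<^sub>m Suc k * B)"
proof (induction k)
  case 0
  then show ?case using c by (simp add: one_smult_mat)
next
  case (Suc k)
  note cN = pow_carrier_mat[OF c(2), of "Suc k"]
  have HN: "H * N ^\<^sub>m Suc k \<in> carrier_mat d d" by (rule mult_carrier_mat[OF c(1) cN])
  have NB: "N * B \<in> carrier_mat d d" by (rule mult_carrier_mat[OF c(2,3)])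
  have HNB: "H * N * B \<in> carrier_mat d d" by (rule mult_carrier_mat[OF mult_carrier_mat[OF c(1,2)] c(3)])
  have "(H * N * B) ^\<^sub>m Suc (Suc k) = (e ^ k \<cdot>\<^sub>m (H * N ^\<^sub>m Suc k * B)) * (H * N * B)"
    using Suc.IH by (simp only: pow_mat.simps(2)[of _ "Suc k"])
  also have "\<dots> = e ^ k \<cdot>\<^sub>m ((H * N ^\<^sub>m Suc k * B) * (H * N * B))"
    by (rule mult_smult_assoc_mat[OF mult_carrier_mat[OF HN c(3)] HNB])
  also have "(H * N ^\<^sub>m Suc k * B) * (H * N * B) = (H * N ^\<^sub>m Suc k) * (B * (H * N * B))"
    by (rule assoc_mult_mat[OF HN c(3) HNB])
  also have "B * (H * N * B) = (B * H) * (N * B)"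
  proof -
    have "H * N * B = H * (N * B)" by (rule assoc_mult_mat[OF c])
    then show ?thesis using assoc_mult_mat[OF c(3,1) NB] by (simp only:)
  qed
  also have "\<dots> = e \<cdot>\<^sub>m (N * B)"
    unfolding BH mult_smult_assoc_mat[OF one_carrier_mat NB] left_mult_one_mat[OF NB] ..
  also have "(H * N ^\<^sub>m Suc k) * (e \<cdot>\<^sub>m (N * B)) = e \<cdot>\<^sub>m ((H * N ^\<^sub>m Suc k) * (N * B))"
    by (rule mult_smult_distrib[OF HN NB])
  also have "(H * N ^\<^sub>m Suc k) * (N * B) = H * N ^\<^sub>m Suc k * N * B"
    by (rule assoc_mult_mat[symmetric, OF HN c(2,3)])
  also have "H * N ^\<^sub>m Suc k * N = H * (N ^\<^sub>m Suc k * N)"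
    by (rule assoc_mult_mat[OF c(1) cN c(2)])
  also have "N ^\<^sub>m Suc k * N = N ^\<^sub>m Suc (Suc k)" by (simp only: pow_mat.simps(2)[of N "Suc k"])
  finally show ?case by (simp only: smult_smult_mat power_Suc mult.commute[of e])
qed

lemma eq_zero_matI:
  "M \<in> carrier_mat d d \<Longrightarrow> (\<And>i j. i < d \<Longrightarrow> j < d \<Longrightarrow> M $$ (i, j) = 0) \<Longrightarrow> M = 0\<^sub>m d d"
  by (rule eq_matI) auto

text \<open>Along a nonzero product of \<open>m\<close> entries the labels would have to increase \<open>m\<close> times, but only \<open>m\<close> labels exist.\<close>

lemma label_increasing_nilpotent:
  fixes N :: "'r::comm_ring_1 mat"
  assumes N: "N \<in> carrier_mat d d" and l: "\<And>i. i < d \<Longrightarrow> l i < (m::nat)"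
    and inc: "\<And>i j. i < d \<Longrightarrow> j < d \<Longrightarrow> N $$ (i, j) \<noteq> 0 \<Longrightarrow> l i < l j"
  shows "N ^\<^sub>m m = 0\<^sub>m d d"
proof -
  have *: "l i + k \<le> l j" if "i < d" "j < d" "(N ^\<^sub>m k) $$ (i, j) \<noteq> 0" for i j k
    using that
  proof (induction k arbitrary: j)
    case 0
    then show ?case using N by (auto split: if_splits)
  next
    case (Suc k)
    have "(N ^\<^sub>m Suc k) $$ (i, j) = (\<Sum>n<d. (N ^\<^sub>m k) $$ (i, n) * N $$ (n, j))"
      using Suc.prems pow_carrier_mat[OF N, of k] N by (simp add: scalar_prod_def atLeast0LessThan)
    then obtain n where n: "n < d" "(N ^\<^sub>m k) $$ (i, n) * N $$ (n, j) \<noteq> 0"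
      using Suc.prems(3) by (metis (no_types, lifting) lessThan_iff sum.neutral)
    then have "(N ^\<^sub>m k) $$ (i, n) \<noteq> 0" "N $$ (n, j) \<noteq> 0" by auto
    then show ?case using Suc.IH[OF Suc.prems(1) n(1)] inc[OF n(1) Suc.prems(2)] by simp
  qed
  show ?thesis
  proof (rule eq_zero_matI[OF pow_carrier_mat[OF N]])
    fix i j assume ij: "i < d" "j < d"
    show "(N ^\<^sub>m m) $$ (i, j) = 0"
    proof (rule ccontr)
      assume "(N ^\<^sub>m m) $$ (i, j) \<noteq> 0"
      from *[OF ij this] l[OF ij(2)] show False by simp
    qed
  qed
qed

text \<open>
  In the normal form \<open>M = h N h\<^sup>-\<^sup>1\<close>, with \<open>N\<close> in the linear space of the labelling, write the inverse
  as the adjugate divided by the determinant. Interpolating the scalar, \<open>h\<close> and \<open>N\<close> linearly then joins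
  two nilpotent matrices by a polynomial curve, on which nilpotency persists even where \<open>h\<close> is singular.
\<close>

lemma nilpotent_matrices_joined:
  fixes M1 M2 :: "'k::field mat"
  assumes M: "M1 \<in> carrier_mat d d" "M1 ^\<^sub>m Suc m = 0\<^sub>m d d" "M2 \<in> carrier_mat d d" "M2 ^\<^sub>m Suc m = 0\<^sub>m d d"
  obtains Y :: "'k poly mat" where "Y \<in> carrier_mat d d" "Y ^\<^sub>m Suc m = 0\<^sub>m d d"
    "map_mat (\<lambda>p. poly p 0) Y = M1" "map_mat (\<lambda>p. poly p 1) Y = M2"
proof -
  obtain l :: "nat \<Rightarrow> nat" where l: "\<And>i. i < d \<Longrightarrow> l i < Suc m"
    and nf: "\<And>M. M \<in> carrier_mat d d \<Longrightarrow> M ^\<^sub>m Suc m = 0\<^sub>m d d \<Longrightarrow>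
      \<exists>h N. h \<in> carrier_mat d d \<and> N \<in> carrier_mat d d \<and> det h \<noteq> (0 :: 'k::field) \<and> M * h = h * N \<and>
        (\<forall>i<d. \<forall>j<d. N $$ (i, j) \<noteq> 0 \<longrightarrow> l i < l j)"
    by (rule nilpotent_matrix_normal_form[of d m, where ?'k = 'k]) blast
  obtain h1 N1 where 1: "h1 \<in> carrier_mat d d" "N1 \<in> carrier_mat d d" "det h1 \<noteq> 0" "M1 * h1 = h1 * N1"
    "\<forall>i<d. \<forall>j<d. N1 $$ (i, j) \<noteq> 0 \<longrightarrow> l i < l j" using nf[OF M(1,2)] by blast
  obtain h2 N2 where 2: "h2 \<in> carrier_mat d d" "N2 \<in> carrier_mat d d" "det h2 \<noteq> 0" "M2 * h2 = h2 * N2"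
    "\<forall>i<d. \<forall>j<d. N2 $$ (i, j) \<noteq> 0 \<longrightarrow> l i < l j" using nf[OF M(3,4)] by blast
  define line where "line a b = [:a, b - a:]" for a b :: 'k
  have line: "poly (line a b) 0 = a" "poly (line a b) 1 = b" for a b by (auto simp: line_def)
  define h where "h = mat d d (\<lambda>(i, j). line (h1 $$ (i, j)) (h2 $$ (i, j)))"
  define N where "N = mat d d (\<lambda>(i, j). line (N1 $$ (i, j)) (N2 $$ (i, j)))"
  define c where "c = line (1 / det h1) (1 / det h2)"
  have hN: "h \<in> carrier_mat d d" "N \<in> carrier_mat d d" by (auto simp: h_def N_def)
  note adj = adj_mat[OF hN(1)]
  define Y where "Y = c \<cdot>\<^sub>m h * N * adj_mat h"
  have ch: "c \<cdot>\<^sub>m h \<in> carrier_mat d d" using hN by simp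
  have Y: "Y \<in> carrier_mat d d" unfolding Y_def using hN adj(1) by auto
  have "N $$ (i, j) \<noteq> 0 \<Longrightarrow> l i < l j" if "i < d" "j < d" for i j
    using 1(5) 2(5) that by (auto simp: N_def line_def)
  from label_increasing_nilpotent[OF hN(2) l this] have Nm: "N ^\<^sub>m Suc m = 0\<^sub>m d d" .
  have "adj_mat h * (c \<cdot>\<^sub>m h) = c \<cdot>\<^sub>m (adj_mat h * h)"
    by (rule mult_smult_distrib[OF adj(1) hN(1)])
  also have "\<dots> = (c * det h) \<cdot>\<^sub>m 1\<^sub>m d" unfolding adj(3) by (simp add: smult_smult_mat)
  finally have BH: "adj_mat h * (c \<cdot>\<^sub>m h) = (c * det h) \<cdot>\<^sub>m 1\<^sub>m d" .
  have "Y ^\<^sub>m Suc m = (c * det h) ^ m \<cdot>\<^sub>m (c \<cdot>\<^sub>m h * N ^\<^sub>m Suc m * adj_mat h)"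
    unfolding Y_def by (rule conjugate_power[OF ch hN(2) adj(1) BH])
  also have "c \<cdot>\<^sub>m h * N ^\<^sub>m Suc m * adj_mat h = 0\<^sub>m d d"
    unfolding Nm using right_mult_zero_mat[OF ch] left_mult_zero_mat[OF adj(1)] by simp
  finally have Y0: "Y ^\<^sub>m Suc m = 0\<^sub>m d d" by auto
  have ev: "map_mat (\<lambda>p. poly p t) Y = M'"
    if H: "h' \<in> carrier_mat d d" "N' \<in> carrier_mat d d" "M' \<in> carrier_mat d d" "det h' \<noteq> 0" "M' * h' = h' * N'"
      and e: "map_mat (\<lambda>p. poly p t) h = h'" "map_mat (\<lambda>p. poly p t) N = N'" "poly c t = 1 / det h'"
    for t h' N' M'
  proof -
    interpret ev: comm_ring_hom "\<lambda>p :: 'k poly. poly p t" by (rule comm_ring_hom_poly_at)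
    let ?ev = "map_mat (\<lambda>p. poly p t)"
    let ?B = "?ev (adj_mat h)"
    have B: "?B \<in> carrier_mat d d" using adj(1) by simp
    have "?ev (h * adj_mat h) = ?ev (det h \<cdot>\<^sub>m 1\<^sub>m d)" by (simp only: adj(2))
    moreover have "?ev (h * adj_mat h) = h' * ?B" using ev.mat_hom_mult[OF hN(1) adj(1)] e(1) by simp
    moreover have "poly (det h) t = det h'" using ev.hom_det[of h] e(1) by simp
    then have "?ev (det h \<cdot>\<^sub>m 1\<^sub>m d) = det h' \<cdot>\<^sub>m 1\<^sub>m d" by (auto intro!: eq_matI)
    ultimately have hB: "h' * ?B = det h' \<cdot>\<^sub>m 1\<^sub>m d" by simp
    have "?ev Y = ?ev (c \<cdot>\<^sub>m h * N) * ?B"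
      unfolding Y_def by (rule ev.mat_hom_mult[OF _ adj(1)]) (use hN in auto)
    also have "?ev (c \<cdot>\<^sub>m h * N) = ?ev (c \<cdot>\<^sub>m h) * N'"
      using ev.mat_hom_mult[OF ch hN(2)] e(2) by simp
    also have "?ev (c \<cdot>\<^sub>m h) = (1 / det h') \<cdot>\<^sub>m h'"
    proof (rule eq_matI)
      fix i j assume "i < dim_row ((1 / det h') \<cdot>\<^sub>m h')" "j < dim_col ((1 / det h') \<cdot>\<^sub>m h')"
      then have ij: "i < d" "j < d" using H(1) by auto
      have "poly (h $$ (i, j)) t = h' $$ (i, j)"
        using arg_cong[OF e(1), of "\<lambda>M. M $$ (i, j)"] ij hN(1) by simp
      then show "?ev (c \<cdot>\<^sub>m h) $$ (i, j) = ((1 / det h') \<cdot>\<^sub>m h') $$ (i, j)" using ij hN(1) H(1) e(3) by simp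
    qed (use hN(1) H(1) in simp_all)
    also have "(1 / det h') \<cdot>\<^sub>m h' * N' = (1 / det h') \<cdot>\<^sub>m (h' * N')"
      by (rule mult_smult_assoc_mat[OF H(1,2)])
    also have "\<dots> * ?B = (1 / det h') \<cdot>\<^sub>m (h' * N' * ?B)"
      by (rule mult_smult_assoc_mat) (use H B in auto)
    also have "h' * N' * ?B = M' * (h' * ?B)"
      unfolding H(5)[symmetric] by (rule assoc_mult_mat[OF H(3,1) B])
    also have "\<dots> = det h' \<cdot>\<^sub>m M'"
      unfolding hB using mult_smult_distrib[OF H(3) one_carrier_mat] H(3) by simp
    also have "(1 / det h') \<cdot>\<^sub>m \<dots> = M'" using H(4) by (simp add: smult_smult_mat one_smult_mat)
    finally show ?thesis .
  qed
  show ?thesis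
  proof (rule that[OF Y Y0])
    show "map_mat (\<lambda>p. poly p 0) Y = M1"
      by (rule ev[OF 1(1,2) M(1) 1(3,4)]) (use 1 in \<open>auto intro!: eq_matI simp: h_def N_def c_def line\<close>)
    show "map_mat (\<lambda>p. poly p 1) Y = M2"
      by (rule ev[OF 2(1,2) M(3) 2(3,4)]) (use 2 in \<open>auto intro!: eq_matI simp: h_def N_def c_def line\<close>)
  qed
qed


lemma mat_mult_entry:
  "A \<in> carrier_mat d d \<Longrightarrow> B \<in> carrier_mat d d \<Longrightarrow> i < d \<Longrightarrow> j < d \<Longrightarrow>
    (A * B) $$ (i, j) = (\<Sum>n<d. A $$ (i, n) * B $$ (n, j))"
  by (simp add: scalar_prod_def atLeast0LessThan)

lemma map_mat_entry:
  "A \<in> carrier_mat d d \<Longrightarrow> i < d \<Longrightarrow> j < d \<Longrightarrow> map_mat f A $$ (i, j) = f (A $$ (i, j))"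
  by simp

lemma pow_mat_add:
  fixes M :: "'r::comm_ring_1 mat"
  assumes "M \<in> carrier_mat d d"
  shows "M ^\<^sub>m (p + q) = M ^\<^sub>m p * M ^\<^sub>m q"
proof (induction q)
  case 0
  then show ?case using assms pow_carrier_mat[OF assms, of p] by simp
next
  case (Suc q)
  then show ?case
    unfolding add_Suc_right pow_mat.simps
    using assoc_mult_mat[OF pow_carrier_mat[OF assms, of p] pow_carrier_mat[OF assms, of q] assms] by (simp only:)
qed

text \<open>The algebra \<open>K[X]/(X\<^sup>D)\<close> in the coordinates of the basis \<open>1, X, \<dots>, X\<^sup>D\<^sup>-\<^sup>1\<close>.\<close>

locale truncated_algebra = coord_algebra +
  assumes D_pos: "0 < D"
    and coord_mult: "a \<in> carrier A \<Longrightarrow> b \<in> carrier A \<Longrightarrow> i < D \<Longrightarrow> \<kappa> (a \<otimes> b) i = (\<Sum>j\<le>i. \<kappa> a j * \<kappa> b (i - j))"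
    and coord_one: "i < D \<Longrightarrow> \<kappa> \<one> i = (if i = 0 then 1 else 0)"
begin

lemma rep_of_nilpotent_matrix:
  fixes M :: "'r::comm_ring_1 mat"
  assumes \<iota>: "scalar_hom \<iota>" and M: "M \<in> carrier_mat d d" "M ^\<^sub>m D = 0\<^sub>m d d"
  shows "matrix_rep \<iota> A d (\<lambda>a i j. \<Sum>k<D. \<iota> (\<kappa> a k) * (M ^\<^sub>m k) $$ (i, j))"
proof -
  interpret scalar_hom \<iota> by (rule \<iota>)
  have Mk: "M ^\<^sub>m k \<in> carrier_mat d d" for k by (rule pow_carrier_mat[OF M(1)])
  have M0: "(M ^\<^sub>m k) $$ (i, j) = 0" if "D \<le> k" "i < d" "j < d" for i j k
  proof -
    have "M ^\<^sub>m k = M ^\<^sub>m D * M ^\<^sub>m (k - D)" using pow_mat_add[OF M(1), of D "k - D"] that(1) by simp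
    also have "\<dots> = 0\<^sub>m d d" unfolding M(2) by (rule left_mult_zero_mat[OF Mk])
    finally show ?thesis using that by simp
  qed
  have Madd: "(M ^\<^sub>m (p + q)) $$ (i, j) = (\<Sum>n<d. (M ^\<^sub>m p) $$ (i, n) * (M ^\<^sub>m q) $$ (n, j))"
    if "i < d" "j < d" for i j p q
    unfolding pow_mat_add[OF M(1)] by (rule mat_mult_entry[OF Mk Mk that])
  show ?thesis
    unfolding matrix_rep_def
  proof (intro conjI ballI allI impI)
    fix i j assume ij: "i < d" "j < d"
    show "(\<Sum>k<D. \<iota> (\<kappa> \<one> k) * (M ^\<^sub>m k) $$ (i, j)) = (if i = j then 1 else 0)"
    proof -
      have "(\<Sum>k<D. \<iota> (\<kappa> \<one> k) * (M ^\<^sub>m k) $$ (i, j)) = (\<Sum>k<D. if k = 0 then (M ^\<^sub>m k) $$ (i, j) else 0)"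
        by (rule sum.cong) (auto simp: coord_one)
      also have "\<dots> = (if i = j then 1 else 0)" using D_pos ij M(1) by simp
      finally show ?thesis .
    qed
    fix a assume a: "a \<in> carrier A"
    show "(\<Sum>k<D. \<iota> (\<kappa> (c \<odot> a) k) * (M ^\<^sub>m k) $$ (i, j)) = \<iota> c * (\<Sum>k<D. \<iota> (\<kappa> a k) * (M ^\<^sub>m k) $$ (i, j))" for c
      using a by (simp add: coord_smult hom_mult sum_distrib_left mult.assoc)
    fix b assume b: "b \<in> carrier A"
    show "(\<Sum>k<D. \<iota> (\<kappa> (a \<oplus> b) k) * (M ^\<^sub>m k) $$ (i, j)) =
        (\<Sum>k<D. \<iota> (\<kappa> a k) * (M ^\<^sub>m k) $$ (i, j)) + (\<Sum>k<D. \<iota> (\<kappa> b k) * (M ^\<^sub>m k) $$ (i, j))"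
      using a b by (simp add: coord_add hom_add distrib_right sum.distrib)
    define F where "F p q = \<iota> (\<kappa> a p) * \<iota> (\<kappa> b q) * (M ^\<^sub>m (p + q)) $$ (i, j)" for p q
    have F0: "p + q < D" if "F p q \<noteq> 0" for p q using M0[OF _ ij, of "p + q"] that by (force simp: F_def)
    have "(\<Sum>k<D. \<iota> (\<kappa> (a \<otimes> b) k) * (M ^\<^sub>m k) $$ (i, j)) = (\<Sum>k<D. \<Sum>p\<le>k. F p (k - p))"
      using a b by (intro sum.cong) (auto simp: coord_mult hom_sum hom_mult sum_distrib_right F_def)
    also have "\<dots> = (\<Sum>(p, q)\<in>{(p, q). p + q < D}. F p q)"
      by (rule sum.triangle_reindex[symmetric])
    also have "\<dots> = (\<Sum>(p, q)\<in>{..<D} \<times> {..<D}. F p q)"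
      by (rule sum.mono_neutral_left) (auto dest: F0)
    also have "\<dots> = (\<Sum>p<D. \<Sum>q<D. F p q)" by (rule sum.cartesian_product[symmetric])
    also have "\<dots> = (\<Sum>p<D. \<Sum>q<D. \<Sum>n<d.
        (\<iota> (\<kappa> a p) * (M ^\<^sub>m p) $$ (i, n)) * (\<iota> (\<kappa> b q) * (M ^\<^sub>m q) $$ (n, j)))"
      unfolding F_def Madd[OF ij] sum_distrib_left by (intro sum.cong refl) (simp add: mult_ac)
    also have "\<dots> = (\<Sum>n<d. \<Sum>p<D. \<Sum>q<D.
        (\<iota> (\<kappa> a p) * (M ^\<^sub>m p) $$ (i, n)) * (\<iota> (\<kappa> b q) * (M ^\<^sub>m q) $$ (n, j)))"
      by (subst sum.swap[of _ "{..<d}"], subst sum.swap[of _ "{..<d}"]) (rule refl)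
    also have "\<dots> = (\<Sum>n<d. (\<Sum>k<D. \<iota> (\<kappa> a k) * (M ^\<^sub>m k) $$ (i, n)) * (\<Sum>k<D. \<iota> (\<kappa> b k) * (M ^\<^sub>m k) $$ (n, j)))"
      by (simp only: sum_product)
    finally show "(\<Sum>k<D. \<iota> (\<kappa> (a \<otimes> b) k) * (M ^\<^sub>m k) $$ (i, j)) =
      (\<Sum>n<d. (\<Sum>k<D. \<iota> (\<kappa> a k) * (M ^\<^sub>m k) $$ (i, n)) * (\<Sum>k<D. \<iota> (\<kappa> b k) * (M ^\<^sub>m k) $$ (n, j)))" .
  qed
qed

lemma basis_power: "basis (Suc k) = basis k \<otimes> basis 1" and basis_0: "basis 0 = \<one>"
proof -
  show "basis (Suc k) = basis k \<otimes> basis 1"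
  proof (rule coord_inj)
    fix i assume i: "i < D"
    have "\<kappa> (basis k \<otimes> basis 1) i = (\<Sum>j\<le>i. if j = k then if i = Suc k then 1 else 0 else 0)"
      unfolding coord_mult[OF basis_closed basis_closed i] using i by (intro sum.cong) (auto simp: coord_basis)
    also have "\<dots> = \<kappa> (basis (Suc k)) i" using i by (auto simp: coord_basis)
    finally show "\<kappa> (basis (Suc k)) i = \<kappa> (basis k \<otimes> basis 1) i" ..
  qed simp_all
  show "basis 0 = \<one>" by (rule coord_inj) (auto simp: coord_basis coord_one)
qed

lemma nilpotent_matrix_of_rep:
  assumes \<rho>: "matrix_rep (\<lambda>c. c) A d \<rho>"
  obtains M where "M \<in> carrier_mat d d" "M ^\<^sub>m D = 0\<^sub>m d d"
    "\<And>a i j. a \<in> carrier A \<Longrightarrow> i < d \<Longrightarrow> j < d \<Longrightarrow> \<rho> a i j = (\<Sum>k<D. \<kappa> a k * (M ^\<^sub>m k) $$ (i, j))"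
proof -
  define M where "M = mat d d (\<lambda>(i, j). \<rho> (basis 1) i j)"
  have M: "M \<in> carrier_mat d d" by (simp add: M_def)
  have Mk: "(M ^\<^sub>m k) $$ (i, j) = \<rho> (basis k) i j" if "i < d" "j < d" for i j k
    using that
  proof (induction k arbitrary: j)
    case 0
    then show ?case using \<rho> M by (simp add: matrix_rep_def basis_0)
  next
    case (Suc k)
    have "(M ^\<^sub>m Suc k) $$ (i, j) = (\<Sum>n<d. (M ^\<^sub>m k) $$ (i, n) * M $$ (n, j))"
      unfolding pow_mat.simps by (rule mat_mult_entry[OF pow_carrier_mat[OF M] M Suc.prems])
    also have "\<dots> = (\<Sum>n<d. \<rho> (basis k) i n * \<rho> (basis 1) n j)"
      using Suc by (intro sum.cong) (auto simp: M_def)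
    also have "\<dots> = \<rho> (basis (Suc k)) i j"
      using \<rho> Suc.prems basis_closed unfolding matrix_rep_def basis_power by simp
    finally show ?case .
  qed
  have lin: "\<rho> a i j = (\<Sum>k<D. \<kappa> a k * \<rho> (basis k) i j)" if "a \<in> carrier A" "i < d" "j < d" for a i j
    by (rule linear_expand[OF that(1) scalar_hom_id]) (use \<rho> that in \<open>simp_all add: matrix_rep_def\<close>)
  have D0: "\<kappa> (basis D) k = 0" if "k < D" for k using that by (simp add: coord_basis)
  have "M ^\<^sub>m D = 0\<^sub>m d d"
  proof (rule eq_zero_matI[OF pow_carrier_mat[OF M]])
    fix i j assume ij: "i < d" "j < d"
    have "\<rho> (basis D) i j = (\<Sum>k<D. 0)"
      by (rule trans[OF lin[OF basis_closed ij]], rule sum.cong) (simp_all add: D0)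
    then show "(M ^\<^sub>m D) $$ (i, j) = 0" unfolding Mk[OF ij] by simp
  qed
  moreover have "\<rho> a i j = (\<Sum>k<D. \<kappa> a k * (M ^\<^sub>m k) $$ (i, j))" if "a \<in> carrier A" "i < d" "j < d" for a i j
    using lin[OF that] Mk[OF that(2,3)] by simp
  ultimately show ?thesis using that M by blast
qed

end

lemma truncated_algebra_geometrically_irreducible:
  fixes A :: "('k::alg_closed_field, 'a) module"
  assumes "truncated_algebra A D \<kappa>"
  shows "geometrically_irreducible A"
proof -
  interpret truncated_algebra A D \<kappa> by fact
  have D: "Suc (D - 1) = D" using D_pos by simp
  have "irreducible_space (zariski_topology (mod_coordinate_ring A d))" for d
  proof (rule irreducible_if_joined_by_curves[OF coord_algebra_axioms])
    have "0\<^sub>m d d ^\<^sub>m Suc (D - 1) = (0\<^sub>m d d :: 'k mat)"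
      unfolding pow_mat.simps by (rule right_mult_zero_mat[OF pow_carrier_mat[OF zero_carrier_mat]])
    then have "0\<^sub>m d d ^\<^sub>m D = (0\<^sub>m d d :: 'k mat)" unfolding D .
    from rep_of_nilpotent_matrix[OF scalar_hom_id zero_carrier_mat this]
    show "matrix_rep (\<lambda>c. c) A d (\<lambda>a i j. \<Sum>k<D. \<kappa> a k * (0\<^sub>m d d ^\<^sub>m k) $$ (i, j))" .
    fix \<rho>1 \<rho>2 assume \<rho>: "matrix_rep (\<lambda>c. c) A d \<rho>1" "matrix_rep (\<lambda>c. c) A d \<rho>2"
    obtain M1 where M1: "M1 \<in> carrier_mat d d" "M1 ^\<^sub>m D = 0\<^sub>m d d"
      "\<And>a i j. a \<in> carrier A \<Longrightarrow> i < d \<Longrightarrow> j < d \<Longrightarrow> \<rho>1 a i j = (\<Sum>k<D. \<kappa> a k * (M1 ^\<^sub>m k) $$ (i, j))"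
      by (rule nilpotent_matrix_of_rep[OF \<rho>(1)]) blast
    obtain M2 where M2: "M2 \<in> carrier_mat d d" "M2 ^\<^sub>m D = 0\<^sub>m d d"
      "\<And>a i j. a \<in> carrier A \<Longrightarrow> i < d \<Longrightarrow> j < d \<Longrightarrow> \<rho>2 a i j = (\<Sum>k<D. \<kappa> a k * (M2 ^\<^sub>m k) $$ (i, j))"
      by (rule nilpotent_matrix_of_rep[OF \<rho>(2)]) blast
    obtain Y :: "'k poly mat" where Y: "Y \<in> carrier_mat d d" "Y ^\<^sub>m D = 0\<^sub>m d d"
      "map_mat (\<lambda>p. poly p 0) Y = M1" "map_mat (\<lambda>p. poly p 1) Y = M2"
      by (rule nilpotent_matrices_joined[of M1 d "D - 1" M2, unfolded D, OF M1(1,2) M2(1,2)])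
    have at: "poly (\<Sum>k<D. [:\<kappa> a k:] * (Y ^\<^sub>m k) $$ (i, j)) t = (\<Sum>k<D. \<kappa> a k * (map_mat (\<lambda>p. poly p t) Y ^\<^sub>m k) $$ (i, j))"
      if "i < d" "j < d" for a i j t
    proof -
      interpret ev: comm_ring_hom "\<lambda>p :: 'k poly. poly p t" by (rule comm_ring_hom_poly_at)
      have "(map_mat (\<lambda>p. poly p t) Y ^\<^sub>m k) $$ (i, j) = poly ((Y ^\<^sub>m k) $$ (i, j)) t" for k
        unfolding ev.mat_hom_pow[OF Y(1), symmetric] by (rule map_mat_entry[OF pow_carrier_mat[OF Y(1)] that])
      then show ?thesis by (simp add: poly_sum)
    qed
    show "\<exists>\<rho>. matrix_rep (\<lambda>c. [:c:]) A d \<rho> \<and> (\<forall>a\<in>carrier A. \<forall>i<d. \<forall>j<d.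
        poly (\<rho> a i j) 0 = \<rho>1 a i j \<and> poly (\<rho> a i j) 1 = \<rho>2 a i j)"
      by (intro exI[of _ "\<lambda>a i j. \<Sum>k<D. [:\<kappa> a k:] * (Y ^\<^sub>m k) $$ (i, j)"] conjI ballI allI impI
          rep_of_nilpotent_matrix[OF scalar_hom_const Y(1,2)])
        (simp_all only: at Y(3,4) M1(3) M2(3))
  qed
  then show ?thesis
    unfolding geometrically_irreducible_def Let_def by (blast intro: irreducible_imp_components_irreducible)
qed

section \<open>Regular and coregular representations\<close>

lemma matrix_rep_at:
  fixes A :: "('k::field, 'a) module"
  assumes "matrix_rep (\<lambda>c. [:c:]) A d \<rho>"
  shows "matrix_rep (\<lambda>c. c) A d (\<lambda>a i j. poly (\<rho> a i j) t)"
proof -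
  have "\<forall>a\<in>carrier A. \<forall>b\<in>carrier A. \<forall>i<d. \<forall>j<d. \<rho> (a \<oplus>\<^bsub>A\<^esub> b) i j = \<rho> a i j + \<rho> b i j"
    "\<forall>c. \<forall>a\<in>carrier A. \<forall>i<d. \<forall>j<d. \<rho> (c \<odot>\<^bsub>A\<^esub> a) i j = [:c:] * \<rho> a i j"
    "\<forall>a\<in>carrier A. \<forall>b\<in>carrier A. \<forall>i<d. \<forall>j<d. \<rho> (a \<otimes>\<^bsub>A\<^esub> b) i j = (\<Sum>k<d. \<rho> a i k * \<rho> b k j)"
    "\<forall>i<d. \<forall>j<d. \<rho> \<one>\<^bsub>A\<^esub> i j = (if i = j then 1 else 0)"
    using assms unfolding matrix_rep_def by blast+
  then show ?thesis unfolding matrix_rep_def by (simp add: poly_sum)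
qed

lemma matrix_rep_cong:
  assumes "ring A" "\<And>c a. a \<in> carrier A \<Longrightarrow> c \<odot>\<^bsub>A\<^esub> a \<in> carrier A"
    and "matrix_rep \<iota> A d \<rho>" and "\<And>a i j. a \<in> carrier A \<Longrightarrow> i < d \<Longrightarrow> j < d \<Longrightarrow> \<rho> a i j = \<rho>' a i j"
  shows "matrix_rep \<iota> A d \<rho>'"
proof -
  interpret ring A by fact
  show ?thesis using assms(3) unfolding matrix_rep_def by (simp add: assms(2) flip: assms(4))
qed

text \<open>
  Conjugation with the diagonal matrix of entries \<open>t\<close> to the power \<open>w i\<close> contracts a representation that
  is triangular for the weights \<open>w\<close> to its block-diagonal part.
\<close>

lemma contraction_curve:
  fixes A :: "('k::field, 'a) module"
  assumes \<rho>: "matrix_rep (\<lambda>c. c) A d \<rho>" and A: "ring A" "\<And>c a. a \<in> carrier A \<Longrightarrow> c \<odot>\<^bsub>A\<^esub> a \<in> carrier A"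
    and w: "\<And>a i j. a \<in> carrier A \<Longrightarrow> i < d \<Longrightarrow> j < d \<Longrightarrow> \<rho> a i j \<noteq> 0 \<Longrightarrow> w j \<le> (w i :: nat)"
  shows "matrix_rep (\<lambda>c. [:c:]) A d (\<lambda>a i j. Polynomial.monom (\<rho> a i j) (w i - w j))"
proof -
  interpret ring A by fact
  have R: "\<And>a b i j. a \<in> carrier A \<Longrightarrow> b \<in> carrier A \<Longrightarrow> i < d \<Longrightarrow> j < d \<Longrightarrow> \<rho> (a \<oplus>\<^bsub>A\<^esub> b) i j = \<rho> a i j + \<rho> b i j"
    "\<And>c a i j. a \<in> carrier A \<Longrightarrow> i < d \<Longrightarrow> j < d \<Longrightarrow> \<rho> (c \<odot>\<^bsub>A\<^esub> a) i j = c * \<rho> a i j"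
    "\<And>a b i j. a \<in> carrier A \<Longrightarrow> b \<in> carrier A \<Longrightarrow> i < d \<Longrightarrow> j < d \<Longrightarrow> \<rho> (a \<otimes>\<^bsub>A\<^esub> b) i j = (\<Sum>k<d. \<rho> a i k * \<rho> b k j)"
    "\<And>i j. i < d \<Longrightarrow> j < d \<Longrightarrow> \<rho> \<one>\<^bsub>A\<^esub> i j = (if i = j then 1 else 0)"
    using \<rho> unfolding matrix_rep_def by blast+
  have monom_sum: "Polynomial.monom (\<Sum>k\<in>S. f k) n = (\<Sum>k\<in>S. Polynomial.monom (f k) n)" for f :: "nat \<Rightarrow> 'k" and S n
    by (rule poly_eqI) (simp add: coeff_sum)
  show ?thesis
    unfolding matrix_rep_def
  proof (intro conjI ballI allI impI)
    fix i j assume ij: "i < d" "j < d"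
    show "Polynomial.monom (\<rho> \<one>\<^bsub>A\<^esub> i j) (w i - w j) = (if i = j then 1 else 0)"
      using ij by (simp add: R(4))
    fix a assume a: "a \<in> carrier A"
    show "Polynomial.monom (\<rho> (c \<odot>\<^bsub>A\<^esub> a) i j) (w i - w j) = [:c:] * Polynomial.monom (\<rho> a i j) (w i - w j)" for c
      using ij a by (simp add: R(2) smult_monom)
    fix b assume b: "b \<in> carrier A"
    show "Polynomial.monom (\<rho> (a \<oplus>\<^bsub>A\<^esub> b) i j) (w i - w j) =
        Polynomial.monom (\<rho> a i j) (w i - w j) + Polynomial.monom (\<rho> b i j) (w i - w j)"
      using ij a b by (simp add: R(1) add_monom)
    have "Polynomial.monom (\<rho> a i k * \<rho> b k j) (w i - w j) =
        Polynomial.monom (\<rho> a i k) (w i - w k) * Polynomial.monom (\<rho> b k j) (w k - w j)" if "k < d" for k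
    proof (cases "\<rho> a i k = 0 \<or> \<rho> b k j = 0")
      case False
      then have "w k \<le> w i" "w j \<le> w k" using w a b ij that by blast+
      then show ?thesis by (simp add: mult_monom)
    qed auto
    then show "Polynomial.monom (\<rho> (a \<otimes>\<^bsub>A\<^esub> b) i j) (w i - w j) =
        (\<Sum>k<d. Polynomial.monom (\<rho> a i k) (w i - w k) * Polynomial.monom (\<rho> b k j) (w k - w j))"
      unfolding R(3)[OF a b ij] monom_sum by (intro sum.cong) auto
  qed
qed

text \<open>
  A finite-dimensional local algebra with a basis adapted to a full flag of two-sided ideals: \<open>basis 0\<close> is the
  identity, the other basis elements span the radical, and multiplication by the radical increases the
  basis index.
\<close>

locale triangular_algebra = coord_algebra A D \<kappa>
  for A :: "('k::field, 'a) module" (structure) and D \<kappa> +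
  assumes D_pos: "0 < D"
    and coord_one: "i < D \<Longrightarrow> \<kappa> \<one> i = (if i = 0 then 1 else 0)"
    and triangular_l: "0 < k \<Longrightarrow> k < D \<Longrightarrow> j < D \<Longrightarrow> i \<le> j \<Longrightarrow> \<kappa> (basis k \<otimes> basis j) i = 0"
    and triangular_r: "0 < k \<Longrightarrow> k < D \<Longrightarrow> j < D \<Longrightarrow> i \<le> j \<Longrightarrow> \<kappa> (basis j \<otimes> basis k) i = 0"
begin

lemma basis_0: "basis 0 = \<one>"
  by (rule coord_inj) (auto simp: coord_basis coord_one)

lemma coord_mult_expand_l:
  assumes "a \<in> carrier A" "b \<in> carrier A" "i < D"
  shows "\<kappa> (a \<otimes> b) i = (\<Sum>k<D. \<kappa> a k * \<kappa> (basis k \<otimes> b) i)"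
  by (rule linear_expand[OF assms(1) scalar_hom_id])
    (use assms in \<open>simp_all add: l_distr coord_add smult_l coord_smult\<close>)

lemma coord_mult_expand_r:
  assumes "a \<in> carrier A" "b \<in> carrier A" "i < D"
  shows "\<kappa> (a \<otimes> b) i = (\<Sum>k<D. \<kappa> b k * \<kappa> (a \<otimes> basis k) i)"
  by (rule linear_expand[OF assms(2) scalar_hom_id])
    (use assms in \<open>simp_all add: r_distr coord_add smult_r coord_smult\<close>)

lemma coord_mult_basis_r:
  assumes "a \<in> carrier A" "j < D" "i \<le> j"
  shows "\<kappa> (a \<otimes> basis j) i = (if i = j then \<kappa> a 0 else 0)"
proof -
  have "\<kappa> (a \<otimes> basis j) i = (\<Sum>k<D. \<kappa> a k * \<kappa> (basis k \<otimes> basis j) i)"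
    by (rule coord_mult_expand_l) (use assms in auto)
  also have "\<dots> = (\<Sum>k<D. if k = 0 then \<kappa> a 0 * \<kappa> (basis j) i else 0)"
    using assms by (intro sum.cong) (auto simp: triangular_l basis_0)
  also have "\<dots> = (if i = j then \<kappa> a 0 else 0)" using assms D_pos by (simp add: coord_basis)
  finally show ?thesis .
qed

lemma coord_mult_basis_l:
  assumes "a \<in> carrier A" "j < D" "i \<le> j"
  shows "\<kappa> (basis j \<otimes> a) i = (if i = j then \<kappa> a 0 else 0)"
proof -
  have "\<kappa> (basis j \<otimes> a) i = (\<Sum>k<D. \<kappa> a k * \<kappa> (basis j \<otimes> basis k) i)"
    by (rule coord_mult_expand_r) (use assms in auto)
  also have "\<dots> = (\<Sum>k<D. if k = 0 then \<kappa> a 0 * \<kappa> (basis j) i else 0)"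
    using assms by (intro sum.cong) (auto simp: triangular_r basis_0)
  also have "\<dots> = (if i = j then \<kappa> a 0 else 0)" using assms D_pos by (simp add: coord_basis)
  finally show ?thesis .
qed

text \<open>
  In dimension \<open>d\<close> these are the regular representation of the quotient of \<open>A\<close> by the span of
  \<open>basis d, basis (d+1), \<dots>\<close>, and the dual of the regular right module of this quotient.
\<close>

definition regular :: "'a \<Rightarrow> nat \<Rightarrow> nat \<Rightarrow> 'k" where
  "regular a i j = \<kappa> (a \<otimes> basis j) i"

definition coregular :: "'a \<Rightarrow> nat \<Rightarrow> nat \<Rightarrow> 'k" where
  "coregular a i j = \<kappa> (basis i \<otimes> a) j"

lemma regular_rep:
  assumes "d \<le> D"
  shows "matrix_rep (\<lambda>c. c) A d regular"
  unfolding matrix_rep_def regular_def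
proof (intro conjI ballI allI impI)
  fix i j assume ij: "i < d" "j < d"
  then have ijD: "i < D" "j < D" using assms by auto
  show "\<kappa> (\<one> \<otimes> basis j) i = (if i = j then 1 else 0)" using ijD by (simp add: coord_basis)
  fix a assume a: "a \<in> carrier A"
  show "\<kappa> ((c \<odot> a) \<otimes> basis j) i = c * \<kappa> (a \<otimes> basis j) i" for c
    using a ijD by (simp add: smult_l coord_smult)
  fix b assume b: "b \<in> carrier A"
  show "\<kappa> ((a \<oplus> b) \<otimes> basis j) i = \<kappa> (a \<otimes> basis j) i + \<kappa> (b \<otimes> basis j) i"
    using a b ijD by (simp add: l_distr coord_add)
  have "\<kappa> ((a \<otimes> b) \<otimes> basis j) i = \<kappa> (a \<otimes> (b \<otimes> basis j)) i" using a b by (simp add: m_assoc)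
  also have "\<dots> = (\<Sum>k<D. \<kappa> (b \<otimes> basis j) k * \<kappa> (a \<otimes> basis k) i)"
    by (rule coord_mult_expand_r) (use a b ijD in auto)
  also have "\<dots> = (\<Sum>k<d. \<kappa> (b \<otimes> basis j) k * \<kappa> (a \<otimes> basis k) i)"
    by (rule sum.mono_neutral_right) (use a ij assms in \<open>auto simp: coord_mult_basis_r\<close>)
  finally show "\<kappa> ((a \<otimes> b) \<otimes> basis j) i = (\<Sum>k<d. \<kappa> (a \<otimes> basis k) i * \<kappa> (b \<otimes> basis j) k)"
    by (simp add: mult.commute)
qed

lemma coregular_rep:
  assumes "d \<le> D"
  shows "matrix_rep (\<lambda>c. c) A d coregular"
  unfolding matrix_rep_def coregular_def
proof (intro conjI ballI allI impI)
  fix i j assume ij: "i < d" "j < d"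
  then have ijD: "i < D" "j < D" using assms by auto
  show "\<kappa> (basis i \<otimes> \<one>) j = (if i = j then 1 else 0)" using ijD by (simp add: coord_basis)
  fix a assume a: "a \<in> carrier A"
  show "\<kappa> (basis i \<otimes> (c \<odot> a)) j = c * \<kappa> (basis i \<otimes> a) j" for c
    using a ijD by (simp add: smult_r coord_smult)
  fix b assume b: "b \<in> carrier A"
  show "\<kappa> (basis i \<otimes> (a \<oplus> b)) j = \<kappa> (basis i \<otimes> a) j + \<kappa> (basis i \<otimes> b) j"
    using a b ijD by (simp add: r_distr coord_add)
  have "\<kappa> (basis i \<otimes> (a \<otimes> b)) j = \<kappa> ((basis i \<otimes> a) \<otimes> b) j" using a b by (simp add: m_assoc)
  also have "\<dots> = (\<Sum>k<D. \<kappa> (basis i \<otimes> a) k * \<kappa> (basis k \<otimes> b) j)"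
    by (rule coord_mult_expand_l) (use a b ijD in auto)
  also have "\<dots> = (\<Sum>k<d. \<kappa> (basis i \<otimes> a) k * \<kappa> (basis k \<otimes> b) j)"
    by (rule sum.mono_neutral_right) (use b ij assms in \<open>auto simp: coord_mult_basis_l\<close>)
  finally show "\<kappa> (basis i \<otimes> (a \<otimes> b)) j = (\<Sum>k<d. \<kappa> (basis i \<otimes> a) k * \<kappa> (basis k \<otimes> b) j)" .
qed

text \<open>
  Both representations contract to the semisimple one, so they lie in the same connected component.
\<close>

lemma regular_coregular_connected:
  assumes d: "d \<le> D"
  shows "connected_component_of (zariski_topology (mod_coordinate_ring A d))
    (point_prime (\<lambda>c. c) d regular) (point_prime (\<lambda>c. c) d coregular)"
proof -
  let ?T = "zariski_topology (mod_coordinate_ring A d)"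
  let ?\<epsilon> = "\<lambda>a i j :: nat. if i = j then \<kappa> a 0 else 0"
  note A = ring_axioms smult_closed
  note rep = regular_rep[OF d] coregular_rep[OF d]
  define \<rho>1 where "\<rho>1 a i j = Polynomial.monom (regular a i j) (i - j)" for a i j
  \<comment> \<open>The weights are reversed, since the coregular representation is upper triangular.\<close>
  define \<rho>2 where "\<rho>2 a i j = Polynomial.monom (coregular a i j) ((D - i) - (D - j))" for a i j
  have \<rho>1: "matrix_rep (\<lambda>c. [:c:]) A d \<rho>1"
    unfolding \<rho>1_def
  proof (rule contraction_curve[OF rep(1) A])
    fix a i j assume "a \<in> carrier A" "i < d" "j < d" "regular a i j \<noteq> 0"
    then show "j \<le> i" using d coord_mult_basis_r[of a j i] by (cases "i \<le> j") (auto simp: regular_def split: if_splits)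
  qed
  have \<rho>2: "matrix_rep (\<lambda>c. [:c:]) A d \<rho>2"
    unfolding \<rho>2_def
  proof (rule contraction_curve[OF rep(2) A])
    fix a i j assume "a \<in> carrier A" "i < d" "j < d" "coregular a i j \<noteq> 0"
    then show "D - j \<le> D - i" using d coord_mult_basis_l[of a i j] by (cases "j \<le> i") (auto simp: coregular_def split: if_splits)
  qed
  have at1: "poly (\<rho>1 a i j) 1 = regular a i j" "poly (\<rho>2 a i j) 1 = coregular a i j" for a i j
    by (simp_all add: \<rho>1_def \<rho>2_def poly_monom)
  have 10: "poly (\<rho>1 a i j) 0 = ?\<epsilon> a i j" if "a \<in> carrier A" "i < d" "j < d" for a i j
    using that d coord_mult_basis_r[of a j i] by (auto simp: \<rho>1_def poly_monom regular_def zero_power_eq)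
  have 20: "poly (\<rho>2 a i j) 0 = ?\<epsilon> a i j" if "a \<in> carrier A" "i < d" "j < d" for a i j
    using that d coord_mult_basis_l[of a i j] by (auto simp: \<rho>2_def poly_monom coregular_def zero_power_eq)
  have \<epsilon>: "matrix_rep (\<lambda>c. c) A d ?\<epsilon>"
    by (rule matrix_rep_cong[OF A matrix_rep_at[OF \<rho>1, of 0] 10])
  note c1 = curve_connected[OF \<rho>1 rep(1), of 1, OF at1(1)] curve_connected[OF \<rho>1 \<epsilon>, of 0, OF 10]
  note c2 = curve_connected[OF \<rho>2 rep(2), of 1, OF at1(2)] curve_connected[OF \<rho>2 \<epsilon>, of 0, OF 20]
  have "connected_component_of ?T (point_prime (\<lambda>c. c) d regular) (point_prime (\<lambda>c. c) d ?\<epsilon>)"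
    by (rule connected_component_of_trans[OF connected_component_of_sym[THEN iffD1, OF c1(1)] c1(2)])
  moreover have "connected_component_of ?T (point_prime (\<lambda>c. c) d ?\<epsilon>) (point_prime (\<lambda>c. c) d coregular)"
    by (rule connected_component_of_trans[OF connected_component_of_sym[THEN iffD1, OF c2(2)] c2(1)])
  ultimately show ?thesis by (rule connected_component_of_trans)
qed

end

section \<open>Cyclic and cocyclic representations\<close>

lemma det_closed:
  assumes M: "M \<in> carrier_mat n n" and e: "\<And>i j. i < n \<Longrightarrow> j < n \<Longrightarrow> M $$ (i, j) \<in> carrier (mpoly_ring V)"
  shows "det M \<in> carrier (mpoly_ring V)"
  unfolding det_def'[OF M]
proof (rule mpoly_ring_sum)
  fix p assume "p \<in> {p. p permutes {0..<n}}"
  then have p: "p i < n" if "i < n" for i using that permutes_in_image[of p "{0..<n}" i] by auto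
  have "(\<Prod>i\<in>S. M $$ (i, p i)) \<in> carrier (mpoly_ring V)" if "S \<subseteq> {0..<n}" for S
    using that
  proof (induction S rule: infinite_finite_induct)
    case (insert x S)
    then have "M $$ (x, p x) * (\<Prod>i\<in>S. M $$ (i, p i)) \<in> carrier (mpoly_ring V)"
      by (intro mpoly_ring_closed(2) e p) auto
    then show ?case using insert.hyps by simp
  qed simp_all
  then have pr: "(\<Prod>i = 0..<n. M $$ (i, p i)) \<in> carrier (mpoly_ring V)" by blast
  then have "- (\<Prod>i = 0..<n. M $$ (i, p i)) \<in> carrier (mpoly_ring V)" by (rule mpoly_ring_closed(3))
  with pr show "signof p * (\<Prod>i = 0..<n. M $$ (i, p i)) \<in> carrier (mpoly_ring V)"
    by (simp add: sign_def)
qed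

lemma det_nonzero_injective:
  fixes M :: "'k::field mat"
  assumes M: "M \<in> carrier_mat d d" "det M \<noteq> 0" and 0: "\<And>i. i < d \<Longrightarrow> (\<Sum>j<d. M $$ (i, j) * c j) = 0" and l: "l < d"
  shows "c l = 0"
proof -
  have "(\<Sum>j<d. (adj_mat M * M) $$ (l, j) * c j) = (\<Sum>j<d. \<Sum>i<d. adj_mat M $$ (l, i) * M $$ (i, j) * c j)"
    by (rule sum.cong) (simp_all add: mat_mult_entry[OF adj_mat(1)[OF M(1)] M(1) l] sum_distrib_right)
  also have "\<dots> = (\<Sum>i<d. adj_mat M $$ (l, i) * (\<Sum>j<d. M $$ (i, j) * c j))"
    by (subst sum.swap) (simp add: sum_distrib_left mult.assoc)
  also have "\<dots> = 0" using 0 by simp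
  finally have "(\<Sum>j<d. (det M \<cdot>\<^sub>m 1\<^sub>m d) $$ (l, j) * c j) = 0" unfolding adj_mat(3)[OF M(1)] .
  moreover have "(\<Sum>j<d. (det M \<cdot>\<^sub>m 1\<^sub>m d) $$ (l, j) * c j) = (\<Sum>j<d. if j = l then det M * c l else 0)"
    using l by (intro sum.cong) auto
  ultimately show ?thesis using M(2) l by simp
qed

lemma det_nonzero_solvable:
  fixes M :: "'k::field mat"
  assumes M: "M \<in> carrier_mat d d" "det M \<noteq> 0"
  shows "\<exists>c. \<forall>i<d. (\<Sum>j<d. M $$ (i, j) * c j) = v i"
proof (intro exI allI impI)
  fix i assume i: "i < d"
  have "(\<Sum>j<d. M $$ (i, j) * ((\<Sum>l<d. adj_mat M $$ (j, l) * v l) / det M)) =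
      (\<Sum>j<d. \<Sum>l<d. M $$ (i, j) * adj_mat M $$ (j, l) * v l) / det M"
    by (simp add: sum_divide_distrib sum_distrib_left mult.assoc)
  also have "\<dots> = (\<Sum>l<d. (M * adj_mat M) $$ (i, l) * v l) / det M"
    by (subst sum.swap) (simp add: mat_mult_entry[OF M(1) adj_mat(1)[OF M(1)] i] sum_distrib_right)
  also have "\<dots> = (\<Sum>l<d. if l = i then det M * v i else 0) / det M"
    unfolding adj_mat(2)[OF M(1)] using i by (intro arg_cong2[of _ _ _ _ "(/)"] sum.cong) auto
  also have "\<dots> = v i" using i M(2) by simp
  finally show "(\<Sum>j<d. M $$ (i, j) * ((\<Sum>l<d. adj_mat M $$ (j, l) * v l) / det M)) = v i" .
qed

text \<open>
  Being generated by the first basis vector, and being cogenerated by the first coordinate, are open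
  conditions. The regular representation satisfies the first and the coregular one the second; hence a
  connected component that contains both, if it is irreducible, has a member with both properties.
\<close>

lemma cyclic_cocyclic_rep:
  fixes A :: "('k::alg_closed_field, 'a) module"
  assumes "triangular_algebra A D \<kappa>" and d: "0 < d" "d \<le> D" and irr: "geometrically_irreducible A"
  obtains \<rho> where "matrix_rep (\<lambda>c. c) A d \<rho>"
    "det (mat d d (\<lambda>(i, j). \<rho> (coord_algebra.basis A D \<kappa> j) i 0)) \<noteq> 0"
    "det (mat d d (\<lambda>(j, i). \<rho> (coord_algebra.basis A D \<kappa> j) 0 i)) \<noteq> 0"
proof -
  interpret triangular_algebra A D \<kappa> by fact
  let ?R = "mod_coordinate_ring A d" and ?M = "mpoly_ring (vars d) :: (('a \<times> nat \<times> nat \<Rightarrow>\<^sub>0 nat) \<Rightarrow>\<^sub>0 'k) ring"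
  interpret R: cring ?R by (rule cring_coordinate_ring)
  define F :: "('a \<times> nat \<times> nat \<Rightarrow>\<^sub>0 nat) \<Rightarrow>\<^sub>0 'k" where "F = det (mat d d (\<lambda>(i, j). mpoly_var (basis j, i, 0)))"
  define G :: "('a \<times> nat \<times> nat \<Rightarrow>\<^sub>0 nat) \<Rightarrow>\<^sub>0 'k" where "G = det (mat d d (\<lambda>(j, i). mpoly_var (basis j, 0, i)))"
  have FG: "F \<in> carrier ?M" "G \<in> carrier ?M"
    unfolding F_def G_def using d(1) by (auto intro!: det_closed mpoly_ring_closed(6))
  have ev: "rep_eval (\<lambda>c. c) \<rho> F = det (mat d d (\<lambda>(i, j). \<rho> (basis j) i 0))"
    "rep_eval (\<lambda>c. c) \<rho> G = det (mat d d (\<lambda>(j, i). \<rho> (basis j) 0 i))" for \<rho>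
  proof -
    note e = scalar_hom.comm_ring_hom_mpoly_eval[OF scalar_hom_id, of "\<lambda>(a, i, j). \<rho> a i j"]
    note var = scalar_hom.mpoly_eval_var[OF scalar_hom_id, of "\<lambda>(a, i, j). \<rho> a i j"]
    show "rep_eval (\<lambda>c. c) \<rho> F = det (mat d d (\<lambda>(i, j). \<rho> (basis j) i 0))"
      unfolding F_def comm_ring_hom.hom_det[OF e, symmetric]
      by (rule arg_cong[of _ _ det], rule eq_matI) (simp_all add: var)
    show "rep_eval (\<lambda>c. c) \<rho> G = det (mat d d (\<lambda>(j, i). \<rho> (basis j) 0 i))"
      unfolding G_def comm_ring_hom.hom_det[OF e, symmetric]
      by (rule arg_cong[of _ _ det], rule eq_matI) (simp_all add: var)
  qed
  have one_mat: "mat d d (\<lambda>(i, j). if i = j then 1 else 0) = (1\<^sub>m d :: 'k mat)" by (rule eq_matI) auto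
  have "mat d d (\<lambda>(i, j). regular (basis j) i 0) = 1\<^sub>m d"
    unfolding one_mat[symmetric] using d by (intro eq_matI) (auto simp: regular_def basis_0 coord_basis)
  then have F1: "rep_eval (\<lambda>c. c) regular F \<noteq> 0" unfolding ev by simp
  have "mat d d (\<lambda>(j, i). coregular (basis j) 0 i) = 1\<^sub>m d"
    unfolding one_mat[symmetric] using d by (intro eq_matI) (auto simp: coregular_def basis_0 coord_basis)
  then have G1: "rep_eval (\<lambda>c. c) coregular G \<noteq> 0" unfolding ev by simp
  note pr = point_prime[OF scalar_hom_id regular_rep[OF d(2)]]
  note pc = point_prime[OF scalar_hom_id coregular_rep[OF d(2)]]
  have cls: "coord_class d h \<in> carrier ?R" if "h \<in> carrier ?M" for h
    using ring_hom_closed[OF coord_class_hom that] .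
  have "\<exists>P. primeideal P ?R \<and> coord_class d F \<notin> P \<and> coord_class d G \<notin> P"
  proof (rule irreducible_component_basic_open_meet[OF R.is_cring _ pr(1) pc(1)
        regular_coregular_connected[OF d(2)] cls[OF FG(1)] cls[OF FG(2)]])
    show "irreducible_space (subtopology (zariski_topology ?R) C)"
      if "C \<in> connected_components_of (zariski_topology ?R)" for C
      using irr that unfolding geometrically_irreducible_def Let_def by blast
    show "coord_class d F \<notin> point_prime (\<lambda>c. c) d regular" using pr(2)[OF FG(1)] F1 by simp
    show "coord_class d G \<notin> point_prime (\<lambda>c. c) d coregular" using pc(2)[OF FG(2)] G1 by simp
  qed
  then obtain P where P: "primeideal P ?R" "coord_class d F \<notin> P" "coord_class d G \<notin> P" by blast
  have FGM: "F * G \<in> carrier ?M" by (rule mpoly_ring_closed(2)[OF FG])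
  have "coord_class d (F * G) = coord_class d F \<otimes>\<^bsub>?R\<^esub> coord_class d G"
    using ring_hom_mult[OF coord_class_hom FG] by simp
  then have "coord_class d (F * G) \<notin> P"
    using primeideal.I_prime[OF P(1) cls[OF FG(1)] cls[OF FG(2)]] P(2,3) by auto
  from rational_point_outside_zero_set[OF coord_algebra_axioms P(1) FGM this] obtain \<rho> where
    \<rho>: "matrix_rep (\<lambda>c. c) A d \<rho>" "rep_eval (\<lambda>c. c) \<rho> (F * G) \<noteq> 0" by blast
  then have "rep_eval (\<lambda>c. c) \<rho> F \<noteq> 0" "rep_eval (\<lambda>c. c) \<rho> G \<noteq> 0"
    by (auto simp: scalar_hom.mpoly_eval_mult[OF scalar_hom_id])
  then show ?thesis using that \<rho>(1) unfolding ev by blast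
qed

text \<open>
  Write \<open>I\<^sub>e\<close> for the span of \<open>basis e, basis (e+1), \<dots>\<close>, that is the set of all \<open>y\<close> with
  \<open>\<kappa> y i = 0\<close> for \<open>i < e\<close>. The conclusion says that the socle of \<open>A/I\<^sub>d\<close> is spanned by
  \<open>basis (d-1)\<close>.

  By downward induction this may be assumed for all larger indices. Take a module \<open>M\<close> of dimension
  \<open>d\<close> that is both cyclic and cocyclic, and write it as \<open>A/L\<close>. The left ideal \<open>L\<close> then contains
  successively all \<open>basis e\<close> with \<open>e \<ge> d\<close>: an element of \<open>L\<close> outside of \<open>I\<^bsub>e+1\<^esub>\<close> exists for dimension
  reasons, and multiplying it into the socle of \<open>A/I\<^bsub>e+1\<^esub>\<close> yields \<open>basis e\<close> up to a scalar. So \<open>L = I\<^sub>d\<close> and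
  \<open>M = A/I\<^sub>d\<close>, and a cocyclic module has a simple socle.
\<close>

lemma simple_socle_of_quotients:
  fixes A :: "('k::alg_closed_field, 'a) module" (structure)
  assumes "triangular_algebra A D \<kappa>" and irr: "geometrically_irreducible A"
    and d: "0 < d" "d \<le> D" and y: "y \<in> carrier A"
    and Jy: "\<And>k i. 0 < k \<Longrightarrow> k < D \<Longrightarrow> i < d \<Longrightarrow> \<kappa> (coord_algebra.basis A D \<kappa> k \<otimes> y) i = 0"
    and i: "i < d - 1"
  shows "\<kappa> y i = 0"
  using d y Jy i
proof (induction "D - d" arbitrary: d y i rule: less_induct)
  case less
  interpret triangular_algebra A D \<kappa> by fact
  have socle: "\<kappa> z i = 0"
    if "d < e" "e \<le> D" "z \<in> carrier A" "\<And>k i. 0 < k \<Longrightarrow> k < D \<Longrightarrow> i < e \<Longrightarrow> \<kappa> (basis k \<otimes> z) i = 0" "i < e - 1"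
    for e z i
    by (rule less.hyps[of e z i]) (use that less.prems(1,2) in auto)
  obtain \<rho> where \<rho>: "matrix_rep (\<lambda>c. c) A d \<rho>"
    and F: "det (mat d d (\<lambda>(i, j). \<rho> (basis j) i 0)) \<noteq> 0"
    and G: "det (mat d d (\<lambda>(j, i). \<rho> (basis j) 0 i)) \<noteq> 0"
    by (rule cyclic_cocyclic_rep[OF triangular_algebra_axioms less.prems(1,2) irr])
  \<comment> \<open>The projection \<open>A \<rightarrow> M\<close> that sends \<open>a\<close> to \<open>a\<close> applied to the first basis vector; \<open>L\<close> is its kernel.\<close>
  define \<tau> where "\<tau> a i = \<rho> a i 0" for a i
  have \<rho>': "\<And>a b i j. a \<in> carrier A \<Longrightarrow> b \<in> carrier A \<Longrightarrow> i < d \<Longrightarrow> j < d \<Longrightarrow> \<rho> (a \<oplus> b) i j = \<rho> a i j + \<rho> b i j"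
    "\<And>c a i j. a \<in> carrier A \<Longrightarrow> i < d \<Longrightarrow> j < d \<Longrightarrow> \<rho> (c \<odot> a) i j = c * \<rho> a i j"
    "\<And>a b i j. a \<in> carrier A \<Longrightarrow> b \<in> carrier A \<Longrightarrow> i < d \<Longrightarrow> j < d \<Longrightarrow> \<rho> (a \<otimes> b) i j = (\<Sum>k<d. \<rho> a i k * \<rho> b k j)"
    using \<rho> unfolding matrix_rep_def by blast+
  have \<tau>_add: "\<tau> (a \<oplus> b) i = \<tau> a i + \<tau> b i" if "a \<in> carrier A" "b \<in> carrier A" "i < d" for a b i
    using \<rho>'(1)[OF that less.prems(1)] by (simp add: \<tau>_def)
  have \<tau>_smult: "\<tau> (c \<odot> a) i = c * \<tau> a i" if "a \<in> carrier A" "i < d" for a c i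
    using \<rho>'(2)[OF that less.prems(1)] by (simp add: \<tau>_def)
  have \<tau>_mult: "\<tau> (a \<otimes> b) i = (\<Sum>k<d. \<rho> a i k * \<tau> b k)" if "a \<in> carrier A" "b \<in> carrier A" "i < d" for a b i
    using \<rho>'(3)[OF that less.prems(1)] by (simp add: \<tau>_def)
  have \<tau>_expand: "\<tau> a i = (\<Sum>k<D. \<kappa> a k * \<tau> (basis k) i)" if "a \<in> carrier A" "i < d" for a i
    by (rule linear_expand[OF that(1) scalar_hom_id]) (use that in \<open>simp_all add: \<tau>_add \<tau>_smult\<close>)
  have inj: "c l = 0" if 0: "\<And>i. i < d \<Longrightarrow> (\<Sum>j<d. c j * \<tau> (basis j) i) = 0" and l: "l < d" for c l
  proof (rule det_nonzero_injective[OF mat_carrier F _ l])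
    fix i assume i: "i < d"
    have "(\<Sum>j<d. mat d d (\<lambda>(i, j). \<rho> (basis j) i 0) $$ (i, j) * c j) = (\<Sum>j<d. c j * \<tau> (basis j) i)"
      using i by (intro sum.cong) (auto simp: \<tau>_def mult.commute)
    then show "(\<Sum>j<d. mat d d (\<lambda>(i, j). \<rho> (basis j) i 0) $$ (i, j) * c j) = 0" using 0[OF i] by simp
  qed
  have surj: "\<exists>c. \<forall>i<d. (\<Sum>j<d. c j * \<tau> (basis j) i) = v i" for v
  proof -
    obtain c where c: "\<forall>i<d. (\<Sum>j<d. mat d d (\<lambda>(i, j). \<rho> (basis j) i 0) $$ (i, j) * c j) = v i"
      using det_nonzero_solvable[OF mat_carrier F, of v] by blast
    have "(\<Sum>j<d. mat d d (\<lambda>(i, j). \<rho> (basis j) i 0) $$ (i, j) * c j) = (\<Sum>j<d. c j * \<tau> (basis j) i)" if "i < d" for i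
      using that by (intro sum.cong) (auto simp: \<tau>_def mult.commute)
    then show ?thesis using c by (intro exI[of _ c]) auto
  qed
  have L_mult: "\<tau> (a \<otimes> b) i = 0" if "a \<in> carrier A" "b \<in> carrier A" "\<And>i. i < d \<Longrightarrow> \<tau> b i = 0" "i < d" for a b i
    using that by (simp add: \<tau>_mult)
  have below: "\<kappa> (basis k \<otimes> z) i = 0"
    if "0 < k" "k < D" "z \<in> carrier A" "\<And>i. i < n \<Longrightarrow> \<kappa> z i = 0" "i \<le> n" "i < D" for k z n i
  proof -
    have "\<kappa> (basis k \<otimes> z) i = (\<Sum>j<D. \<kappa> z j * \<kappa> (basis k \<otimes> basis j) i)"
      by (rule coord_mult_expand_r) (use that in auto)
    also have "\<dots> = (\<Sum>j<D. 0)"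
    proof (rule sum.cong)
      fix j assume "j \<in> {..<D}"
      then show "\<kappa> z j * \<kappa> (basis k \<otimes> basis j) i = 0"
        using that triangular_l[of k j i] by (cases "j < n") auto
    qed simp
    finally show ?thesis by simp
  qed
  have L: "\<tau> (basis e) i = 0" if "d \<le> e" "e < D" "i < d" for e i
    using that
  proof (induction "D - e" arbitrary: e i rule: less_induct)
    case (less e i0)
    have IH: "\<tau> (basis e') i = 0" if "e < e'" "e' < D" "i < d" for e' i
      by (rule less.hyps[of e' i]) (use that less.prems in auto)
    \<comment> \<open>Move an element of \<open>L\<close> outside of \<open>I\<^bsub>e+1\<^esub>\<close> into the socle modulo \<open>I\<^bsub>e+1\<^esub>\<close>.\<close>
    have step: "\<forall>i<d. \<tau> (basis e) i = 0"
      if "z \<in> carrier A" "\<And>i. i < d \<Longrightarrow> \<tau> z i = 0" "\<And>i. i < n \<Longrightarrow> \<kappa> z i = 0" "j \<le> e" "\<kappa> z j \<noteq> 0" for z n j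
      using that
    proof (induction "Suc e - n" arbitrary: z n j rule: less_induct)
      case (less n z j)
      show ?case
      proof (cases "\<forall>k i. 0 < k \<longrightarrow> k < D \<longrightarrow> i < Suc e \<longrightarrow> \<kappa> (basis k \<otimes> z) i = 0")
        case True
        have z0: "\<kappa> z i = 0" if "i < e" for i
          by (rule socle[of "Suc e"]) (use True that \<open>d \<le> e\<close> \<open>e < D\<close> less.prems(1) in auto)
        then have ze: "\<kappa> z e \<noteq> 0" using less.prems(4,5) by (cases "j = e") auto
        show ?thesis
        proof (intro allI impI)
          fix i assume i: "i < d"
          have "0 = (\<Sum>k<D. \<kappa> z k * \<tau> (basis k) i)"
            using \<tau>_expand[OF less.prems(1) i] less.prems(2)[OF i] by simp
          also have "\<dots> = (\<Sum>k<D. if k = e then \<kappa> z e * \<tau> (basis e) i else 0)"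
          proof (rule sum.cong)
            fix k assume k: "k \<in> {..<D}"
            show "\<kappa> z k * \<tau> (basis k) i = (if k = e then \<kappa> z e * \<tau> (basis e) i else 0)"
              using z0[of k] IH[of k i] i k by (cases k e rule: linorder_cases) auto
          qed simp
          finally show "\<tau> (basis e) i = 0" using ze \<open>e < D\<close> by simp
        qed
      next
        case False
        then obtain k i where k: "0 < k" "k < D" "i < Suc e" "\<kappa> (basis k \<otimes> z) i \<noteq> 0" by blast
        have n: "n \<le> j" using less.prems(3)[of j] less.prems(5) by (meson not_le)
        show ?thesis
        proof (rule less.hyps[of "Suc n" "basis k \<otimes> z" i])
          show "Suc e - Suc n < Suc e - n" using n less.prems(4) by simp
          show "\<tau> (basis k \<otimes> z) i = 0" if "i < d" for i
            by (rule L_mult[OF basis_closed less.prems(1,2) that])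
          show "\<kappa> (basis k \<otimes> z) i = 0" if "i < Suc n" for i
            by (rule below[OF k(1,2) less.prems(1,3)]) (use that n less.prems(4) \<open>e < D\<close> in auto)
        qed (use k less.prems(1) in auto)
      qed
    qed
    obtain c where c: "\<forall>i<d. (\<Sum>j<d. c j * \<tau> (basis j) i) = \<tau> (basis e) i" using surj by blast
    obtain z where z: "z \<in> carrier A" "\<forall>i<D. \<kappa> z i = (if i < d then - c i else if i = e then 1 else 0)"
      using coord_surj[of "\<lambda>i. if i < d then - c i else if i = e then 1 else 0"] by blast
    have "\<tau> z i = 0" if i: "i < d" for i
    proof -
      have "\<tau> z i = (\<Sum>k<D. \<kappa> z k * \<tau> (basis k) i)" by (rule \<tau>_expand[OF z(1) i])
      also have "\<dots> = (\<Sum>k<D. (if k < d then - c k * \<tau> (basis k) i else 0) + (if k = e then \<tau> (basis e) i else 0))"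
        using z(2) less.prems(1) by (intro sum.cong) auto
      also have "\<dots> = (\<Sum>k<D. if k < d then - c k * \<tau> (basis k) i else 0) + \<tau> (basis e) i"
        using less.prems(2) by (simp add: sum.distrib)
      also have "(\<Sum>k<D. if k < d then - c k * \<tau> (basis k) i else 0) = (\<Sum>k<d. - c k * \<tau> (basis k) i)"
        using \<open>d \<le> D\<close> by (intro sum.mono_neutral_cong_right) auto
      also have "\<dots> = - \<tau> (basis e) i" using c i by (simp add: sum_negf)
      finally show ?thesis by simp
    qed
    from step[OF z(1) this, of 0 e] show ?case using z(2) less.prems by simp
  qed
  have \<tau>_low: "\<tau> a i = (\<Sum>k<d. \<kappa> a k * \<tau> (basis k) i)" if "a \<in> carrier A" "i < d" for a i
    unfolding \<tau>_expand[OF that] by (rule sum.mono_neutral_right) (use L that less.prems(2) in auto)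
  \<comment> \<open>The socle of \<open>M\<close> is one-dimensional, because the first coordinate does not vanish on it.\<close>
  have cocyc: "\<tau> u i = 0"
    if u: "u \<in> carrier A" "\<And>k i. 0 < k \<Longrightarrow> k < D \<Longrightarrow> i < d \<Longrightarrow> \<kappa> (basis k \<otimes> u) i = 0" "\<tau> u 0 = 0" and i: "i < d" for u i
  proof (rule det_nonzero_injective[OF mat_carrier G _ i])
    fix j assume j: "j < d"
    have "(\<Sum>i<d. mat d d (\<lambda>(j, i). \<rho> (basis j) 0 i) $$ (j, i) * \<tau> u i) = \<tau> (basis j \<otimes> u) 0"
      using j u(1) less.prems(1) by (simp add: \<tau>_mult)
    also have "\<dots> = 0"
    proof (cases "j = 0")
      case True
      then show ?thesis using u(1,3) by (simp add: basis_0)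
    next
      case False
      then show ?thesis using j u(1) less.prems(1,2) by (subst \<tau>_low) (auto simp: u(2))
    qed
    finally show "(\<Sum>i<d. mat d d (\<lambda>(j, i). \<rho> (basis j) 0 i) $$ (j, i) * \<tau> u i) = 0" .
  qed
  let ?b = "basis (d - 1)"
  have bd: "d - 1 < D" using less.prems(1,2) by simp
  have b_soc: "\<kappa> (basis k \<otimes> ?b) i = 0" if "0 < k" "k < D" "i < d" for k i
    using triangular_l[OF that(1,2) bd, of i] that(3) by simp
  have "\<tau> ?b 0 \<noteq> 0"
  proof
    assume 0: "\<tau> ?b 0 = 0"
    have "(if d - 1 = d - 1 then 1 else 0) = (0 :: 'k)"
    proof (rule inj[of "\<lambda>j. if j = d - 1 then 1 else 0" "d - 1"])
      fix i assume "i < d"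
      have "(\<Sum>j<d. (if j = d - 1 then 1 else 0) * \<tau> (basis j) i) = (\<Sum>j<d. if j = d - 1 then \<tau> ?b i else 0)"
        by (intro sum.cong) auto
      also have "\<dots> = \<tau> ?b i" using less.prems(1) by simp
      also have "\<dots> = 0" by (rule cocyc[OF basis_closed b_soc 0 \<open>i < d\<close>])
      finally show "(\<Sum>j<d. (if j = d - 1 then 1 else 0) * \<tau> (basis j) i) = 0" .
    qed (use less.prems(1) in simp)
    then show False by simp
  qed
  define u where "u = y \<oplus> (- (\<tau> y 0 / \<tau> ?b 0)) \<odot> ?b"
  have u: "u \<in> carrier A" using less.prems(3) by (simp add: u_def smult_closed)
  have "\<tau> u j = 0" if "j < d" for j
  proof (rule cocyc[OF u _ _ that])
    show "\<tau> u 0 = 0"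
      using less.prems(1,3) \<open>\<tau> ?b 0 \<noteq> 0\<close> by (simp add: u_def \<tau>_add \<tau>_smult smult_closed)
    show "\<kappa> (basis k \<otimes> u) i = 0" if "0 < k" "k < D" "i < d" for k i
      using that less.prems(2,3) less.prems(4)[OF that] b_soc[OF that]
      by (simp add: u_def r_distr smult_closed smult_r coord_add coord_smult)
  qed
  then have "(\<Sum>k<d. \<kappa> u k * \<tau> (basis k) j) = 0" if "j < d" for j using \<tau>_low[OF u that] that by simp
  from inj[OF this] have "\<kappa> u i = 0" using less.prems(5) by simp
  then show "\<kappa> y i = 0"
    using less.prems bd by (simp add: u_def coord_add coord_smult smult_closed coord_basis)
qed

text \<open>
  The last hypothesis puts \<open>basis 1\<close> into the socle of \<open>A/I\<^sub>3\<close>, which for a geometrically irreducible \<open>A\<close>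
  is spanned by \<open>basis 2\<close>.
\<close>

lemma triangular_algebra_not_geometrically_irreducible:
  fixes A :: "('k::alg_closed_field, 'a) module" (structure)
  assumes "triangular_algebra A D \<kappa>" and D: "3 \<le> D"
    and sq: "\<And>k i. 0 < k \<Longrightarrow> k < D \<Longrightarrow> i < 3 \<Longrightarrow>
      \<kappa> (coord_algebra.basis A D \<kappa> k \<otimes> coord_algebra.basis A D \<kappa> 1) i = 0"
  shows "\<not> geometrically_irreducible A"
proof
  assume irr: "geometrically_irreducible A"
  interpret triangular_algebra A D \<kappa> by fact
  have "\<kappa> (basis 1) 1 = 0"
    by (rule simple_socle_of_quotients[OF triangular_algebra_axioms irr, of 3]) (use D sq in auto)
  then show False using D by (simp add: coord_basis)
qed

section \<open>Quotient algebras and coordinates\<close>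

locale k_algebra = ring B for B :: "('k::field, 'b) module" (structure) +
  assumes smult_closed: "x \<in> carrier B \<Longrightarrow> c \<odot> x \<in> carrier B"
    and smult_add: "x \<in> carrier B \<Longrightarrow> y \<in> carrier B \<Longrightarrow> c \<odot> (x \<oplus> y) = c \<odot> x \<oplus> c \<odot> y"
    and smult_l: "x \<in> carrier B \<Longrightarrow> y \<in> carrier B \<Longrightarrow> (c \<odot> x) \<otimes> y = c \<odot> (x \<otimes> y)"
    and smult_r: "x \<in> carrier B \<Longrightarrow> y \<in> carrier B \<Longrightarrow> x \<otimes> (c \<odot> y) = c \<odot> (x \<otimes> y)"

lemma ring_extend_simps [simp]:
  "carrier (ring.extend R (module.fields f)) = carrier R"
  "x \<otimes>\<^bsub>ring.extend R (module.fields f)\<^esub> y = x \<otimes>\<^bsub>R\<^esub> y"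
  "x \<oplus>\<^bsub>ring.extend R (module.fields f)\<^esub> y = x \<oplus>\<^bsub>R\<^esub> y"
  "\<one>\<^bsub>ring.extend R (module.fields f)\<^esub> = \<one>\<^bsub>R\<^esub>"
  "\<zero>\<^bsub>ring.extend R (module.fields f)\<^esub> = \<zero>\<^bsub>R\<^esub>"
  "c \<odot>\<^bsub>ring.extend R (module.fields f)\<^esub> x = f c x"
  by (simp_all add: ring.extend_def module.fields_def)

lemma ring_extend:
  fixes R :: "'a ring" and f :: "'k \<Rightarrow> 'a \<Rightarrow> 'a"
  assumes "ring R"
  shows "ring (ring.extend R (module.fields f))"
proof -
  interpret ring R by fact
  show ?thesis
  proof (rule ringI)
    show "abelian_group (ring.extend R (module.fields f))"
      by (rule abelian_groupI) (auto simp: a_ac intro: a_inv_closed l_neg)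
    show "monoid (ring.extend R (module.fields f))"
      by (rule monoidI) (auto simp: m_assoc)
  qed (auto simp: l_distr r_distr)
qed

context k_algebra
begin

context
  fixes I
  assumes I: "ideal I B"
begin

interpretation I: ideal I B by (rule I)

abbreviation quot where "quot \<equiv> quotient_algebra B I"

lemma smult_ideal:
  assumes "h \<in> I"
  shows "c \<odot> h \<in> I"
proof -
  have h: "h \<in> carrier B" using I.a_subset assms by blast
  have "c \<odot> h = (c \<odot> \<one>) \<otimes> h" using smult_l[OF one_closed h] h by simp
  then show ?thesis using I.I_l_closed[OF assms smult_closed[OF one_closed]] by simp
qed

lemma quot_carrier: "carrier quot = {I +> f | f. f \<in> carrier B}"
  unfolding quotient_algebra_def FactRing_def A_RCOSETS_def' by auto

lemma quot_closed: "f \<in> carrier B \<Longrightarrow> I +> f \<in> carrier quot"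
  unfolding quot_carrier by blast

lemma quot_simps:
  assumes "f \<in> carrier B" "g \<in> carrier B"
  shows "(I +> f) \<oplus>\<^bsub>quot\<^esub> (I +> g) = I +> (f \<oplus> g)" "(I +> f) \<otimes>\<^bsub>quot\<^esub> (I +> g) = I +> (f \<otimes> g)"
    "\<one>\<^bsub>quot\<^esub> = I +> \<one>"
  using ring_hom_add[OF I.rcos_ring_hom assms] ring_hom_mult[OF I.rcos_ring_hom assms]
    ring_hom_one[OF I.rcos_ring_hom] by (simp_all add: quotient_algebra_def)

lemma quot_eq_iff:
  assumes "f \<in> carrier B" "g \<in> carrier B"
  shows "I +> f = I +> g \<longleftrightarrow> f \<ominus> g \<in> I"
  using quotient_eq_iff_same_a_r_cos[OF I assms] by blast

lemma quot_smult:
  assumes f: "f \<in> carrier B"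
  shows "c \<odot>\<^bsub>quot\<^esub> (I +> f) = I +> (c \<odot> f)"
proof -
  have const: "I +> (c \<odot> x) = I +> (c \<odot> f)" if "x \<in> I +> f" for x
  proof -
    have "x \<in> (\<Union>h\<in>I. {h \<oplus> f})" using that by (simp only: a_r_coset_def')
    then obtain h where h: "h \<in> I" "x = h \<oplus> f" by (elim UN_E singletonE)
    have hB: "h \<in> carrier B" by (rule subsetD[OF I.a_subset h(1)])
    have "c \<odot> x \<in> (\<Union>k\<in>I. {k \<oplus> c \<odot> f})"
      unfolding h(2) smult_add[OF hB f] by (intro UN_I[OF smult_ideal[OF h(1), of c]] singletonI)
    then have "c \<odot> x \<in> I +> (c \<odot> f)" by (simp only: a_r_coset_def')
    from I.a_repr_independence'[OF this smult_closed[OF f]] show ?thesis ..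
  qed
  have "I +> f \<noteq> {}" using I.a_rcos_self[OF f] by blast
  then have "(\<Union>x\<in>I +> f. I +> (c \<odot> x)) = I +> (c \<odot> f)" by (rule SUP_eq_const) (rule const)
  then show ?thesis by (simp add: quotient_algebra_def)
qed

lemma k_algebra_quot: "k_algebra quot"
proof -
  have "ring quot" unfolding quotient_algebra_def by (rule ring_extend[OF I.quotient_is_ring])
  then interpret Q: ring quot .
  have rep: "\<exists>f. f \<in> carrier B \<and> C = I +> f" if "C \<in> carrier quot" for C
    using that unfolding quot_carrier by blast
  show ?thesis
  proof
    fix c C assume "C \<in> carrier quot"
    then obtain f where f: "f \<in> carrier B" "C = I +> f" using rep by blast
    show "c \<odot>\<^bsub>quot\<^esub> C \<in> carrier quot"
      unfolding f(2) quot_smult[OF f(1)] by (rule quot_closed[OF smult_closed[OF f(1)]])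
    fix E assume "E \<in> carrier quot"
    then obtain g where g: "g \<in> carrier B" "E = I +> g" using rep by blast
    note fg = f(1) g(1) smult_closed[OF f(1)] smult_closed[OF g(1)]
    show "c \<odot>\<^bsub>quot\<^esub> (C \<oplus>\<^bsub>quot\<^esub> E) = c \<odot>\<^bsub>quot\<^esub> C \<oplus>\<^bsub>quot\<^esub> c \<odot>\<^bsub>quot\<^esub> E"
      unfolding f(2) g(2) using fg by (simp only: quot_smult quot_simps smult_add a_closed)
    show "(c \<odot>\<^bsub>quot\<^esub> C) \<otimes>\<^bsub>quot\<^esub> E = c \<odot>\<^bsub>quot\<^esub> (C \<otimes>\<^bsub>quot\<^esub> E)"
      unfolding f(2) g(2) using fg by (simp only: quot_smult quot_simps smult_l m_closed)
    show "C \<otimes>\<^bsub>quot\<^esub> (c \<odot>\<^bsub>quot\<^esub> E) = c \<odot>\<^bsub>quot\<^esub> (C \<otimes>\<^bsub>quot\<^esub> E)"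
      unfolding f(2) g(2) using fg by (simp only: quot_smult quot_simps smult_r m_closed)
  qed
qed

text \<open>
  Linear functionals that cut out the ideal descend to the quotient and are coordinates there, so bases
  need to be chosen only upstairs.
\<close>

lemma quotient_coordinates:
  fixes \<phi> :: "'b \<Rightarrow> nat \<Rightarrow> 'k"
  assumes add: "\<And>f g i. f \<in> carrier B \<Longrightarrow> g \<in> carrier B \<Longrightarrow> i < D \<Longrightarrow> \<phi> (f \<oplus> g) i = \<phi> f i + \<phi> g i"
    and smult: "\<And>c f i. f \<in> carrier B \<Longrightarrow> i < D \<Longrightarrow> \<phi> (c \<odot> f) i = c * \<phi> f i"
    and ker: "\<And>f. f \<in> carrier B \<Longrightarrow> f \<in> I \<longleftrightarrow> (\<forall>i<D. \<phi> f i = 0)"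
    and surj: "\<And>v. \<exists>f\<in>carrier B. \<forall>i<D. \<phi> f i = v i"
  obtains \<kappa> where "coord_algebra quot D \<kappa>" "\<And>f i. f \<in> carrier B \<Longrightarrow> i < D \<Longrightarrow> \<kappa> (I +> f) i = \<phi> f i"
proof -
  define \<kappa> where "\<kappa> C = \<phi> (SOME f. f \<in> carrier B \<and> C = I +> f)" for C
  have diff: "\<phi> f i = \<phi> (f \<ominus> g) i + \<phi> g i" if "f \<in> carrier B" "g \<in> carrier B" "i < D" for f g i
  proof -
    have "f = (f \<ominus> g) \<oplus> g" using that by (simp add: a_minus_def a_assoc l_neg)
    then show ?thesis using add[of "f \<ominus> g" g i] that by simp
  qed
  have \<kappa>: "\<kappa> (I +> f) i = \<phi> f i" if f: "f \<in> carrier B" and i: "i < D" for f i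
  proof -
    define g where "g = (SOME g. g \<in> carrier B \<and> I +> f = I +> g)"
    have g: "g \<in> carrier B \<and> I +> f = I +> g" unfolding g_def by (rule someI[of _ f]) (use f in simp)
    then have "f \<ominus> g \<in> I" using quot_eq_iff[OF f] by blast
    then have "\<phi> (f \<ominus> g) i = 0" using ker[of "f \<ominus> g"] f g i by simp
    then have "\<phi> f i = \<phi> g i" using diff[OF f _ i, of g] g by simp
    moreover have "\<kappa> (I +> f) = \<phi> g" unfolding \<kappa>_def g_def ..
    ultimately show ?thesis by simp
  qed
  interpret Q: k_algebra quot by (rule k_algebra_quot)
  have "coord_algebra quot D \<kappa>"
  proof
    show "a = b" if ab: "a \<in> carrier quot" "b \<in> carrier quot" "\<And>i. i < D \<Longrightarrow> \<kappa> a i = \<kappa> b i" for a b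
    proof -
      obtain f g where f: "f \<in> carrier B" "a = I +> f" and g: "g \<in> carrier B" "b = I +> g"
        using ab(1,2) unfolding quot_carrier by blast
      have "\<phi> (f \<ominus> g) i = 0" if "i < D" for i
        using diff[OF f(1) g(1) that] ab(3)[OF that] f g \<kappa> that by simp
      then show ?thesis using ker[of "f \<ominus> g"] f g quot_eq_iff by simp
    qed
    show "\<exists>a\<in>carrier quot. \<forall>i<D. \<kappa> a i = v i" for v
    proof -
      obtain f where f: "f \<in> carrier B" "\<forall>i<D. \<phi> f i = v i" using surj[of v] by blast
      then show ?thesis using quot_closed[OF f(1)] \<kappa>[OF f(1)] by (intro bexI[of _ "I +> f"]) auto
    qed
    fix C c i assume "C \<in> carrier quot" and i: "i < D"
    then obtain f where f: "f \<in> carrier B" "C = I +> f" unfolding quot_carrier by blast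
    show "\<kappa> (c \<odot>\<^bsub>quot\<^esub> C) i = c * \<kappa> C i"
      unfolding f(2) quot_smult[OF f(1)] using f(1) i by (simp add: \<kappa> smult_closed smult)
    fix E assume "E \<in> carrier quot"
    then obtain g where g: "g \<in> carrier B" "E = I +> g" unfolding quot_carrier by blast
    show "\<kappa> (C \<oplus>\<^bsub>quot\<^esub> E) i = \<kappa> C i + \<kappa> E i"
      unfolding f(2) g(2) quot_simps(1)[OF f(1) g(1)] using f(1) g(1) i by (simp add: \<kappa> add)
  qed (simp_all add: Q.smult_closed Q.smult_l Q.smult_r)
  then show ?thesis using \<kappa> that by blast
qed

end

end

text \<open>Both algebras have the same structure constants.\<close>

lemma truncated_algebras_isomorphic:
  assumes "truncated_algebra A D \<kappa>" "truncated_algebra B D \<mu>"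
  shows "algebra_isomorphic A B"
proof -
  interpret A: truncated_algebra A D \<kappa> by fact
  interpret B: truncated_algebra B D \<mu> by fact
  define h where "h a = (SOME b. b \<in> carrier B \<and> (\<forall>i<D. \<mu> b i = \<kappa> a i))" for a
  have h: "h a \<in> carrier B" "i < D \<Longrightarrow> \<mu> (h a) i = \<kappa> a i" for a i
  proof -
    have "\<exists>b. b \<in> carrier B \<and> (\<forall>i<D. \<mu> b i = \<kappa> a i)" using B.coord_surj by blast
    from someI_ex[OF this] show "h a \<in> carrier B" "i < D \<Longrightarrow> \<mu> (h a) i = \<kappa> a i" by (auto simp: h_def)
  qed
  have "h \<in> Ring.ring_hom A B"
    by (rule ring_hom_memI; (intro B.coord_inj)?)
      (auto simp: h A.coord_mult B.coord_mult A.coord_add B.coord_add A.coord_one B.coord_one)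
  moreover have "bij_betw h (carrier A) (carrier B)"
  proof (rule bij_betw_imageI)
    show "inj_on h (carrier A)" by (rule inj_onI) (metis h(2) A.coord_inj)
    show "h ` carrier A = carrier B"
    proof (intro equalityI subsetI)
      fix b assume b: "b \<in> carrier B"
      obtain a where "a \<in> carrier A" "\<forall>i<D. \<kappa> a i = \<mu> b i" using A.coord_surj by blast
      then show "b \<in> h ` carrier A" using b h by (intro image_eqI[of _ _ a] B.coord_inj) auto
    qed (auto simp: h)
  qed
  moreover have "h (c \<odot>\<^bsub>A\<^esub> a) = c \<odot>\<^bsub>B\<^esub> h a" if "a \<in> carrier A" for c a
    using that by (intro B.coord_inj) (auto simp: h B.smult_closed A.coord_smult B.coord_smult)
  ultimately show ?thesis unfolding algebra_isomorphic_def ring_iso_def by blast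
qed

lemma algebra_isomorphic_truncated:
  assumes A: "k_algebra A" and B: "truncated_algebra B D \<mu>" and iso: "algebra_isomorphic A B"
  shows "\<exists>\<kappa>. truncated_algebra A D \<kappa>"
proof -
  interpret A: k_algebra A by (rule A)
  interpret B: truncated_algebra B D \<mu> by (rule B)
  obtain h where h: "h \<in> Ring.ring_hom A B" "bij_betw h (carrier A) (carrier B)"
    and hs: "\<And>c a. a \<in> carrier A \<Longrightarrow> h (c \<odot>\<^bsub>A\<^esub> a) = c \<odot>\<^bsub>B\<^esub> h a"
    using iso unfolding algebra_isomorphic_def ring_iso_def by blast
  note hh = ring_hom_closed[OF h(1)] ring_hom_add[OF h(1)] ring_hom_mult[OF h(1)] ring_hom_one[OF h(1)]
  have "truncated_algebra A D (\<lambda>a. \<mu> (h a))"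
  proof
    show "a = b" if ab: "a \<in> carrier A" "b \<in> carrier A" and eq: "\<And>i. i < D \<Longrightarrow> \<mu> (h a) i = \<mu> (h b) i" for a b
    proof -
      have "h a = h b" by (rule B.coord_inj[OF hh(1)[OF ab(1)] hh(1)[OF ab(2)] eq])
      then show ?thesis using bij_betw_imp_inj_on[OF h(2)] ab by (meson inj_onD)
    qed
    show "\<exists>a\<in>carrier A. \<forall>i<D. \<mu> (h a) i = v i" for v
    proof -
      obtain b where b: "b \<in> carrier B" "\<forall>i<D. \<mu> b i = v i" using B.coord_surj[of v] by blast
      then obtain a where "a \<in> carrier A" "h a = b" using h(2) by (metis bij_betw_imp_surj_on imageE)
      then show ?thesis using b(2) by blast
    qed
    show "0 < D" by (rule B.D_pos)
    show "\<mu> (h \<one>\<^bsub>A\<^esub>) i = (if i = 0 then 1 else 0)" if "i < D" for i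
      unfolding hh(4) by (rule B.coord_one[OF that])
    fix a c assume a: "a \<in> carrier A"
    show "c \<odot>\<^bsub>A\<^esub> a \<in> carrier A" by (rule A.smult_closed[OF a])
    show "\<mu> (h (c \<odot>\<^bsub>A\<^esub> a)) i = c * \<mu> (h a) i" if "i < D" for i
      unfolding hs[OF a] by (rule B.coord_smult[OF hh(1)[OF a] that])
    fix b assume b: "b \<in> carrier A"
    show "(c \<odot>\<^bsub>A\<^esub> a) \<otimes>\<^bsub>A\<^esub> b = c \<odot>\<^bsub>A\<^esub> (a \<otimes>\<^bsub>A\<^esub> b)" by (rule A.smult_l[OF a b])
    show "a \<otimes>\<^bsub>A\<^esub> (c \<odot>\<^bsub>A\<^esub> b) = c \<odot>\<^bsub>A\<^esub> (a \<otimes>\<^bsub>A\<^esub> b)" by (rule A.smult_r[OF a b])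
    show "\<mu> (h (a \<oplus>\<^bsub>A\<^esub> b)) i = \<mu> (h a) i + \<mu> (h b) i" if "i < D" for i
      unfolding hh(2)[OF a b] by (rule B.coord_add[OF hh(1)[OF a] hh(1)[OF b] that])
    show "\<mu> (h (a \<otimes>\<^bsub>A\<^esub> b)) i = (\<Sum>j\<le>i. \<mu> (h a) j * \<mu> (h b) (i - j))" if "i < D" for i
      unfolding hh(3)[OF a b] by (rule B.coord_mult[OF hh(1)[OF a] hh(1)[OF b] that])
  qed
  then show ?thesis by blast
qed

lemma poly_algebra_simps [simp]:
  "carrier poly_algebra = UNIV" "f \<oplus>\<^bsub>poly_algebra\<^esub> g = f + g" "f \<otimes>\<^bsub>poly_algebra\<^esub> g = f * g"
  "\<one>\<^bsub>poly_algebra\<^esub> = 1" "\<zero>\<^bsub>poly_algebra\<^esub> = 0" "c \<odot>\<^bsub>poly_algebra\<^esub> f = smult c f"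
  by (simp_all add: poly_algebra_def ring_of_type_algebra_def)

lemma truncated_poly_algebra:
  assumes "0 < m"
  shows "\<exists>\<kappa>. truncated_algebra (truncated_poly_algebra m :: ('k::field, 'k poly set) module) m \<kappa>"
proof -
  let ?B = "poly_algebra :: ('k, 'k poly) module"
  have R: "ring ?B" unfolding poly_algebra_def by (rule ring_extend) (rule ring_from_type_algebra)
  interpret B: k_algebra ?B
    using R by (simp add: k_algebra_def k_algebra_axioms_def smult_add_right)
  have C: "cring ?B"
    by (rule cring.intro[OF R]) (auto simp: comm_monoid_def comm_monoid_axioms_def B.monoid_axioms mult.commute)
  define I where "I = genideal ?B {Polynomial.monom 1 m}"
  have I: "ideal I ?B" unfolding I_def by (rule B.genideal_ideal) simp
  have "I = cgenideal ?B (Polynomial.monom 1 m)"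
    unfolding I_def by (rule cring.cgenideal_eq_genideal[OF C, symmetric]) simp
  then have "f \<in> I \<longleftrightarrow> Polynomial.monom 1 m dvd f" for f
    unfolding cgenideal_def by (auto simp: dvd_def mult.commute)
  then have ker: "f \<in> I \<longleftrightarrow> (\<forall>i<m. coeff f i = 0)" for f by (simp add: monom_1_dvd_iff')
  have surj: "\<exists>f\<in>carrier ?B. \<forall>i<m. coeff f i = v i" for v :: "nat \<Rightarrow> 'k"
  proof -
    have "coeff (\<Sum>j<m. Polynomial.monom (v j) j) i = v i" if "i < m" for i using that by (simp add: coeff_sum)
    then show ?thesis by auto
  qed
  obtain \<kappa> where Q: "coord_algebra (quotient_algebra ?B I) m \<kappa>"
    and \<kappa>: "\<And>f i. f \<in> carrier ?B \<Longrightarrow> i < m \<Longrightarrow> \<kappa> (I +>\<^bsub>?B\<^esub> f) i = coeff f i"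
  proof (rule B.quotient_coordinates[OF I, of m coeff])
    show "\<exists>f\<in>carrier ?B. \<forall>i<m. coeff f i = v i" for v by (rule surj)
  qed (auto simp: ker)
  interpret Q: coord_algebra "quotient_algebra ?B I" m \<kappa> by (rule Q)
  have "truncated_algebra (quotient_algebra ?B I) m \<kappa>"
    by unfold_locales
      (auto simp: assms B.quot_carrier[OF I] B.quot_simps[OF I] \<kappa> coeff_mult)
  then show ?thesis unfolding truncated_poly_algebra_def I_def by blast
qed

section \<open>Path algebras of quivers with one vertex\<close>

text \<open>
  Going through the vectors \<open>w 0, w 1, \<dots>\<close> from the end, keep those that do not lie in the span of \<open>U\<close>
  and the later ones. What is kept is a basis modulo \<open>U\<close>, and it is compatible with the filtration by the
  spans \<open>S i\<close>: on \<open>S i\<close> the coordinates that belong to earlier vectors vanish.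
\<close>

lemma (in vector_space) echelon_coordinates:
  fixes w :: "nat \<Rightarrow> 'b" and U N
  defines "S \<equiv> \<lambda>i. span (U \<union> w ` {i..<N})"
  assumes U: "subspace U"
    and xs: "sorted_wrt (<) xs" "set xs = {i. i < N \<and> w i \<notin> S (Suc i)}"
  obtains \<phi> :: "'b \<Rightarrow> nat \<Rightarrow> 'a" where
    "\<And>x y l. x \<in> S 0 \<Longrightarrow> y \<in> S 0 \<Longrightarrow> \<phi> (x + y) l = \<phi> x l + \<phi> y l"
    "\<And>c x l. x \<in> S 0 \<Longrightarrow> \<phi> (scale c x) l = c * \<phi> x l"
    "\<And>x. x \<in> S 0 \<Longrightarrow> x \<in> U \<longleftrightarrow> (\<forall>l<length xs. \<phi> x l = 0)"
    "\<And>k l. k < length xs \<Longrightarrow> l < length xs \<Longrightarrow> \<phi> (w (xs ! k)) l = (if l = k then 1 else 0)"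
    "\<And>x i l. x \<in> S i \<Longrightarrow> l < length xs \<Longrightarrow> xs ! l < i \<Longrightarrow> \<phi> x l = 0"
proof -
  obtain B0 where B0: "B0 \<subseteq> U" "independent B0" "U \<subseteq> span B0"
    using maximal_independent_subset by blast
  have spanB0: "span B0 = U" using B0 U by (simp add: span_subspace)
  have S_mono: "S j \<subseteq> S i" if "i \<le> j" for i j
    unfolding S_def using that by (intro span_mono) auto
  have insert_span: "span (insert a (span Y)) = span (insert a Y)" for a Y
    by (simp add: span_insert span_span)
  define B where "B i = B0 \<union> w ` {j \<in> set xs. i \<le> j}" for i
  have B: "independent (B i) \<and> span (B i) = S i" if "i \<le> N" for i
    using that
  proof (induction i rule: inc_induct)
    case base
    have "B N = B0" unfolding B_def xs(2) by auto
    moreover have "S N = U" unfolding S_def using U by (simp add: span_eq_iff)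
    ultimately show ?case using B0 spanB0 by simp
  next
    case (step i)
    have ins: "{i..<N} = insert i {Suc i..<N}" using step by auto
    have Si: "S i = span (insert (w i) (S (Suc i)))"
    proof -
      have "S i = span (insert (w i) (U \<union> w ` {Suc i..<N}))" unfolding S_def ins by simp
      also have "\<dots> = span (insert (w i) (S (Suc i)))"
        unfolding S_def by (simp add: insert_span)
      finally show ?thesis .
    qed
    show ?case
    proof (cases "i \<in> set xs")
      case True
      then have "{j \<in> set xs. i \<le> j} = insert i {j \<in> set xs. Suc i \<le> j}" by (auto simp: Suc_le_eq le_less)
      then have Bi: "B i = insert (w i) (B (Suc i))" unfolding B_def by simp
      have "w i \<notin> span (B (Suc i))" using True step.IH unfolding xs(2) by simp
      then have "independent (B i)" unfolding Bi using step.IH by (intro independent_insertI) auto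
      moreover have "span (B i) = S i" unfolding Bi Si using step.IH insert_span[of "w i" "B (Suc i)"] by simp
      ultimately show ?thesis by simp
    next
      case False
      then have "{j \<in> set xs. i \<le> j} = {j \<in> set xs. Suc i \<le> j}"
        by (metis (no_types, lifting) Suc_leD Suc_leI le_neq_implies_less)
      then have "B i = B (Suc i)" unfolding B_def by simp
      moreover have "w i \<in> S (Suc i)" using False step.hyps unfolding xs(2) by simp
      then have "S i = S (Suc i)" unfolding Si by (simp add: insert_absorb) (simp add: S_def)
      ultimately show ?thesis using step.IH by simp
    qed
  qed
  have pick: "w (xs ! l) \<notin> S i" if "l < length xs" "xs ! l < i" for l i
    using that nth_mem[OF that(1)] S_mono[of "Suc (xs ! l)" i] unfolding xs(2) by auto
  have pickN: "xs ! l < N" if "l < length xs" for l using nth_mem[OF that] unfolding xs(2) by simp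
  have pick0: "w (xs ! l) \<in> B 0" if "l < length xs" for l using nth_mem[OF that] by (auto simp: B_def)
  define \<phi> where "\<phi> x l = representation (B 0) x (w (xs ! l))" for x l
  have B00: "independent (B 0)" "span (B 0) = S 0" using B[of 0] by auto
  show ?thesis
  proof
    show "\<phi> (x + y) l = \<phi> x l + \<phi> y l" if "x \<in> S 0" "y \<in> S 0" for x y l
      unfolding \<phi>_def using representation_add[OF B00(1), of y x] that B00(2) by simp
    show "\<phi> (scale c x) l = c * \<phi> x l" if "x \<in> S 0" for x c l
      unfolding \<phi>_def using representation_scale[OF B00(1), of x c] that B00(2) by simp
    show "\<phi> x l = 0" if x: "x \<in> S i" "l < length xs" "xs ! l < i" for x i l
    proof -
      define i' where "i' = min i N"
      have i': "i' \<le> N" "xs ! l < i'" using x(3) pickN[OF x(2)] by (auto simp: i'_def)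
      have "S i \<subseteq> S i'" unfolding i'_def S_def by (intro span_mono) auto
      then have "x \<in> span (B i')" using x(1) B[OF i'(1)] by auto
      moreover have "B i' \<subseteq> B 0" by (auto simp: B_def)
      ultimately have "representation (B 0) x = representation (B i') x"
        using representation_extend[OF B00(1)] by blast
      moreover have "w (xs ! l) \<notin> B i'"
        using pick[OF x(2) i'(2)] B[OF i'(1)] span_superset[of "B i'"] by auto
      ultimately show ?thesis unfolding \<phi>_def using representation_ne_zero by metis
    qed
    then have later: "\<phi> x l = 0" if "x \<in> S i" "l < length xs" "xs ! l < i" for x i l using that by blast
    show "\<phi> (w (xs ! k)) l = (if l = k then 1 else 0)" if "k < length xs" "l < length xs" for k l
    proof -
      have "w (xs ! l) \<noteq> w (xs ! k)" if "l \<noteq> k"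
      proof -
        have "w (xs ! a) \<noteq> w (xs ! b)" if "a < b" "b < length xs" for a b
        proof -
          have "xs ! a < xs ! b" using xs(1) that by (simp add: sorted_wrt_nth_less)
          moreover have "w (xs ! b) \<in> S (xs ! b)"
            unfolding S_def using pickN[OF that(2)] by (intro span_base) auto
          ultimately show ?thesis using pick[of a "xs ! b"] that by auto
        qed
        then show ?thesis using \<open>k < length xs\<close> \<open>l < length xs\<close> that by (metis linorder_neqE_nat)
      qed
      then show ?thesis
        unfolding \<phi>_def representation_basis[OF B00(1) pick0[OF that(1)]] by auto
    qed
    show "x \<in> U \<longleftrightarrow> (\<forall>l<length xs. \<phi> x l = 0)" if x: "x \<in> S 0" for x
    proof
      assume "x \<in> U"
      then have "x \<in> S N" unfolding S_def by (intro span_base) auto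
      then show "\<forall>l<length xs. \<phi> x l = 0" using later pickN by blast
    next
      assume 0: "\<forall>l<length xs. \<phi> x l = 0"
      have "b \<in> B0" if "representation (B 0) x b \<noteq> 0" for b
      proof -
        have "b \<in> B 0" using representation_ne_zero[OF that] .
        moreover have "b \<noteq> w j" if "j \<in> set xs" for j
          using 0 \<open>representation (B 0) x b \<noteq> 0\<close> that unfolding \<phi>_def in_set_conv_nth by auto
        ultimately show ?thesis unfolding B_def by auto
      qed
      then have "(\<Sum>b | representation (B 0) x b \<noteq> 0. scale (representation (B 0) x b) b) \<in> span B0"
        by (intro span_sum span_scale span_base) auto
      then show "x \<in> U"
        using sum_nonzero_representation_eq[OF B00(1), of x] x B00(2) spanB0 by simp
    qed
  qed
qed

definition pm_scale :: "'k::field \<Rightarrow> ('x \<Rightarrow>\<^sub>0 'k) \<Rightarrow> 'x \<Rightarrow>\<^sub>0 'k" where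
  "pm_scale c f = Poly_Mapping.map (\<lambda>x. c * x) f"

lemma lookup_pm_scale [simp]: "Poly_Mapping.lookup (pm_scale c f) p = c * Poly_Mapping.lookup f p"
  by (simp add: pm_scale_def Poly_Mapping.map.rep_eq when_def)

interpretation pm_vs: vector_space "pm_scale :: 'k::field \<Rightarrow> ('x \<Rightarrow>\<^sub>0 'k) \<Rightarrow> 'x \<Rightarrow>\<^sub>0 'k"
  by unfold_locales (auto intro!: poly_mapping_eqI simp: lookup_add algebra_simps)

locale one_vertex_quiver =
  fixes Q :: "('v, 'e) pre_digraph" and v :: 'v
  assumes fin: "fin_digraph Q" and verts: "verts Q = {v}"
begin

abbreviation KQ :: "('k::field, ('v \<times> 'e list) \<Rightarrow>\<^sub>0 'k) module" where
  "KQ \<equiv> path_algebra Q"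

definition word :: "'e list \<Rightarrow> ('v \<times> 'e list) \<Rightarrow>\<^sub>0 'k::field" where
  "word p = Poly_Mapping.single (v, p) 1"

lemma ends: "e \<in> arcs Q \<Longrightarrow> tail Q e = v \<and> head Q e = v"
proof -
  assume e: "e \<in> arcs Q"
  interpret fin_digraph Q by (rule fin)
  show ?thesis using tail_in_verts[OF e] head_in_verts[OF e] verts by simp
qed

lemma awalk_iff: "pre_digraph.awalk Q u p x \<longleftrightarrow> u = v \<and> x = v \<and> set p \<subseteq> arcs Q"
proof -
  have "pre_digraph.cas Q v p x \<longleftrightarrow> x = v" if "set p \<subseteq> arcs Q"
    using that by (induction p) (auto simp: pre_digraph.cas.simps ends)
  then show ?thesis by (auto simp: pre_digraph.awalk_def verts)
qed

lemma quiver_paths_eq: "quiver_paths Q = {v} \<times> lists (arcs Q)"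
  by (auto simp: quiver_paths_def awalk_iff)

lemma path_end_eq: "p \<in> quiver_paths Q \<Longrightarrow> path_end Q p = v"
proof -
  have "last (pre_digraph.awalk_verts Q v p) = v" if "set p \<subseteq> arcs Q" for p
    using that by (induction p) (auto simp: pre_digraph.awalk_verts.simps ends)
  moreover assume "p \<in> quiver_paths Q"
  then have "fst p = v" "set (snd p) \<subseteq> arcs Q" by (auto simp: quiver_paths_eq)
  ultimately show "path_end Q p = v" by (simp add: path_end_def)
qed

lemma KQ_simps [simp]:
  "f \<oplus>\<^bsub>KQ\<^esub> g = f + g" "\<zero>\<^bsub>KQ\<^esub> = 0" "\<one>\<^bsub>KQ\<^esub> = word []" "c \<odot>\<^bsub>KQ\<^esub> f = pm_scale c f"
  by (simp_all add: path_algebra_def verts word_def pm_scale_def)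

lemma KQ_carrier: "carrier KQ = {f. Poly_Mapping.keys f \<subseteq> {v} \<times> lists (arcs Q)}"
  by (simp add: path_algebra_def quiver_paths_eq)

lemma KQ_mult:
  fixes f g :: "('v \<times> 'e list) \<Rightarrow>\<^sub>0 'k::field"
  assumes "f \<in> carrier KQ" "g \<in> carrier KQ"
    and F: "finite F" "Poly_Mapping.keys f \<subseteq> F" and G: "finite G" "Poly_Mapping.keys g \<subseteq> G"
  shows "f \<otimes>\<^bsub>KQ\<^esub> g = (\<Sum>p\<in>F. \<Sum>q\<in>G.
    Poly_Mapping.single (v, snd q @ snd p) (Poly_Mapping.lookup f p * Poly_Mapping.lookup g q))"
proof -
  have "f \<otimes>\<^bsub>KQ\<^esub> g = (\<Sum>p\<in>Poly_Mapping.keys f. \<Sum>q\<in>Poly_Mapping.keys g.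
      Poly_Mapping.single (v, snd q @ snd p) (Poly_Mapping.lookup f p * Poly_Mapping.lookup g q))"
    unfolding path_algebra_def monoid.simps
  proof (intro sum.cong refl)
    fix p q assume "p \<in> Poly_Mapping.keys f" "q \<in> Poly_Mapping.keys g"
    then have "p \<in> quiver_paths Q" "q \<in> quiver_paths Q"
      using assms(1,2) unfolding KQ_carrier quiver_paths_eq by auto
    then have "path_end Q q = fst p" "fst q = v" using path_end_eq by (auto simp: quiver_paths_eq)
    then show "(if path_end Q q = fst p then Poly_Mapping.single (fst q, snd q @ snd p)
        (Poly_Mapping.lookup f p * Poly_Mapping.lookup g q) else 0) =
      Poly_Mapping.single (v, snd q @ snd p) (Poly_Mapping.lookup f p * Poly_Mapping.lookup g q)" by simp
  qed
  also have "\<dots> = (\<Sum>p\<in>Poly_Mapping.keys f. \<Sum>q\<in>G.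
      Poly_Mapping.single (v, snd q @ snd p) (Poly_Mapping.lookup f p * Poly_Mapping.lookup g q))"
    by (intro sum.cong refl sum.mono_neutral_left G) (auto simp: in_keys_iff)
  also have "\<dots> = (\<Sum>p\<in>F. \<Sum>q\<in>G.
      Poly_Mapping.single (v, snd q @ snd p) (Poly_Mapping.lookup f p * Poly_Mapping.lookup g q))"
    by (intro sum.mono_neutral_left F) (auto simp: in_keys_iff)
  finally show ?thesis .
qed

lemma word_closed: "set p \<subseteq> arcs Q \<Longrightarrow> word p \<in> carrier KQ"
  by (auto simp: word_def KQ_carrier)

lemma word_mult: "set p \<subseteq> arcs Q \<Longrightarrow> set q \<subseteq> arcs Q \<Longrightarrow> word p \<otimes>\<^bsub>KQ\<^esub> word q = word (q @ p)"
  using KQ_mult[OF word_closed word_closed, of p q "{(v, p)}" "{(v, q)}"] by (simp add: word_def)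

lemma KQ_eq_sum_words:
  assumes "f \<in> carrier KQ"
  shows "f = (\<Sum>p\<in>Poly_Mapping.keys f. pm_scale (Poly_Mapping.lookup f p) (word (snd p)))"
proof -
  have "Poly_Mapping.single p (Poly_Mapping.lookup f p) = pm_scale (Poly_Mapping.lookup f p) (word (snd p))"
    if "p \<in> Poly_Mapping.keys f" for p
    using that assms by (intro poly_mapping_eqI) (auto simp: KQ_carrier word_def lookup_single when_def)
  then show ?thesis using poly_mapping_sum_single[of f] by simp
qed

lemma k_algebra_KQ:
  assumes "ring (KQ :: ('k::field, ('v \<times> 'e list) \<Rightarrow>\<^sub>0 'k) module)"
  shows "k_algebra (KQ :: ('k, ('v \<times> 'e list) \<Rightarrow>\<^sub>0 'k) module)"
proof -
  interpret ring "KQ :: ('k, ('v \<times> 'e list) \<Rightarrow>\<^sub>0 'k) module" by fact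
  have keys: "Poly_Mapping.keys (pm_scale c f) \<subseteq> Poly_Mapping.keys f" for c and f :: "('v \<times> 'e list) \<Rightarrow>\<^sub>0 'k"
    by (auto simp: in_keys_iff)
  then have cl: "pm_scale c f \<in> carrier KQ" if "f \<in> carrier KQ" for c and f :: "('v \<times> 'e list) \<Rightarrow>\<^sub>0 'k"
    using that unfolding KQ_carrier by blast
  have single: "Poly_Mapping.single x (c * d) = pm_scale c (Poly_Mapping.single x d)" for x :: "'v \<times> 'e list" and c d :: 'k
    by (rule poly_mapping_eqI) (simp add: lookup_single when_def)
  have mult: "pm_scale c f \<otimes>\<^bsub>KQ\<^esub> g = pm_scale c (f \<otimes>\<^bsub>KQ\<^esub> g)" "f \<otimes>\<^bsub>KQ\<^esub> pm_scale c g = pm_scale c (f \<otimes>\<^bsub>KQ\<^esub> g)"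
    if "f \<in> carrier KQ" "g \<in> carrier KQ" for c and f g :: "('v \<times> 'e list) \<Rightarrow>\<^sub>0 'k"
    by (simp_all add: KQ_mult[OF _ _ finite_keys _ finite_keys, of _ _ f g] that cl keys
        pm_vs.scale_sum_right single[symmetric] mult_ac)
  show ?thesis
    by unfold_locales (simp_all add: cl mult pm_vs.scale_right_distrib)
qed

text \<open>The homomorphism to \<open>K[X]\<close> that sends every arrow to \<open>X\<close>.\<close>

definition length_poly :: "(('v \<times> 'e list) \<Rightarrow>\<^sub>0 'k::field) \<Rightarrow> 'k poly" where
  "length_poly f = (\<Sum>p\<in>Poly_Mapping.keys f. Polynomial.monom (Poly_Mapping.lookup f p) (length (snd p)))"

lemma length_poly_superset:
  assumes "finite F" "Poly_Mapping.keys f \<subseteq> F"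
  shows "length_poly f = (\<Sum>p\<in>F. Polynomial.monom (Poly_Mapping.lookup f p) (length (snd p)))"
  unfolding length_poly_def by (rule sum.mono_neutral_left) (use assms in \<open>auto simp: in_keys_iff\<close>)

lemma length_poly_add: "length_poly (f + g) = length_poly f + length_poly g"
proof -
  let ?B = "Poly_Mapping.keys f \<union> Poly_Mapping.keys g"
  have "Poly_Mapping.keys (f + g) \<subseteq> ?B" by (rule keys_add)
  then show ?thesis
    by (simp add: length_poly_superset[of ?B] lookup_add add_monom[symmetric] sum.distrib)
qed

lemma length_poly_sum: "length_poly (\<Sum>i\<in>I. f i) = (\<Sum>i\<in>I. length_poly (f i))"
proof -
  have "length_poly 0 = 0" by (simp add: length_poly_def)
  then show ?thesis by (induction I rule: infinite_finite_induct) (auto simp: length_poly_add)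
qed

lemma length_poly_single: "length_poly (Poly_Mapping.single p c) = Polynomial.monom c (length (snd p))"
  by (simp add: length_poly_def)

lemma length_poly_scale: "length_poly (pm_scale c f) = smult c (length_poly f)"
proof -
  have "Poly_Mapping.keys (pm_scale c f) \<subseteq> Poly_Mapping.keys f" by (auto simp: in_keys_iff)
  then show ?thesis
    by (intro poly_eqI) (simp add: length_poly_superset[of "Poly_Mapping.keys f"] coeff_sum sum_distrib_left
        if_distrib[of "\<lambda>x. _ * x"] cong: if_cong)
qed

lemma length_poly_mult:
  assumes "f \<in> carrier KQ" "g \<in> carrier KQ"
  shows "length_poly (f \<otimes>\<^bsub>KQ\<^esub> g) = length_poly f * length_poly g"
  unfolding KQ_mult[OF assms finite_keys order_refl finite_keys order_refl] length_poly_sum length_poly_single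
  by (simp add: length_poly_def sum_product mult_monom add.commute)

text \<open>
  The combinations of paths of length at least two form an ideal, and it contains the relations that
  generate \<open>I\<close>.
\<close>

lemma admissible_long_paths:
  fixes I :: "(('v \<times> 'e list) \<Rightarrow>\<^sub>0 'k::field) set"
  assumes "admissible_ideal Q I" "f \<in> I" "p \<in> Poly_Mapping.keys f"
  shows "2 \<le> length (snd p)"
proof -
  let ?K = "KQ :: ('k, ('v \<times> 'e list) \<Rightarrow>\<^sub>0 'k) module"
  obtain S where I: "ideal I ?K" and S: "\<forall>r\<in>S. relation_in Q r" "I = genideal ?K S"
    using assms(1) unfolding admissible_ideal_def by blast
  interpret I: ideal I ?K by (rule I)
  define L where "L = {f \<in> carrier ?K. \<forall>p\<in>Poly_Mapping.keys f. 2 \<le> length (snd p)}"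
  have neg: "\<ominus>\<^bsub>?K\<^esub> f = - f" if "f \<in> carrier ?K" for f
  proof -
    have "- f \<in> carrier ?K" using that by (auto simp: KQ_carrier in_keys_iff subset_iff)
    then show ?thesis using that by (intro I.minus_equality) simp_all
  qed
  have mult: "2 \<le> length (snd r)"
    if fg: "f \<in> carrier ?K" "g \<in> carrier ?K" "f \<in> L \<or> g \<in> L" and r: "r \<in> Poly_Mapping.keys (f \<otimes>\<^bsub>?K\<^esub> g)" for f g r
  proof -
    note r' = r[unfolded KQ_mult[OF fg(1,2) finite_keys order_refl finite_keys order_refl]]
    obtain p where p: "p \<in> Poly_Mapping.keys f"
      and rp: "r \<in> Poly_Mapping.keys (\<Sum>q\<in>Poly_Mapping.keys g.
        Poly_Mapping.single (v, snd q @ snd p) (Poly_Mapping.lookup f p * Poly_Mapping.lookup g q))"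
      using subsetD[OF keys_sum r'] by (elim UN_E)
    obtain q where q: "q \<in> Poly_Mapping.keys g" and "r \<in> Poly_Mapping.keys
        (Poly_Mapping.single (v, snd q @ snd p) (Poly_Mapping.lookup f p * Poly_Mapping.lookup g q))"
      using subsetD[OF keys_sum rp] by (elim UN_E)
    then have "r = (v, snd q @ snd p)" by (simp split: if_splits)
    then have "length (snd r) = length (snd q) + length (snd p)" by simp
    moreover have "2 \<le> length (snd p) \<or> 2 \<le> length (snd q)" using fg(3) p q unfolding L_def by blast
    ultimately show ?thesis by linarith
  qed
  have "ideal L ?K"
  proof (rule idealI[OF I.ring_axioms])
    show "subgroup L (add_monoid ?K)"
    proof (rule subgroup.intro)
      show "x \<otimes>\<^bsub>add_monoid ?K\<^esub> y \<in> L" if "x \<in> L" "y \<in> L" for x y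
      proof -
        have "x + y \<in> carrier ?K" using I.a_closed[of x y] that by (simp add: L_def)
        moreover have "2 \<le> length (snd p)" if "p \<in> Poly_Mapping.keys (x + y)" for p
          using subsetD[OF keys_add that] \<open>x \<in> L\<close> \<open>y \<in> L\<close> unfolding L_def by blast
        ultimately show ?thesis by (simp add: L_def)
      qed
      show "inv\<^bsub>add_monoid ?K\<^esub> x \<in> L" if "x \<in> L" for x
      proof -
        have x: "x \<in> carrier ?K" using that by (simp add: L_def)
        have "inv\<^bsub>add_monoid ?K\<^esub> x = - x" using neg[OF x] by (simp only: a_inv_def)
        moreover have "- x \<in> carrier ?K" using I.a_inv_closed[OF x] neg[OF x] by simp
        ultimately show ?thesis using that by (simp add: L_def in_keys_iff)
      qed
    qed (auto simp: L_def KQ_carrier)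
    show "x \<otimes>\<^bsub>?K\<^esub> a \<in> L" if "a \<in> L" "x \<in> carrier ?K" for a x
      using mult[of x a] that I.m_closed[of x a] unfolding L_def by blast
    show "a \<otimes>\<^bsub>?K\<^esub> x \<in> L" if "a \<in> L" "x \<in> carrier ?K" for a x
      using mult[of a x] that I.m_closed[of a x] unfolding L_def by blast
  qed
  moreover have "S \<subseteq> L"
  proof
    fix r assume "r \<in> S"
    then have "relation_in Q r" using S(1) by blast
    then obtain a b where "\<forall>p\<in>Poly_Mapping.keys r. fst p = a \<and> pre_digraph.awalk Q a (snd p) b \<and> 2 \<le> length (snd p)"
      unfolding relation_in_def by blast
    then show "r \<in> L" unfolding L_def KQ_carrier awalk_iff by fastforce
  qed
  ultimately have "I \<subseteq> L" unfolding S(2) by (rule I.genideal_minimal)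
  then show ?thesis using assms(2,3) unfolding L_def by blast
qed

end

section \<open>Admissible quotients with one vertex\<close>

context one_vertex_quiver
begin

text \<open>
  With at most one arrow there is at most one path of each length. If \<open>k\<close> is the least length from which
  on all paths lie in the ideal \<open>I\<close>, then \<open>I\<close> contains no \<open>f\<close> with a lowest term of length \<open>i < k\<close>:
  multiplying \<open>f\<close> by the path of length \<open>k-1-i\<close> would put the path of length \<open>k-1\<close> into \<open>I\<close>.
\<close>

lemma truncated_if_at_most_one_arrow:
  fixes I :: "(('v \<times> 'e list) \<Rightarrow>\<^sub>0 'k::field) set"
  assumes adm: "admissible_ideal Q I" and arcs: "card (arcs Q) \<le> 1"
  shows "\<exists>D \<kappa>. truncated_algebra (quotient_algebra (path_algebra Q) I) D \<kappa>"
proof -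
  let ?K = "KQ :: ('k, ('v \<times> 'e list) \<Rightarrow>\<^sub>0 'k) module"
  have I: "ideal I ?K" using adm by (simp add: admissible_ideal_def)
  interpret K: k_algebra ?K by (rule k_algebra_KQ[OF ideal.axioms(2)[OF I]])
  interpret I: ideal I ?K by (rule I)
  note I_zero = additive_subgroup.zero_closed[OF ideal.axioms(1)[OF I]]
    and I_plus = additive_subgroup.a_closed[OF ideal.axioms(1)[OF I]]
  have I_add: "f + g \<in> I" if "f \<in> I" "g \<in> I" for f g using I_plus[OF that] by simp
  have I_scale: "pm_scale c f \<in> I" if "f \<in> I" for c f using K.smult_ideal[OF I that, of c] by simp
  have I_sum: "(\<Sum>p\<in>F. g p) \<in> I" if "\<And>p. p \<in> F \<Longrightarrow> g p \<in> I" for F :: "('v \<times> 'e list) set" and g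
    using that by (induction F rule: infinite_finite_induct) (use I_zero I_add in auto)
  have fin_arcs: "finite (arcs Q)" using fin by (simp add: fin_digraph_def fin_digraph_axioms_def)
  have uniq: "p = q" if "set p \<subseteq> arcs Q" "set q \<subseteq> arcs Q" "length p = length q" for p q
  proof (rule nth_equalityI[OF that(3)])
    fix i assume "i < length p"
    then have "p ! i \<in> arcs Q" "q ! i \<in> arcs Q" using that by (auto simp: subset_iff)
    then show "p ! i = q ! i" using arcs fin_arcs by (metis One_nat_def card_le_Suc0_iff_eq)
  qed
  have coeff: "coeff (length_poly f) (length (snd p)) = Poly_Mapping.lookup f p"
    if f: "f \<in> carrier ?K" and p: "p \<in> Poly_Mapping.keys f" for f p
  proof -
    have "coeff (length_poly f) (length (snd p)) =
        (\<Sum>q\<in>Poly_Mapping.keys f. if q = p then Poly_Mapping.lookup f p else 0)"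
      unfolding length_poly_def coeff_sum
    proof (rule sum.cong[OF refl])
      fix q assume "q \<in> Poly_Mapping.keys f"
      then have "q = p" if "length (snd q) = length (snd p)"
        using f p that uniq[of "snd q" "snd p"] unfolding KQ_carrier by (cases q; cases p) auto
      then show "coeff (Polynomial.monom (Poly_Mapping.lookup f q) (length (snd q))) (length (snd p)) =
          (if q = p then Poly_Mapping.lookup f p else 0)" by auto
    qed
    then show ?thesis using p by simp
  qed
  define long where "long n \<longleftrightarrow> (\<forall>p. set p \<subseteq> arcs Q \<longrightarrow> n \<le> length p \<longrightarrow> (word p :: ('v \<times> 'e list) \<Rightarrow>\<^sub>0 'k) \<in> I)" for n
  obtain m where m: "\<forall>p\<in>quiver_paths Q. m \<le> length (snd p) \<longrightarrow> Poly_Mapping.single p 1 \<in> I"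
    using adm unfolding admissible_ideal_def by blast
  have "long m" unfolding long_def word_def using m by (auto simp: quiver_paths_eq)
  define k where "k = (LEAST n. long n)"
  have k: "long k" and k_min: "\<not> long n" if "n < k" for n
    using LeastI[of long, OF \<open>long m\<close>] not_less_Least[of n long] that by (auto simp: k_def)
  have long_k: "long k" unfolding k_def by (rule LeastI[of long, OF \<open>long m\<close>])
  have in_I: "f \<in> I" if f: "f \<in> carrier ?K" and 0: "\<And>i. i < k \<Longrightarrow> coeff (length_poly f) i = 0" for f
  proof -
    have "pm_scale (Poly_Mapping.lookup f p) (word (snd p)) \<in> I" if p: "p \<in> Poly_Mapping.keys f" for p
    proof -
      have "\<not> length (snd p) < k" using 0 coeff[OF f p] p by (auto simp: in_keys_iff)
      moreover have "set (snd p) \<subseteq> arcs Q" using f p unfolding KQ_carrier by (cases p) auto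
      ultimately show ?thesis using long_k by (intro I_scale) (simp add: long_def)
    qed
    then show ?thesis by (subst KQ_eq_sum_words[OF f]) (rule I_sum)
  qed
  have I0: "coeff (length_poly f) 0 = 0" if "f \<in> I" for f
  proof -
    have "length (snd p) \<noteq> 0" if "p \<in> Poly_Mapping.keys f" for p
      using admissible_long_paths[OF adm \<open>f \<in> I\<close> that] by linarith
    then show ?thesis unfolding length_poly_def coeff_sum by (intro sum.neutral) auto
  qed
  have word_poly: "length_poly (word p) = Polynomial.monom 1 (length p)" for p
    by (simp add: word_def length_poly_single)
  have "word [] \<notin> I" using I0[of "word []"] by (auto simp: word_poly)
  then have k_pos: "0 < k" using long_k by (auto simp: long_def intro!: gr0I)
  have ker: "f \<in> I \<longleftrightarrow> (\<forall>i<k. coeff (length_poly f) i = 0)" if f: "f \<in> carrier ?K" for f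
  proof
    assume fI: "f \<in> I"
    show "\<forall>i<k. coeff (length_poly f) i = 0"
    proof (rule ccontr)
      assume "\<not> ?thesis"
      then obtain i0 where "i0 < k \<and> coeff (length_poly f) i0 \<noteq> 0" by blast
      then obtain i where i: "i < k" "coeff (length_poly f) i \<noteq> 0"
        and low: "\<And>j. j < i \<Longrightarrow> coeff (length_poly f) j = 0"
        using exists_least_iff[of "\<lambda>i. i < k \<and> coeff (length_poly f) i \<noteq> 0"] by (metis less_trans)
      obtain p where p: "p \<in> Poly_Mapping.keys f" "length (snd p) = i"
      proof -
        have "\<exists>p\<in>Poly_Mapping.keys f. coeff (Polynomial.monom (Poly_Mapping.lookup f p) (length (snd p))) i \<noteq> 0"
          using i(2) unfolding length_poly_def coeff_sum by (meson sum.neutral)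
        then show ?thesis using that by (auto split: if_splits)
      qed
      have "i \<noteq> 0" using i(2) I0[OF fI] by metis
      have "set (snd p) \<subseteq> arcs Q" using f p(1) unfolding KQ_carrier by auto
      moreover have "snd p \<noteq> []" using p(2) \<open>i \<noteq> 0\<close> by auto
      ultimately obtain e where e: "e \<in> arcs Q" using hd_in_set by blast
      define w where "w = replicate (k - 1 - i) e"
      have w: "set w \<subseteq> arcs Q" "length w = k - 1 - i" using e by (auto simp: w_def)
      define g where "g = f \<otimes>\<^bsub>?K\<^esub> word w"
      have gI: "g \<in> I" unfolding g_def by (rule I.I_r_closed[OF fI word_closed[OF w(1)]])
      have gK: "g \<in> carrier ?K" using gI I.a_subset by blast
      have gp: "length_poly g = length_poly f * Polynomial.monom 1 (k - 1 - i)"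
        unfolding g_def length_poly_mult[OF f word_closed[OF w(1)]] word_poly w(2) ..
      have g_coeff: "coeff (length_poly g) j = (if j < k - 1 - i then 0 else coeff (length_poly f) (j - (k - 1 - i)))" for j
        unfolding gp by (subst mult.commute) (simp add: coeff_monom_mult)
      define c where "c = coeff (length_poly f) i"
      have "word q \<in> I" if q: "set q \<subseteq> arcs Q" "k - 1 \<le> length q" for q
      proof (cases "k \<le> length q")
        case True
        then show ?thesis using long_k q by (simp add: long_def)
      next
        case False
        then have lq: "length q = k - 1" using q(2) by simp
        have cq: "pm_scale (- c) (word q) \<in> carrier ?K" using K.smult_closed[OF word_closed[OF q(1)], of "- c"] by simp
        have "g + pm_scale (- c) (word q) \<in> I"
        proof (rule in_I)
          show "g + pm_scale (- c) (word q) \<in> carrier ?K" using K.a_closed[OF gK cq] by simp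
          fix j assume j: "j < k"
          have "coeff (length_poly g) j = (if j = k - 1 then c else 0)"
            unfolding g_coeff using j i(1) low[of "j - (k - 1 - i)"] by (auto simp: c_def)
          then show "coeff (length_poly (g + pm_scale (- c) (word q))) j = 0"
            unfolding length_poly_add length_poly_scale word_poly lq coeff_add by simp
        qed
        from I_add[OF this I_scale[OF gI, of "- 1"]] have "pm_scale (- c) (word q) \<in> I" by simp
        then have "pm_scale (- inverse c) (pm_scale (- c) (word q)) \<in> I" by (rule I_scale)
        then show ?thesis using i(2) unfolding pm_vs.scale_scale by (simp add: c_def)
      qed
      then have "long (k - 1)" by (simp add: long_def)
      then show False using k_min[of "k - 1"] k_pos by simp
    qed
  qed (use in_I f in blast)
  have short_word: "\<exists>p. set p \<subseteq> arcs Q \<and> length p = i" if "i < k" for i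
  proof (cases "arcs Q = {}")
    case True
    then have "long 1" unfolding long_def by auto
    then have "k \<le> 1" using k_min[of 1] by linarith
    then show ?thesis using that by (intro exI[of _ "[]"]) auto
  next
    case False
    then obtain e where "e \<in> arcs Q" by blast
    then show ?thesis by (intro exI[of _ "replicate i e"]) auto
  qed
  then obtain sw where sw: "\<And>i. i < k \<Longrightarrow> set (sw i) \<subseteq> arcs Q \<and> length (sw i) = i" by metis
  have surj: "\<exists>f\<in>carrier ?K. \<forall>i<k. coeff (length_poly f) i = x i" for x :: "nat \<Rightarrow> 'k"
  proof -
    have "\<exists>f\<in>carrier ?K. \<forall>i<k. coeff (length_poly f) i = (if i < n then x i else 0)" if "n \<le> k" for n
      using that
    proof (induction n)
      case 0
      show ?case by (rule bexI[OF _ K.zero_closed]) (simp add: length_poly_def)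
    next
      case (Suc n)
      then obtain f where f: "f \<in> carrier ?K" "\<forall>i<k. coeff (length_poly f) i = (if i < n then x i else 0)" by auto
      have s: "set (sw n) \<subseteq> arcs Q" "length (sw n) = n" using sw[of n] Suc.prems by auto
      have c: "pm_scale (x n) (word (sw n)) \<in> carrier ?K" using K.smult_closed[OF word_closed[OF s(1)], of "x n"] by simp
      have "f + pm_scale (x n) (word (sw n)) \<in> carrier ?K" using K.a_closed[OF f(1) c] by simp
      moreover have "coeff (length_poly (f + pm_scale (x n) (word (sw n)))) i = (if i < Suc n then x i else 0)" if "i < k" for i
        using f(2) that by (auto simp: length_poly_add length_poly_scale word_poly s(2) less_Suc_eq)
      ultimately show ?case by blast
    qed
    from this[OF order_refl] show ?thesis by (elim bexE) (auto intro!: bexI)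
  qed
  obtain \<kappa> where Q: "coord_algebra (quotient_algebra ?K I) k \<kappa>"
    and \<kappa>: "\<And>f i. f \<in> carrier ?K \<Longrightarrow> i < k \<Longrightarrow> \<kappa> (I +>\<^bsub>?K\<^esub> f) i = coeff (length_poly f) i"
  proof (rule K.quotient_coordinates[OF I, of k "\<lambda>f. coeff (length_poly f)"])
    show "\<exists>f\<in>carrier ?K. \<forall>i<k. coeff (length_poly f) i = x i" for x by (rule surj)
    show "f \<in> I \<longleftrightarrow> (\<forall>i<k. coeff (length_poly f) i = 0)" if "f \<in> carrier ?K" for f by (rule ker[OF that])
  qed (simp_all add: length_poly_add length_poly_scale)
  interpret Q: coord_algebra "quotient_algebra ?K I" k \<kappa> by (rule Q)
  note qs = K.quot_simps[OF I]
  have "truncated_algebra (quotient_algebra ?K I) k \<kappa>"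
  proof
    show "0 < k" by (rule k_pos)
    show "\<kappa> \<one>\<^bsub>quotient_algebra ?K I\<^esub> i = (if i = 0 then 1 else 0)" if "i < k" for i
      unfolding qs(3)[OF K.one_closed K.one_closed] using \<kappa>[OF K.one_closed that] by (simp add: word_poly)
    fix a b i assume ab: "a \<in> carrier (quotient_algebra ?K I)" "b \<in> carrier (quotient_algebra ?K I)" and i: "i < k"
    obtain f g where f: "f \<in> carrier ?K" "a = I +>\<^bsub>?K\<^esub> f" and g: "g \<in> carrier ?K" "b = I +>\<^bsub>?K\<^esub> g"
      using ab unfolding K.quot_carrier[OF I] by blast
    show "\<kappa> (a \<otimes>\<^bsub>quotient_algebra ?K I\<^esub> b) i = (\<Sum>j\<le>i. \<kappa> a j * \<kappa> b (i - j))"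
      unfolding f(2) g(2) qs(2)[OF f(1) g(1)] \<kappa>[OF K.m_closed[OF f(1) g(1)] i] length_poly_mult[OF f(1) g(1)] coeff_mult
      using i by (intro sum.cong) (auto simp: \<kappa> f(1) g(1))
  qed
  then show ?thesis by blast
qed

text \<open>
  Enumerate the paths of length less than \<open>m\<close> by increasing length and discard those which are, modulo
  \<open>I\<close>, combinations of later ones. The remaining paths are a basis of the quotient as required for a
  triangular algebra. The trivial path and two arrows come first and are not discarded.
\<close>

lemma not_geometrically_irreducible_if_two_arrows:
  fixes I :: "(('v \<times> 'e list) \<Rightarrow>\<^sub>0 'k::alg_closed_field) set"
  assumes adm: "admissible_ideal Q I" and ab: "a \<in> arcs Q" "b \<in> arcs Q" "a \<noteq> b"
  shows "\<not> geometrically_irreducible (quotient_algebra (path_algebra Q) I)"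
proof -
  let ?K = "KQ :: ('k, ('v \<times> 'e list) \<Rightarrow>\<^sub>0 'k) module"
  let ?A = "quotient_algebra ?K I"
  have I: "ideal I ?K" using adm by (simp add: admissible_ideal_def)
  interpret K: k_algebra ?K by (rule k_algebra_KQ[OF ideal.axioms(2)[OF I]])
  interpret I: ideal I ?K by (rule I)
  note I_zero = additive_subgroup.zero_closed[OF ideal.axioms(1)[OF I]]
    and I_plus = additive_subgroup.a_closed[OF ideal.axioms(1)[OF I]]
  have subspaceI: "pm_vs.subspace I"
    unfolding pm_vs.subspace_def using I_zero I_plus K.smult_ideal[OF I] by simp
  have subspaceK: "pm_vs.subspace (carrier ?K)"
    unfolding pm_vs.subspace_def using K.zero_closed K.a_closed K.smult_closed by simp
  obtain m where m2: "2 \<le> m" and m: "\<forall>p\<in>quiver_paths Q. m \<le> length (snd p) \<longrightarrow> Poly_Mapping.single p 1 \<in> I"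
    using adm unfolding admissible_ideal_def by blast
  have long: "word p \<in> I" if "set p \<subseteq> arcs Q" "m \<le> length p" for p
    using m that by (auto simp: word_def quiver_paths_eq)
  have fin_arcs: "finite (arcs Q)" using fin by (simp add: fin_digraph_def fin_digraph_axioms_def)
  define W where "W = {p. set p \<subseteq> arcs Q \<and> length p \<le> m - 1}"
  have finW: "finite (W - {[], [a], [b]})" unfolding W_def by (intro finite_Diff finite_lists_length_le fin_arcs)
  obtain rest where rest: "set rest = W - {[], [a], [b]}" using finite_list[OF finW] by blast
  define ws where "ws = [[], [a], [b]] @ sort_key length rest"
  define N where "N = length ws"
  have ws_set: "set ws = W" using ab m2 by (auto simp: ws_def rest W_def)
  have ws_sorted: "sorted (map length ws)"
  proof -
    have "1 \<le> length p" if "p \<in> set rest" for p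
    proof -
      have "p \<noteq> []" using that rest by blast
      then show ?thesis by (cases p) simp_all
    qed
    then show ?thesis by (simp add: ws_def)
  qed
  have ws_mono: "length (ws ! i) \<le> length (ws ! j)" if "i \<le> j" "j < N" for i j
    using sorted_nth_mono[OF ws_sorted, of i j] that by (simp add: N_def)
  have ws_arcs: "set (ws ! i) \<subseteq> arcs Q" if "i < N" for i
    using nth_mem[of i ws] that ws_set by (simp add: N_def W_def)
  have N3: "3 \<le> N" by (simp add: N_def ws_def)
  have ws012: "ws ! 0 = []" "ws ! 1 = [a]" "ws ! 2 = [b]" by (simp_all add: ws_def)
  define w where "w i = (word (ws ! i) :: ('v \<times> 'e list) \<Rightarrow>\<^sub>0 'k)" for i
  define S where "S i = pm_vs.span (I \<union> w ` {i..<N})" for i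
  have wK: "w i \<in> carrier ?K" if "i < N" for i unfolding w_def by (rule word_closed[OF ws_arcs[OF that]])
  have longer: "word p \<in> S (Suc j)" if "set p \<subseteq> arcs Q" "j < N" "length (ws ! j) < length p" for p j
  proof (cases "m \<le> length p")
    case True
    then show ?thesis unfolding S_def using long that(1) by (intro pm_vs.span_base) auto
  next
    case False
    then have "p \<in> set ws" unfolding ws_set W_def using that(1) by auto
    then obtain l where l: "l < N" "p = ws ! l" unfolding in_set_conv_nth N_def by auto
    then have "j < l" using ws_mono[of l j] that by (metis not_le)
    then show ?thesis unfolding S_def using l by (intro pm_vs.span_base) (auto simp: w_def)
  qed
  have word_S0: "word p \<in> S 0" if "set p \<subseteq> arcs Q" for p
  proof (cases p)
    case Nil
    then have "word p = w 0" by (simp add: w_def ws012)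
    moreover have "w 0 \<in> I \<union> w ` {0..<N}" using N3 by (intro UnI2 imageI) auto
    ultimately show ?thesis unfolding S_def by (simp only: pm_vs.span_base)
  next
    case (Cons x xs)
    then have "word p \<in> S (Suc 0)" using longer[OF that, of 0] N3 ws012 by simp
    moreover have "S (Suc 0) \<subseteq> S 0" unfolding S_def by (intro pm_vs.span_mono) auto
    ultimately show ?thesis by blast
  qed
  have S0: "S 0 = carrier ?K"
  proof
    show "S 0 \<subseteq> carrier ?K"
      unfolding S_def using I.a_subset wK by (intro pm_vs.span_minimal subspaceK) auto
    show "carrier ?K \<subseteq> S 0"
    proof
      fix f assume f: "f \<in> carrier ?K"
      have "pm_scale (Poly_Mapping.lookup f p) (word (snd p)) \<in> S 0" if "p \<in> Poly_Mapping.keys f" for p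
      proof -
        have "set (snd p) \<subseteq> arcs Q" using f that unfolding KQ_carrier by (cases p) auto
        then show ?thesis using word_S0 unfolding S_def by (intro pm_vs.span_scale) auto
      qed
      then show "f \<in> S 0"
        by (subst KQ_eq_sum_words[OF f]) (unfold S_def, rule pm_vs.span_sum)
    qed
  qed
  \<comment> \<open>The coefficient of a path of length at most one vanishes on \<open>I\<close> and on all other paths.\<close>
  have picked: "w i \<notin> S (Suc i)" if i: "i < 3" for i
  proof
    assume wi: "w i \<in> S (Suc i)"
    let ?L = "{f :: ('v \<times> 'e list) \<Rightarrow>\<^sub>0 'k. Poly_Mapping.lookup f (v, ws ! i) = 0}"
    have len: "length (ws ! i) < 2" using i ws012 by (auto simp: less_Suc_eq numeral_3_eq_3 numeral_2_eq_2)
    have "S (Suc i) \<subseteq> ?L"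
      unfolding S_def
    proof (rule pm_vs.span_minimal)
      show "pm_vs.subspace ?L" by (auto simp: pm_vs.subspace_def lookup_add)
      have "f \<in> ?L" if "f \<in> I" for f
        using admissible_long_paths[OF adm that, of "(v, ws ! i)"] len by (force simp: in_keys_iff)
      moreover have "w j \<in> ?L" if "Suc i \<le> j" "j < N" for j
      proof -
        have "ws ! j \<noteq> ws ! i"
        proof (cases "j < 3")
          case True
          then show ?thesis using that(1) i ab(3) ws012 by (auto simp: less_Suc_eq numeral_3_eq_3 numeral_2_eq_2)
        next
          case False
          have "ws ! j = sort_key length rest ! (j - 3)" using False by (simp add: ws_def nth_append numeral_3_eq_3)
          moreover have "j - 3 < length (sort_key length rest)" using False that(2) by (simp add: N_def ws_def)
          ultimately have "ws ! j \<in> set rest" by (metis nth_mem set_sort)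
          moreover have "ws ! i \<in> {[], [a], [b]}" using i ws012 by (auto simp: less_Suc_eq numeral_3_eq_3 numeral_2_eq_2)
          ultimately show ?thesis unfolding rest by (metis DiffD2)
        qed
        then show ?thesis by (simp add: w_def word_def lookup_single when_def)
      qed
      ultimately show "I \<union> w ` {Suc i..<N} \<subseteq> ?L" by auto
    qed
    then have "w i \<in> ?L" using wi by blast
    then show False by (simp add: w_def word_def)
  qed
  define R where "R = {i. i < N \<and> w i \<notin> S (Suc i)}"
  define xs where "xs = [0, 1, 2] @ sorted_list_of_set (R - {0, 1, 2})"
  have finR: "finite (R - {0, 1, 2})" by (simp add: R_def)
  have "{0, 1, 2} \<subseteq> R"
  proof -
    have "i \<in> R" if "i < 3" for i using picked[OF that] that N3 by (simp add: R_def)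
    from this[of 0] this[of 1] this[of 2] show ?thesis by simp
  qed
  then have xs_set: "set xs = R"
    unfolding xs_def set_append set_sorted_list_of_set[OF finR] by auto
  have "2 < j" if "j \<in> R - {0, 1, 2}" for j
  proof -
    have "j \<noteq> 0 \<and> j \<noteq> 1 \<and> j \<noteq> 2" using that by simp
    then show ?thesis by arith
  qed
  then have "\<forall>j\<in>set (sorted_list_of_set (R - {0, 1, 2})). 2 < j"
    unfolding set_sorted_list_of_set[OF finR] by blast
  then have xs_sorted: "sorted_wrt (<) xs"
    unfolding xs_def sorted_wrt_append using strict_sorted_list_of_set[of "R - {0, 1, 2}"] by fastforce
  define D where "D = length xs"
  have D3: "3 \<le> D" by (simp add: D_def xs_def)
  have xs012: "xs ! 0 = 0" "xs ! 1 = 1" "xs ! 2 = 2" by (simp_all add: xs_def)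
  have xsN: "xs ! l < N" if "l < D" for l using nth_mem[of l xs] that xs_set by (simp add: D_def R_def)
  have xs_less: "xs ! i < xs ! j" if "i < j" "j < D" for i j
    using sorted_wrt_nth_less[OF xs_sorted, of i j] that by (simp add: D_def)
  have xs_le: "xs ! i \<le> xs ! j" if "i \<le> j" "j < D" for i j
    using xs_less[of i j] that by (cases "i = j") auto
  obtain \<phi> where \<phi>_add: "\<And>x y l. x \<in> carrier ?K \<Longrightarrow> y \<in> carrier ?K \<Longrightarrow> \<phi> (x + y) l = \<phi> x l + \<phi> y l"
    and \<phi>_scale: "\<And>c x l. x \<in> carrier ?K \<Longrightarrow> \<phi> (pm_scale c x) l = c * \<phi> x l"
    and \<phi>_ker: "\<And>x. x \<in> carrier ?K \<Longrightarrow> x \<in> I \<longleftrightarrow> (\<forall>l<D. \<phi> x l = 0)"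
    and \<phi>_basis: "\<And>k l. k < D \<Longrightarrow> l < D \<Longrightarrow> \<phi> (w (xs ! k)) l = (if l = k then 1 else 0)"
    and \<phi>_later: "\<And>x i l. x \<in> S i \<Longrightarrow> l < D \<Longrightarrow> xs ! l < i \<Longrightarrow> \<phi> x l = 0"
    by (rule pm_vs.echelon_coordinates[OF subspaceI xs_sorted xs_set[unfolded R_def S_def],
          folded S_def, unfolded S0, folded D_def]) blast
  have surj: "\<exists>f\<in>carrier ?K. \<forall>l<D. \<phi> f l = x l" for x :: "nat \<Rightarrow> 'k"
  proof -
    have "\<exists>f\<in>carrier ?K. \<forall>l<D. \<phi> f l = (if l < n then x l else 0)" if "n \<le> D" for n
      using that
    proof (induction n)
      case 0
      have "0 \<in> I" using I_zero by simp
      then show ?case using \<phi>_ker[of 0] K.zero_closed by (intro bexI[of _ 0]) auto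
    next
      case (Suc n)
      then obtain f where f: "f \<in> carrier ?K" "\<forall>l<D. \<phi> f l = (if l < n then x l else 0)" by auto
      have wn: "w (xs ! n) \<in> carrier ?K" using wK xsN Suc.prems by simp
      have c: "pm_scale (x n) (w (xs ! n)) \<in> carrier ?K" using K.smult_closed[OF wn, of "x n"] by simp
      have "f + pm_scale (x n) (w (xs ! n)) \<in> carrier ?K" using K.a_closed[OF f(1) c] by simp
      moreover have "\<phi> (f + pm_scale (x n) (w (xs ! n))) l = (if l < Suc n then x l else 0)" if "l < D" for l
        using f(2) that Suc.prems \<phi>_basis[of n l] by (auto simp: \<phi>_add[OF f(1) c] \<phi>_scale[OF wn] less_Suc_eq)
      ultimately show ?case by blast
    qed
    from this[OF order_refl] show ?thesis by (elim bexE) (auto intro!: bexI)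
  qed
  obtain \<kappa> where Q: "coord_algebra ?A D \<kappa>"
    and \<kappa>: "\<And>f i. f \<in> carrier ?K \<Longrightarrow> i < D \<Longrightarrow> \<kappa> (I +>\<^bsub>?K\<^esub> f) i = \<phi> f i"
  proof (rule K.quotient_coordinates[OF I, of D \<phi>])
    show "\<exists>f\<in>carrier ?K. \<forall>i<D. \<phi> f i = x i" for x by (rule surj)
    show "f \<in> I \<longleftrightarrow> (\<forall>i<D. \<phi> f i = 0)" if "f \<in> carrier ?K" for f by (rule \<phi>_ker[OF that])
  qed (simp_all add: \<phi>_add \<phi>_scale)
  interpret Q: coord_algebra ?A D \<kappa> by (rule Q)
  note qs = K.quot_simps[OF I]
  have basis: "Q.basis j = I +>\<^bsub>?K\<^esub> w (xs ! j)" if "j < D" for j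
  proof (rule Q.coord_inj)
    have wj: "w (xs ! j) \<in> carrier ?K" by (rule wK[OF xsN[OF that]])
    show "I +>\<^bsub>?K\<^esub> w (xs ! j) \<in> carrier ?A" by (rule K.quot_closed[OF I wj])
    show "\<kappa> (Q.basis j) i = \<kappa> (I +>\<^bsub>?K\<^esub> w (xs ! j)) i" if "i < D" for i
      using \<kappa>[OF wj that] \<phi>_basis[OF \<open>j < D\<close> that] Q.coord_basis[OF that] by simp
  qed simp
  have prod: "\<kappa> (Q.basis k \<otimes>\<^bsub>?A\<^esub> Q.basis j) i = \<phi> (word (ws ! (xs ! j) @ ws ! (xs ! k))) i"
    if "k < D" "j < D" "i < D" for k j i
  proof -
    have kj: "w (xs ! k) \<in> carrier ?K" "w (xs ! j) \<in> carrier ?K" using wK xsN that by auto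
    have "w (xs ! k) \<otimes>\<^bsub>?K\<^esub> w (xs ! j) = word (ws ! (xs ! j) @ ws ! (xs ! k))"
      unfolding w_def by (rule word_mult) (use ws_arcs xsN that in auto)
    then show ?thesis
      unfolding basis[OF that(1)] basis[OF that(2)] qs(2)[OF kj] using \<kappa>[OF K.m_closed[OF kj] that(3)] by simp
  qed
  have nonempty: "0 < length (ws ! (xs ! k))" if "0 < k" "k < D" for k
  proof -
    have "1 \<le> xs ! k" using xs_less[OF that] xs012 by simp
    from ws_mono[OF this xsN[OF that(2)]] have "length [a] \<le> length (ws ! (xs ! k))" unfolding ws012 .
    moreover have "length [a] = 1" by simp
    ultimately show ?thesis by linarith
  qed
  have arcs_app: "set (ws ! (xs ! j) @ ws ! (xs ! k)) \<subseteq> arcs Q" if "j < D" "k < D" for j k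
    using ws_arcs[OF xsN[OF that(1)]] ws_arcs[OF xsN[OF that(2)]] by simp
  have "triangular_algebra ?A D \<kappa>"
  proof
    show "0 < D" using D3 by simp
    show "\<kappa> \<one>\<^bsub>?A\<^esub> i = (if i = 0 then 1 else 0)" if "i < D" for i
    proof -
      have "\<one>\<^bsub>?K\<^esub> = w (xs ! 0)" by (simp add: w_def xs012 ws012)
      then show ?thesis
        unfolding qs(3)[OF K.one_closed K.one_closed] using \<kappa>[OF K.one_closed that] \<phi>_basis[of 0 i] that D3 by simp
    qed
    fix k j i :: nat assume k: "0 < k" "k < D" and j: "j < D" and i: "i \<le> j"
    have iD: "i < D" using i j by simp
    have lt: "xs ! i < Suc (xs ! j)" using xs_le[OF i j] by simp
    show "\<kappa> (Q.basis k \<otimes>\<^bsub>?A\<^esub> Q.basis j) i = 0"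
      unfolding prod[OF k(2) j iD]
      by (rule \<phi>_later[OF longer[OF arcs_app[OF j k(2)] xsN[OF j]] iD lt]) (use nonempty[OF k] in simp)
    show "\<kappa> (Q.basis j \<otimes>\<^bsub>?A\<^esub> Q.basis k) i = 0"
      unfolding prod[OF j k(2) iD]
      by (rule \<phi>_later[OF longer[OF arcs_app[OF k(2) j] xsN[OF j]] iD lt]) (use nonempty[OF k] in simp)
  qed
  moreover have "\<kappa> (Q.basis k \<otimes>\<^bsub>?A\<^esub> Q.basis 1) i = 0" if k: "0 < k" "k < D" and i: "i < 3" for k i
  proof -
    have D: "1 < D" "i < D" "2 < N" using D3 i N3 by auto
    have "xs ! i < Suc 2" using i xs012 by (auto simp: less_Suc_eq numeral_3_eq_3 numeral_2_eq_2)
    then show ?thesis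
      unfolding prod[OF k(2) D(1,2)]
      by (intro \<phi>_later[OF longer[OF arcs_app[OF D(1) k(2)] D(3)] D(2)]) (use nonempty[OF k] ws012 xs012 in simp_all)
  qed
  ultimately show ?thesis by (rule triangular_algebra_not_geometrically_irreducible[OF _ D3])
qed

end

theorem proposition1p5:
  fixes Q :: "('v, 'e) pre_digraph"
    and I :: "(('v \<times> 'e list) \<Rightarrow>\<^sub>0 'k::alg_closed_field) set"
  assumes "fin_digraph Q"
    and "admissible_ideal Q I"
    and "card (verts Q) = 1"
  defines "A \<equiv> quotient_algebra (path_algebra Q) I"
  shows "(geometrically_irreducible A \<longleftrightarrow> card (arcs Q) \<le> 1) \<and>
         (card (arcs Q) \<le> 1 \<longleftrightarrow> (\<exists>m\<ge>1. algebra_isomorphic A (truncated_poly_algebra m)))"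
proof -
  obtain v where v: "verts Q = {v}" using assms(3) by (rule card_1_singletonE)
  interpret one_vertex_quiver Q v using assms(1) v by (rule one_vertex_quiver.intro)
  have I: "ideal I (path_algebra Q)" using assms(2) by (simp add: admissible_ideal_def)
  have kA: "k_algebra A"
    unfolding A_def by (rule k_algebra.k_algebra_quot[OF k_algebra_KQ[OF ideal.axioms(2)[OF I]] I])
  have 1: "\<exists>m\<ge>1. algebra_isomorphic A (truncated_poly_algebra m)" if card: "card (arcs Q) \<le> 1"
  proof -
    obtain D \<kappa> where A: "truncated_algebra A D \<kappa>"
      using truncated_if_at_most_one_arrow[OF assms(2) card] unfolding A_def by blast
    then have D: "0 < D" by (rule truncated_algebra.D_pos)
    obtain \<mu> where "truncated_algebra (truncated_poly_algebra D :: ('k, 'k poly set) module) D \<mu>"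
      using truncated_poly_algebra[OF D] by blast
    from truncated_algebras_isomorphic[OF A this] show ?thesis using D by (intro exI[of _ D]) auto
  qed
  have 2: "geometrically_irreducible A" if iso: "algebra_isomorphic A (truncated_poly_algebra m)" and "m \<ge> 1" for m
  proof -
    have "0 < m" using \<open>m \<ge> 1\<close> by simp
    then obtain \<mu> where "truncated_algebra (truncated_poly_algebra m :: ('k, 'k poly set) module) m \<mu>"
      using truncated_poly_algebra by blast
    from algebra_isomorphic_truncated[OF kA this iso] show ?thesis
      by (elim exE) (rule truncated_algebra_geometrically_irreducible)
  qed
  have 3: "card (arcs Q) \<le> 1" if "geometrically_irreducible A"
  proof (rule ccontr)
    assume "\<not> card (arcs Q) \<le> 1"
    moreover have "finite (arcs Q)" using assms(1) by (simp add: fin_digraph_def fin_digraph_axioms_def)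
    ultimately obtain a b where "a \<in> arcs Q" "b \<in> arcs Q" "a \<noteq> b"
      by (metis One_nat_def card_le_Suc0_iff_eq)
    from not_geometrically_irreducible_if_two_arrows[OF assms(2) this] that show False
      unfolding A_def by blast
  qed
  show ?thesis using 1 2 3 by blast
qed

end
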